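(* Let $k\in\mathbb{N}$, $k\geq 1$, and $\gamma=(k+1,2,1^{k-1})\vdash 2k+2$, and write $s_\gamma*s_\gamma=\sum_{\lambda\in P(2k+2)}g(\gamma,\gamma,\lambda)s_\lambda$. If $\lambda\in P(2k+2)$ has Durfee size $1$, then $g(\gamma,\gamma,\lambda)\neq0$. Moreover, if $\lambda=(a,1^b)\vdash 2k+2$ with $a>b$, then $$g(\gamma,\gamma,\lambda)=\begin{cases}1&\text{if } b=0,\\ 2&\text{if } b=1,\\ 4&\text{if } b=2,\\ 6&\text{if } b>2.\end{cases}$$
   Context: $P(n)$ is the set of partitions of $n$. $s_\lambda$ is the Schur function, $*$ is the Kronecker (internal) product of symmetric functions, and $g(\lambda,\mu,\nu)=\langle\chi^\lambda,\chi^\mu\otimes\chi^\nu\rangle$ is the Kronecker coefficient, where $\chi^\lambda$ is the irreducible character of the symmetric group indexed by $\lambda$. The Durfee size of $\lambda$ is the largest $d$ such that the square $(d^d)$ is contained in the Young diagram of $\lambda$; partitions of Durfee size $1$ are the hooks $(a,1^b)$.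
   Formalization: The case k=1 is excluded (k≥2 is assumed), because there γ=(2,2) and s_γ*s_γ = s_4+s_{22}+s_{1111}, so g(γ,γ,(3,1))=0 although (3,1) has Durfee size 1 and the formula claims 2. *)

theory Defs
  imports
    Complex_Main
    "HOL-Combinatorics.Permutations"
    "HOL-Library.Function_Algebras"
begin

section \<open>Partitions, diagrams and Durfee size\<close>

text \<open>Partitions are weakly decreasing lists of positive parts. Rows and columns of Young diagrams
  are indexed from 0 (English convention).\<close>

definition partitions :: "nat \<Rightarrow> nat list set" where
  "partitions n = {l. sorted_wrt (\<ge>) l \<and> 0 \<notin> set l \<and> sum_list l = n}"

definition diagram :: "nat list \<Rightarrow> (nat \<times> nat) set" where
  "diagram l = {(i, j). i < length l \<and> j < l ! i}"

definition durfee :: "nat list \<Rightarrow> nat" where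
  "durfee l = (GREATEST d. {..<d} \<times> {..<d} \<subseteq> diagram l)"

text \<open>The canonical tableau of shape \<open>l\<close> is filled with \<open>0, 1, 2, \<dots>\<close> row by row;
  entry \<open>x < sum_list l\<close> lies in the following row and column.\<close>

definition row_of :: "nat list \<Rightarrow> nat \<Rightarrow> nat" where
  "row_of l x = (LEAST i. x < sum_list (take (Suc i) l))"

definition col_of :: "nat list \<Rightarrow> nat \<Rightarrow> nat" where
  "col_of l x = x - sum_list (take (row_of l x) l)"


section \<open>The group algebra of the symmetric group\<close>

definition sym_group :: "nat \<Rightarrow> (nat \<Rightarrow> nat) set" where
  "sym_group n = {\<sigma>. \<sigma> permutes {..<n}}"

text \<open>An element \<open>\<Sum> x(\<sigma>) \<sigma>\<close> of the complex group algebra is represented by its coefficient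
  function, which vanishes outside the symmetric group.\<close>

type_synonym galg = "(nat \<Rightarrow> nat) \<Rightarrow> complex"

definition group_algebra :: "nat \<Rightarrow> galg set" where
  "group_algebra n = {x. \<forall>\<sigma>. \<sigma> \<notin> sym_group n \<longrightarrow> x \<sigma> = 0}"

definition gmult :: "nat \<Rightarrow> galg \<Rightarrow> galg \<Rightarrow> galg" where
  "gmult n x y = (\<lambda>\<sigma>. \<Sum>\<tau>\<in>sym_group n. x \<tau> * y (inv \<tau> \<circ> \<sigma>))"

definition gelem :: "(nat \<Rightarrow> nat) \<Rightarrow> galg" where
  "gelem \<sigma> = (\<lambda>\<tau>. if \<tau> = \<sigma> then 1 else 0)"

definition fscale :: "complex \<Rightarrow> ('a \<Rightarrow> complex) \<Rightarrow> 'a \<Rightarrow> complex" where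
  "fscale c x = (\<lambda>\<sigma>. c * x \<sigma>)"

global_interpretation fvs: vector_space "fscale :: complex \<Rightarrow> ('a \<Rightarrow> complex) \<Rightarrow> 'a \<Rightarrow> complex"
  by unfold_locales (auto simp: fscale_def fun_eq_iff algebra_simps)

text \<open>Trace of a linear endomorphism \<open>f\<close> of a finite-dimensional subspace \<open>V\<close>, read off from the
  diagonal of its matrix in some basis \<open>B\<close> of \<open>V\<close>.\<close>

definition trace_on :: "('a \<Rightarrow> complex) set \<Rightarrow> (('a \<Rightarrow> complex) \<Rightarrow> 'a \<Rightarrow> complex) \<Rightarrow> complex" where
  "trace_on V f =
    (let B = (SOME B. fvs.independent B \<and> fvs.span B = V)
     in \<Sum>b\<in>B. fvs.representation B (f b) b)"


section \<open>Irreducible characters and Kronecker coefficients\<close>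

definition row_group :: "nat list \<Rightarrow> (nat \<Rightarrow> nat) set" where
  "row_group l = {\<sigma> \<in> sym_group (sum_list l). \<forall>x<sum_list l. row_of l (\<sigma> x) = row_of l x}"

definition col_group :: "nat list \<Rightarrow> (nat \<Rightarrow> nat) set" where
  "col_group l = {\<sigma> \<in> sym_group (sum_list l). \<forall>x<sum_list l. col_of l (\<sigma> x) = col_of l x}"

text \<open>The Young symmetrizer, (sum over the row group) times (signed sum over the column group).\<close>

definition young_symmetrizer :: "nat list \<Rightarrow> galg" where
  "young_symmetrizer l =
    gmult (sum_list l)
      (\<lambda>\<sigma>. if \<sigma> \<in> row_group l then 1 else 0)
      (\<lambda>\<sigma>. if \<sigma> \<in> col_group l then of_int (sign \<sigma>) else 0)"

text \<open>The irreducible module indexed by \<open>l\<close>: the left ideal generated by the Young symmetrizer. With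
  this convention \<open>[n]\<close> gives the trivial and \<open>[1, \<dots>, 1]\<close> the sign representation.\<close>

definition specht :: "nat list \<Rightarrow> galg set" where
  "specht l = (\<lambda>x. gmult (sum_list l) x (young_symmetrizer l)) ` group_algebra (sum_list l)"

definition irr_char :: "nat list \<Rightarrow> (nat \<Rightarrow> nat) \<Rightarrow> complex" where
  "irr_char l \<sigma> = trace_on (specht l) (gmult (sum_list l) (gelem \<sigma>))"

definition char_inner ::
  "nat \<Rightarrow> ((nat \<Rightarrow> nat) \<Rightarrow> complex) \<Rightarrow> ((nat \<Rightarrow> nat) \<Rightarrow> complex) \<Rightarrow> complex" where
  "char_inner n \<phi> \<psi> = (\<Sum>\<sigma>\<in>sym_group n. \<phi> \<sigma> * cnj (\<psi> \<sigma>)) / fact n"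

text \<open>Meaningful when \<open>l\<close>, \<open>m\<close>, \<open>p\<close> are partitions of the same number. The character of a tensor
  product is the pointwise product of the characters.\<close>

definition kronecker :: "nat list \<Rightarrow> nat list \<Rightarrow> nat list \<Rightarrow> complex" where
  "kronecker l m p =
    char_inner (sum_list l) (irr_char l) (\<lambda>\<sigma>. irr_char m \<sigma> * irr_char p \<sigma>)"

end

theory Submission
  imports Defs
begin

text \<open>For a permutation \<open>\<sigma>\<close> let \<open>F(q)\<close> be the sum of \<open>sgn(\<sigma>|S) q^|S|\<close> over the subsets \<open>S\<close> stable under
  \<open>\<sigma>\<close>. The character of the hook \<open>(n - b, 1^b)\<close> at \<open>\<sigma>\<close> is the coefficient of \<open>q^b\<close> in \<open>F / (1 + q)\<close>, and by
  Giambelli's formula the character of \<open>\<gamma>\<close> is \<open>m\<close> times the coefficient of \<open>q^k\<close> in \<open>F / (1 + q)^2\<close> minus the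
  coefficient of \<open>q^(k+1)\<close> in \<open>F\<close>, where \<open>m\<close> is the number of fixed points.

  The average of \<open>F(x) F(y) F(z)\<close> over the symmetric group counts the orbits of triples of subsets with a
  restriction on the regions of their Venn diagram; this gives the generating function
  \<open>(1 + t^2 xyz) / ((1 - t) (1 - txy) (1 - txz) (1 - tyz))\<close> for the Kronecker coefficients of three hooks. Averages
  involving \<open>m\<close> or \<open>m^2\<close> reduce to point stabilizers, so the coefficients for \<open>\<gamma>\<close> are finite combinations of
  those for hooks.

  To identify these class functions with the characters of the ideals generated by Young symmetrizers
  \<open>c\<close>, where \<open>c^2 = \<kappa> c\<close>, note that those characters have norm \<open>1\<close>, and that the inner product of a class
  function \<open>f\<close> with such a character is the coefficient of the identity in \<open>f c / \<kappa>\<close>. Expanding \<open>f\<close> into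
  products of symmetrizers and antisymmetrizers, almost all terms are killed by \<open>c\<close>, and the inner product
  is \<open>1\<close>. As \<open>f\<close> also has norm \<open>1\<close>, it equals the character.\<close>

text \<open>Two real class functions of norm 1 with inner product 1 differ by a function of norm 1 -
  2 + 1 = 0, which spares the computation of any character value. The norm of the candidate for
  \<gamma> is itself a Kronecker sum, the case b = 0 with the trivial character, so one generating
  function both identifies the character and yields the answer.

  The factors 1 + q have two sources. By Pieri's rule a coefficient of F is a sum of two
  neighbouring hooks, so hooks belong to F / (1 + q). And a fixed point contributes a factor 1 + q
  to F, so on a point stabilizer one factor cancels; hence m times a coefficient of F / (1 + q)^2 is
  induced from a hook on one point fewer.

  The expansion in symmetrizers collapses at a critical size of S: for smaller S the symmetrized
  points outnumber the columns, so two of them share a column and c kills the term; for larger S the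
  truncated weight is 0. For the near hook two families of terms survive. They are reconciled by
  splitting an antisymmetrizer over cosets, which also produces the minus sign in Giambelli's
  formula.\<close>

section \<open>Kronecker products of hooks: the arithmetic\<close>

text \<open>The coefficient of \<open>t^m x^a y^b z^c\<close> in \<open>1 / ((1 - t) (1 - txy) (1 - txz) (1 - tyz))\<close>. The exponents
  are integers, so that shifted indices need no case distinction.\<close>

definition triangle_ind :: "int \<Rightarrow> int \<Rightarrow> int \<Rightarrow> int \<Rightarrow> int" where
  "triangle_ind m a b c =
    of_bool (even (a + b + c) \<and> c \<le> a + b \<and> b \<le> a + c \<and> a \<le> b + c \<and> a + b + c \<le> 2 * m)"

text \<open>The coefficient of \<open>t^(n-1) x^a y^b z^c\<close> in \<open>(1 + t^2 xyz) / ((1 - t) (1 - txy) (1 - txz) (1 - tyz))\<close>;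
  it turns out to be the multiplicity of the trivial character in the product of the characters of the
  hooks of size \<open>n\<close> with legs \<open>a\<close>, \<open>b\<close>, \<open>c\<close>.\<close>

definition hook_triple :: "int \<Rightarrow> int \<Rightarrow> int \<Rightarrow> int \<Rightarrow> int" where
  "hook_triple n a b c = triangle_ind (n - 1) a b c + triangle_ind (n - 3) (a - 1) (b - 1) (c - 1)"

text \<open>Counts the sizes of the eight regions of a Venn diagram of three subsets of \<open>{..<n}\<close> of sizes \<open>a\<close>, \<open>b\<close>,
  \<open>c\<close> in which the four regions inside an odd number of the sets have size at most \<open>1\<close>. The generating
  function is \<open>(1 + tx) (1 + ty) (1 + tz) (1 + txyz) / ((1 - t) (1 - txy) (1 - txz) (1 - tyz))\<close>.\<close>

definition table_count :: "int \<Rightarrow> int \<Rightarrow> int \<Rightarrow> int \<Rightarrow> int" where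
  "table_count n a b c = (\<Sum>o1\<in>{0,1}. \<Sum>o2\<in>{0,1}. \<Sum>o3\<in>{0,1}. \<Sum>o4\<in>{0,1}.
     triangle_ind (n - o1 - o2 - o3 - o4) (a - o1 - o4) (b - o2 - o4) (c - o3 - o4))"

lemma triangle_ind_odd: "odd (a + b + c) \<Longrightarrow> triangle_ind m a b c = 0"
  by (simp add: triangle_ind_def)

text \<open>\<open>i\<close>, \<open>j\<close>, \<open>l\<close>, \<open>m\<close> are the exponents
  of t, txy, txz, tyz in the monomial t^n x^a y^b z^c; once the parity is right, the four
  inequalities of \<open>triangle_ind\<close> say that these exponents are nonnegative.\<close>

lemma triangle_ind_even:
  assumes "a = j + l" "b = j + m" "c = l + m" "n = i + j + l + m"
  shows "triangle_ind n a b c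
     = of_bool (i \<ge> 0) * of_bool (j \<ge> 0) * of_bool (l \<ge> 0) * of_bool (m \<ge> 0)"
proof -
  have e: "(j + l) + (j + m) + (l + m) = 2 * (j + l + m)" by simp
  have "even ((j + l) + (j + m) + (l + m))" unfolding e by simp
  then show ?thesis unfolding triangle_ind_def assms by auto
qed

text \<open>Let D be the common denominator. Then (1 + tx) (1 + ty) (1 + tz) (1 + txyz) - t (1 + x)
  (1 + y) (1 + z) (1 + t^2 xyz) = D, so the two generating functions differ by the constant 1, which
  \<open>n > 0\<close> excludes.\<close>

lemma table_count_eq:
  assumes "n > 0"
  shows "table_count n a b c =
    (\<Sum>d1\<in>{0,1}. \<Sum>d2\<in>{0,1}. \<Sum>d3\<in>{0,1}. hook_triple n (a - d1) (b - d2) (c - d3))"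
proof (cases "even (a + b + c)")
  case True
  define j where "j = (a + b - c) div 2"
  define l where "l = (a + c - b) div 2"
  define m where "m = (b + c - a) div 2"
  define i where "i = n - j - l - m"
  have s: "a = j + l" "b = j + m" "c = l + m" "n = i + j + l + m"
    using True unfolding i_def j_def l_def m_def by presburger+
  define u where "u i j l m = (of_bool (i \<ge> 0) * of_bool (j \<ge> 0) * of_bool (l \<ge> 0) * of_bool (m \<ge> 0) :: int)" for i j l m :: int
  have T: "triangle_ind n a b c = u i j l m" if "a = j + l \<and> b = j + m \<and> c = l + m \<and> n = i + j + l + m"
    for n a b c i j l m using triangle_ind_even that unfolding u_def by blast
  \<comment> \<open>The numerator \<open>(1 - t) (1 - txy) (1 - txz) (1 - tyz)\<close> cancels the denominator.\<close>
  have pm: "of_bool (x \<ge> 0) - of_bool (x - 1 \<ge> 0) = (of_bool (x = 0) :: int)" for x :: int by auto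
  have prod: "(of_bool (i \<ge> 0) - of_bool (i - 1 \<ge> 0)) * (of_bool (j \<ge> 0) - of_bool (j - 1 \<ge> 0)) *
     (of_bool (l \<ge> 0) - of_bool (l - 1 \<ge> 0)) * (of_bool (m \<ge> 0) - of_bool (m - 1 \<ge> 0)) = (0::int)"
    unfolding pm using assms s by auto
  have key: "u i j l m + u (i-1) (j-1) l m + u (i-1) j (l-1) m + u (i-1) j l (m-1)
     + u i (j-1) (l-1) m + u i (j-1) l (m-1) + u i j (l-1) (m-1) + u (i-1) (j-1) (l-1) (m-1)
   = u (i-1) j l m + u i (j-1) l m + u i j (l-1) m + u i j l (m-1)
     + u (i-1) (j-1) (l-1) m + u (i-1) (j-1) l (m-1) + u (i-1) j (l-1) (m-1) + u i (j-1) (l-1) (m-1)"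
    using prod unfolding u_def by (simp only: algebra_simps)
  have F:
    "triangle_ind n a b c = u i j l m"
    "triangle_ind (n - 2) (a - 1) (b - 1) (c - 2) = u i j (l - 1) (m - 1)"
    "triangle_ind (n - 2) (a - 1) (b - 2) (c - 1) = u i (j - 1) l (m - 1)"
    "triangle_ind (n - 2) a (b - 1) (c - 1) = u (i - 1) j l (m - 1)"
    "triangle_ind (n - 2) (a - 2) (b - 1) (c - 1) = u i (j - 1) (l - 1) m"
    "triangle_ind (n - 2) (a - 1) b (c - 1) = u (i - 1) j (l - 1) m"
    "triangle_ind (n - 2) (a - 1) (b - 1) c = u (i - 1) (j - 1) l m"
    "triangle_ind (n - 4) (a - 2) (b - 2) (c - 2) = u (i - 1) (j - 1) (l - 1) (m - 1)"
    "triangle_ind (n - 1) a b c = u (i - 1) j l m"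
    "triangle_ind (n - 3) (a - 1) (b - 1) (c - 2) = u (i - 1) j (l - 1) (m - 1)"
    "triangle_ind (n - 3) (a - 1) (b - 2) (c - 1) = u (i - 1) (j - 1) l (m - 1)"
    "triangle_ind (n - 1) a (b - 1) (c - 1) = u i j l (m - 1)"
    "triangle_ind (n - 3) (a - 2) (b - 1) (c - 1) = u (i - 1) (j - 1) (l - 1) m"
    "triangle_ind (n - 1) (a - 1) b (c - 1) = u i j (l - 1) m"
    "triangle_ind (n - 1) (a - 1) (b - 1) c = u i (j - 1) l m"
    "triangle_ind (n - 3) (a - 2) (b - 2) (c - 2) = u i (j - 1) (l - 1) (m - 1)"
    by (rule T, use s in linarith)+
  have O: "triangle_ind n' a' b' c' = 0" if "odd (a' + b' + c')" for n' a' b' c'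
    using triangle_ind_odd[OF that] .
  show ?thesis
   unfolding table_count_def hook_triple_def
    using True key by (simp add: F O)
next
  case False
  \<comment> \<open>For odd a + b + c the shifts of even total degree vanish; the remaining terms on
    the two sides agree one by one.\<close>
  have F:
    "triangle_ind (n) (a) (b) (c) = 0"
    "triangle_ind (n - 2) (a - 1) (b - 1) (c - 2) = 0"
    "triangle_ind (n - 2) (a - 1) (b - 2) (c - 1) = 0"
    "triangle_ind (n - 2) (a) (b - 1) (c - 1) = 0"
    "triangle_ind (n - 2) (a - 2) (b - 1) (c - 1) = 0"
    "triangle_ind (n - 2) (a - 1) (b) (c - 1) = 0"
    "triangle_ind (n - 2) (a - 1) (b - 1) (c) = 0"
    "triangle_ind (n - 4) (a - 2) (b - 2) (c - 2) = 0"
    "triangle_ind (n - 1) (a) (b) (c) = 0"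
    "triangle_ind (n - 3) (a - 1) (b - 1) (c - 2) = 0"
    "triangle_ind (n - 3) (a - 1) (b - 2) (c - 1) = 0"
    "triangle_ind (n - 1) (a) (b - 1) (c - 1) = 0"
    "triangle_ind (n - 3) (a - 2) (b - 1) (c - 1) = 0"
    "triangle_ind (n - 1) (a - 1) (b) (c - 1) = 0"
    "triangle_ind (n - 1) (a - 1) (b - 1) (c) = 0"
    "triangle_ind (n - 3) (a - 2) (b - 2) (c - 2) = 0"
    by (rule triangle_ind_odd, use False in presburger)+
  show ?thesis
    unfolding table_count_def hook_triple_def
    by (simp add: F)
qed

text \<open>The three groups of terms come from \<open>m^2 f^2\<close>, \<open>2 m f g\<close> and \<open>g^2\<close> in the square of the character
  \<open>m f - g\<close> of the near hook (\<open>near_hook_fun\<close> below), where the fixed point counts \<open>m\<close> and \<open>m^2\<close> move the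
  sums to the symmetric groups on one and on one or two points less.\<close>

definition near_hook_mult :: "int \<Rightarrow> int \<Rightarrow> int" where
  "near_hook_mult k c =
     (let T1 = hook_triple (2 * k + 1); T2 = hook_triple (2 * k); T0 = hook_triple (2 * k + 2);
          W = (\<lambda>T a b. T a b c + T a b (c - 1));
          W2 = (\<lambda>T a b. T a b c + 2 * T a b (c - 1) + T a b (c - 2))
      in W T1 k k + (W2 T2 k k + W2 T2 k (k - 1) + W2 T2 (k - 1) k + W2 T2 (k - 1) (k - 1))
         - 2 * (W T1 k (k + 1) + 2 * W T1 k k + W T1 k (k - 1))
         + (T0 (k + 1) (k + 1) c + T0 (k + 1) k c + T0 k (k + 1) c + T0 k k c))"

text \<open>\<gamma> is self-conjugate, so tensoring with the sign character gives the symmetry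
  between c and 2k + 1 - c, whence the minimum. For k = 1 the diagram is (2,2), whose Kronecker
  square [4] + [2,2] + [1^4] misses (3,1); the formula starts at k = 2.\<close>

lemma near_hook_mult_eq:
  assumes "k \<ge> 2" "0 \<le> c" "c \<le> 2 * k + 1"
  shows "near_hook_mult k c =
    (let m = min c (2 * k + 1 - c) in if m = 0 then 1 else if m = 1 then 2 else if m = 2 then 4 else 6)"
proof -
  consider "c = 0" | "c = 1" | "c = 2" | "c = 2 * k + 1" | "c = 2 * k" | "c = 2 * k - 1"
    | "3 \<le> c" "c \<le> 2 * k - 2" using assms by linarith
  then show ?thesis
  proof cases
    case 7
    then show ?thesis using assms unfolding near_hook_mult_def hook_triple_def triangle_ind_def Let_def
      by (cases "even c") (simp_all add: min_def, presburger+)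
  qed (use assms in \<open>simp_all add: near_hook_mult_def hook_triple_def triangle_ind_def Let_def min_def\<close>)
qed

section \<open>The symmetric group and signs of restrictions\<close>

lemma finite_sym_group [simp]: "finite (sym_group n)"
  unfolding sym_group_def by (rule finite_permutations) simp

lemma card_sym_group: "card (sym_group n) = fact n"
  unfolding sym_group_def by (rule card_permutations) simp_all

lemma sym_group_id [simp]: "id \<in> sym_group n"
  unfolding sym_group_def by (simp add: permutes_id)

lemma sym_group_comp [simp]: "\<sigma> \<in> sym_group n \<Longrightarrow> \<tau> \<in> sym_group n \<Longrightarrow> \<sigma> \<circ> \<tau> \<in> sym_group n"
  unfolding sym_group_def by (simp add: permutes_compose)

lemma sym_group_inv [simp]: "\<sigma> \<in> sym_group n \<Longrightarrow> inv \<sigma> \<in> sym_group n"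
  unfolding sym_group_def by (simp add: permutes_inv)

lemma sym_group_bij: "\<sigma> \<in> sym_group n \<Longrightarrow> bij \<sigma>"
  unfolding sym_group_def by (simp add: permutes_bij)

lemma sym_group_inj: "\<sigma> \<in> sym_group n \<Longrightarrow> inj \<sigma>"
  by (simp add: bij_is_inj sym_group_bij)

lemma sym_group_permutation: "\<sigma> \<in> sym_group n \<Longrightarrow> permutation \<sigma>"
  unfolding sym_group_def using permutation_permutes by blast

lemma sym_group_transpose [simp]: "x < n \<Longrightarrow> y < n \<Longrightarrow> transpose x y \<in> sym_group n"
  unfolding sym_group_def by (simp add: permutes_swap_id)

lemma sym_group_inv_comp [simp]:
  assumes "\<sigma> \<in> sym_group n"
  shows "\<sigma> \<circ> inv \<sigma> = id" "inv \<sigma> \<circ> \<sigma> = id" "\<sigma> (inv \<sigma> x) = x" "inv \<sigma> (\<sigma> x) = x"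
    "\<sigma> \<circ> (inv \<sigma> \<circ> \<rho>) = \<rho>" "inv \<sigma> \<circ> (\<sigma> \<circ> \<rho>) = \<rho>"
    "(\<rho> \<circ> \<sigma>) \<circ> inv \<sigma> = \<rho>" "(\<rho> \<circ> inv \<sigma>) \<circ> \<sigma> = \<rho>" "inv (inv \<sigma>) = \<sigma>"
    "\<sigma> ` inv \<sigma> ` S = S" "inv \<sigma> ` \<sigma> ` S = S"
proof -
  have b: "bij \<sigma>" using assms by (rule sym_group_bij)
  then show "\<sigma> \<circ> inv \<sigma> = id" "inv \<sigma> \<circ> \<sigma> = id" "\<sigma> (inv \<sigma> x) = x" "inv \<sigma> (\<sigma> x) = x"
    "\<sigma> \<circ> (inv \<sigma> \<circ> \<rho>) = \<rho>" "inv \<sigma> \<circ> (\<sigma> \<circ> \<rho>) = \<rho>"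
    "(\<rho> \<circ> \<sigma>) \<circ> inv \<sigma> = \<rho>" "(\<rho> \<circ> inv \<sigma>) \<circ> \<sigma> = \<rho>" "inv (inv \<sigma>) = \<sigma>"
    "\<sigma> ` inv \<sigma> ` S = S" "inv \<sigma> ` \<sigma> ` S = S"
    by (auto simp: fun_eq_iff bij_is_inj bij_is_surj surj_f_inv_f inv_inv_eq image_image)
qed

lemma sym_group_inv_distrib:
  "\<sigma> \<in> sym_group n \<Longrightarrow> \<tau> \<in> sym_group n \<Longrightarrow> inv (\<sigma> \<circ> \<tau>) = inv \<tau> \<circ> inv \<sigma>"
  by (simp add: o_inv_distrib sym_group_bij)

lemma bij_betw_comp_left: "\<tau> \<in> sym_group n \<Longrightarrow> bij_betw (\<lambda>\<sigma>. \<tau> \<circ> \<sigma>) (sym_group n) (sym_group n)"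
  by (rule bij_betwI[where g = "\<lambda>\<sigma>. inv \<tau> \<circ> \<sigma>"]) auto

lemma bij_betw_comp_right: "\<tau> \<in> sym_group n \<Longrightarrow> bij_betw (\<lambda>\<sigma>. \<sigma> \<circ> \<tau>) (sym_group n) (sym_group n)"
  by (rule bij_betwI[where g = "\<lambda>\<sigma>. \<sigma> \<circ> inv \<tau>"]) auto

lemma bij_betw_inv_sym_group: "bij_betw inv (sym_group n) (sym_group n)"
  by (rule bij_betwI[where g = inv]) auto

lemma sum_sym_group_left:
  "\<tau> \<in> sym_group n \<Longrightarrow> (\<Sum>\<sigma>\<in>sym_group n. f (\<tau> \<circ> \<sigma>)) = (\<Sum>\<sigma>\<in>sym_group n. f \<sigma>)"
  using sum.reindex_bij_betw[OF bij_betw_comp_left] .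

lemma sum_sym_group_right:
  "\<tau> \<in> sym_group n \<Longrightarrow> (\<Sum>\<sigma>\<in>sym_group n. f (\<sigma> \<circ> \<tau>)) = (\<Sum>\<sigma>\<in>sym_group n. f \<sigma>)"
  using sum.reindex_bij_betw[OF bij_betw_comp_right] .

lemma sum_sym_group_inv: "(\<Sum>\<sigma>\<in>sym_group n. f (inv \<sigma>)) = (\<Sum>\<sigma>\<in>sym_group n. f \<sigma>)"
  using sum.reindex_bij_betw[OF bij_betw_inv_sym_group] .

lemma sum_sym_group_conj:
  assumes "\<tau> \<in> sym_group n"
  shows "(\<Sum>\<sigma>\<in>sym_group n. f (\<tau> \<circ> \<sigma> \<circ> inv \<tau>)) = (\<Sum>\<sigma>\<in>sym_group n. f \<sigma>)"
  using sum_sym_group_left[OF assms, of "\<lambda>\<sigma>. f (\<sigma> \<circ> inv \<tau>)"]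
    sum_sym_group_right[OF sym_group_inv[OF assms], of f] by simp

section \<open>Signs of permutations on stable subsets\<close>

definition restr :: "nat set \<Rightarrow> (nat \<Rightarrow> nat) \<Rightarrow> nat \<Rightarrow> nat" where
  "restr S \<sigma> = (\<lambda>x. if x \<in> S then \<sigma> x else x)"

definition rsign :: "nat set \<Rightarrow> (nat \<Rightarrow> nat) \<Rightarrow> int" where
  "rsign S \<sigma> = sign (restr S \<sigma>)"

lemma restr_permutes:
  assumes "inj \<sigma>" "\<sigma> ` S = S"
  shows "restr S \<sigma> permutes S"
proof (rule bij_imp_permutes)
  have "bij_betw \<sigma> S S" using assms by (auto simp: bij_betw_def intro: inj_on_subset)
  then show "bij_betw (restr S \<sigma>) S S"
    by (rule bij_betw_cong[THEN iffD1, rotated]) (simp add: restr_def)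
qed (simp add: restr_def)

lemma restr_permutation: "finite S \<Longrightarrow> inj \<sigma> \<Longrightarrow> \<sigma> ` S = S \<Longrightarrow> permutation (restr S \<sigma>)"
  using restr_permutes permutation_permutes by blast

lemma rsign_comp:
  assumes "finite S" "inj \<sigma>" "\<sigma> ` S = S" "inj \<tau>" "\<tau> ` S = S"
  shows "rsign S (\<sigma> \<circ> \<tau>) = rsign S \<sigma> * rsign S \<tau>"
proof -
  have "restr S (\<sigma> \<circ> \<tau>) = restr S \<sigma> \<circ> restr S \<tau>"
    using assms(5) by (auto simp: restr_def fun_eq_iff)
  then show ?thesis unfolding rsign_def using assms by (simp add: sign_compose restr_permutation)
qed

lemma rsign_Un:
  assumes "finite S" "finite T" "S \<inter> T = {}" "inj \<sigma>" "\<sigma> ` S = S" "\<sigma> ` T = T"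
  shows "rsign (S \<union> T) \<sigma> = rsign S \<sigma> * rsign T \<sigma>"
proof -
  have "restr (S \<union> T) \<sigma> = restr S \<sigma> \<circ> restr T \<sigma>"
    using assms(3,5,6) by (auto simp: restr_def fun_eq_iff)
  then show ?thesis unfolding rsign_def using assms by (simp add: sign_compose restr_permutation)
qed

lemma rsign_le_1:
  assumes "finite S" "inj \<sigma>" "\<sigma> ` S = S" "card S \<le> 1"
  shows "rsign S \<sigma> = 1"
proof -
  have "restr S \<sigma> = id"
  proof (cases "S = {}")
    case False
    then obtain x where "S = {x}" using assms(1,4) by (metis card_1_singletonE card_0_eq le_Suc_eq le_zero_eq One_nat_def)
    then show ?thesis using assms(3) by (auto simp: restr_def fun_eq_iff)
  qed (auto simp: restr_def)
  then show ?thesis by (simp add: rsign_def)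
qed

lemma rsign_sq [simp]: "rsign S \<sigma> * rsign S \<sigma> = 1"
  by (simp add: rsign_def sign_def)

lemma rsign_transpose:
  assumes "x \<noteq> y" "x \<in> S \<longleftrightarrow> y \<in> S"
  shows "rsign S (transpose x y) = (if x \<in> S then - 1 else 1)"
proof -
  have "restr S (transpose x y) = (if x \<in> S then transpose x y else id)"
    using assms(2) by (auto simp: restr_def fun_eq_iff transpose_def)
  then show ?thesis using assms(1) by (simp add: rsign_def sign_swap_id)
qed

lemma transpose_image_same: "x \<in> S \<longleftrightarrow> y \<in> S \<Longrightarrow> transpose x y ` S = S"
  by (auto simp: transpose_def image_iff)

lemma rsign_conj:
  assumes "\<tau> \<in> sym_group n" "\<sigma> \<in> sym_group n" "\<sigma> ` S = S" "S \<subseteq> {..<n}"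
  shows "rsign (\<tau> ` S) (\<tau> \<circ> \<sigma> \<circ> inv \<tau>) = rsign S \<sigma>"
proof -
  have i: "inj \<tau>" "inj \<sigma>" using assms by (auto intro: sym_group_inj)
  have f: "finite S" using assms(4) finite_subset by blast
  have "restr (\<tau> ` S) (\<tau> \<circ> \<sigma> \<circ> inv \<tau>) = \<tau> \<circ> restr S \<sigma> \<circ> inv \<tau>"
  proof
    fix x
    have "x \<in> \<tau> ` S \<longleftrightarrow> inv \<tau> x \<in> S"
    proof
      assume "x \<in> \<tau> ` S"
      then obtain y where "y \<in> S" "x = \<tau> y" by blast
      then show "inv \<tau> x \<in> S" using assms(1) by simp
    next
      assume "inv \<tau> x \<in> S"
      then have "\<tau> (inv \<tau> x) \<in> \<tau> ` S" by (rule imageI)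
      then show "x \<in> \<tau> ` S" using assms(1) by simp
    qed
    then show "restr (\<tau> ` S) (\<tau> \<circ> \<sigma> \<circ> inv \<tau>) x = (\<tau> \<circ> restr S \<sigma> \<circ> inv \<tau>) x"
      using assms(1) by (simp add: restr_def)
  qed
  moreover have "permutation \<tau>" "permutation (inv \<tau>)"
    using assms(1) sym_group_permutation[of _ n] by simp_all
  moreover have "permutation (restr S \<sigma>)" using restr_permutation[OF f i(2) assms(3)] .
  ultimately show ?thesis unfolding rsign_def
    by (simp add: sign_compose permutation_compose sign_inverse sign_idempotent mult.commute mult.left_commute)
qed

text \<open>Venn regions, subsets and pointed subsets are all encoded as colourings, so that every
  transitivity claim below reduces to comparing the sizes of colour classes.\<close>

lemma colouring_orbit:
  fixes f g :: "nat \<Rightarrow> 'c"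
  assumes "\<And>p. card {x \<in> {..<n}. f x = p} = card {x \<in> {..<n}. g x = p}"
  obtains \<sigma> where "\<sigma> \<in> sym_group n" "\<And>x. x < n \<Longrightarrow> f x = g (\<sigma> x)"
proof -
  have cnt: "count (image_mset h (mset_set {..<n})) p = card {x \<in> {..<n}. h x = p}" for h :: "nat \<Rightarrow> 'c" and p
    by (auto simp: count_image_mset' intro: arg_cong[where f = card])
  have "image_mset f (mset_set {..<n}) = image_mset g (mset_set {..<n})"
    by (rule multiset_eqI) (simp only: cnt assms)
  then obtain \<sigma> where "\<sigma> permutes {..<n}" "\<forall>x\<in>{..<n}. f x = g (\<sigma> x)"
    by (rule image_mset_eq_implies_permutes[rotated]) auto
  then show ?thesis using that by (auto simp: sym_group_def)
qed

section \<open>Class functions from stable subsets\<close>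

text \<open>Along one orbit the stabilizers add up to the whole group, so each orbit contributes n!.
  \<open>inv_of\<close> is a complete invariant whose values stand for the orbits.\<close>

lemma orbit_count:
  fixes act :: "(nat \<Rightarrow> nat) \<Rightarrow> 's \<Rightarrow> 's" and inv_of :: "'s \<Rightarrow> 'r"
  assumes fin: "finite A"
    and closed: "\<And>\<sigma> s. \<sigma> \<in> sym_group n \<Longrightarrow> s \<in> A \<Longrightarrow> act \<sigma> s \<in> A"
    and comp: "\<And>\<sigma> \<tau> s. act (\<sigma> \<circ> \<tau>) s = act \<sigma> (act \<tau> s)"
    and id: "\<And>s. act id s = s"
    and orbit: "\<And>s t. s \<in> A \<Longrightarrow> t \<in> A \<Longrightarrow> inv_of s = inv_of t \<longleftrightarrow> (\<exists>\<sigma>\<in>sym_group n. act \<sigma> s = t)"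
  shows "(\<Sum>s\<in>A. card {\<sigma> \<in> sym_group n. act \<sigma> s = s}) = fact n * card (inv_of ` A)"
proof -
  have "(\<Sum>s\<in>A. card {\<sigma> \<in> sym_group n. act \<sigma> s = s})
     = (\<Sum>r\<in>inv_of ` A. \<Sum>s\<in>{s \<in> A. inv_of s = r}. card {\<sigma> \<in> sym_group n. act \<sigma> s = s})"
    using sum.image_gen[OF fin] .
  also have "\<dots> = (\<Sum>r\<in>inv_of ` A. fact n)"
  proof (rule sum.cong[OF refl])
    fix r assume "r \<in> inv_of ` A"
    then obtain t where t: "t \<in> A" "inv_of t = r" by auto
    have "card {\<sigma> \<in> sym_group n. act \<sigma> s = s} = card {\<sigma> \<in> sym_group n. act \<sigma> t = s}"
      if s: "s \<in> A" "inv_of s = r" for s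
    proof -
      obtain \<tau> where \<tau>: "\<tau> \<in> sym_group n" "act \<tau> t = s" using orbit t s by metis
      then have \<tau>': "act (inv \<tau>) s = t" using comp[of "inv \<tau>" \<tau> t] id by simp
      have "bij_betw (\<lambda>\<sigma>. \<sigma> \<circ> \<tau>) {\<sigma> \<in> sym_group n. act \<sigma> s = s} {\<sigma> \<in> sym_group n. act \<sigma> t = s}"
        by (rule bij_betwI[where g = "\<lambda>\<sigma>. \<sigma> \<circ> inv \<tau>"]) (use \<tau> \<tau>' in \<open>auto simp: comp\<close>)
      then show ?thesis by (rule bij_betw_same_card)
    qed
    then have "(\<Sum>s\<in>{s \<in> A. inv_of s = r}. card {\<sigma> \<in> sym_group n. act \<sigma> s = s})
       = (\<Sum>s\<in>{s \<in> A. inv_of s = r}. card {\<sigma> \<in> sym_group n. act \<sigma> t = s})"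
      by (intro sum.cong) auto
    also have "\<dots> = card (\<Union>s\<in>{s \<in> A. inv_of s = r}. {\<sigma> \<in> sym_group n. act \<sigma> t = s})"
      by (rule card_UN_disjoint[symmetric]) (use fin in auto)
    also have "(\<Union>s\<in>{s \<in> A. inv_of s = r}. {\<sigma> \<in> sym_group n. act \<sigma> t = s}) = sym_group n"
    proof -
      have "inv_of (act \<sigma> t) = r" if "\<sigma> \<in> sym_group n" for \<sigma>
        proof -
        have "\<exists>\<sigma>'\<in>sym_group n. act \<sigma>' t = act \<sigma> t" using that by blast
        then have "inv_of t = inv_of (act \<sigma> t)" using orbit[OF t(1) closed[OF that t(1)]] by simp
        then show ?thesis using t(2) by simp
      qed
      then show ?thesis using closed t by auto
    qed
    finally show "(\<Sum>s\<in>{s \<in> A. inv_of s = r}. card {\<sigma> \<in> sym_group n. act \<sigma> s = s}) = fact n"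
      by (simp add: card_sym_group)
  qed
  finally show ?thesis by simp
qed

text \<open>For \<open>w = (\<lambda>s. q^s)\<close> this is the product of \<open>1 - (- q)^l\<close> over the cycle lengths \<open>l\<close> of \<open>\<sigma>\<close>.\<close>

definition Phi :: "nat \<Rightarrow> (nat \<Rightarrow> int) \<Rightarrow> (nat \<Rightarrow> nat) \<Rightarrow> int" where
  "Phi n w \<sigma> = (\<Sum>S\<in>{S. S \<subseteq> {..<n} \<and> \<sigma> ` S = S}. w (card S) * rsign S \<sigma>)"

lemma finite_fixsets [simp]: "finite {S. S \<subseteq> {..<n::nat} \<and> P S}"
  by (rule finite_subset[of _ "Pow {..<n}"]) auto

lemma Phi_conj:
  assumes "\<tau> \<in> sym_group n" "\<sigma> \<in> sym_group n"
  shows "Phi n w (\<tau> \<circ> \<sigma> \<circ> inv \<tau>) = Phi n w \<sigma>"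
proof -
  have p: "\<tau> permutes {..<n}" using assms(1) by (simp add: sym_group_def)
  have sub: "\<tau> ` S \<subseteq> {..<n}" if "S \<subseteq> {..<n}" for S
    using that permutes_image[OF p] by blast
  have sub': "inv \<tau> ` S \<subseteq> {..<n}" if "S \<subseteq> {..<n}" for S
    using that permutes_image[OF permutes_inv[OF p]] by blast
  have inj: "card (\<tau> ` S) = card S" for S
    using card_image inj_on_subset sym_group_inj[OF assms(1)] by blast
  have im: "(\<tau> \<circ> \<sigma> \<circ> inv \<tau>) ` \<tau> ` S = \<tau> ` \<sigma> ` S" for S
    using assms(1) by (simp add: image_image)
  have im': "\<tau> ` S = T \<longleftrightarrow> S = inv \<tau> ` T" for S T
    using assms(1) by (metis sym_group_inv_comp(10,11))
  have bij: "bij_betw (\<lambda>S. \<tau> ` S) {S. S \<subseteq> {..<n} \<and> \<sigma> ` S = S} {S. S \<subseteq> {..<n} \<and> (\<tau> \<circ> \<sigma> \<circ> inv \<tau>) ` S = S}"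
  proof (rule bij_betwI[where g = "\<lambda>S. inv \<tau> ` S"])
    show "(`) \<tau> \<in> {S. S \<subseteq> {..<n} \<and> \<sigma> ` S = S} \<rightarrow> {S. S \<subseteq> {..<n} \<and> (\<tau> \<circ> \<sigma> \<circ> inv \<tau>) ` S = S}"
      using sub im by auto
    show "(`) (inv \<tau>) \<in> {S. S \<subseteq> {..<n} \<and> (\<tau> \<circ> \<sigma> \<circ> inv \<tau>) ` S = S} \<rightarrow> {S. S \<subseteq> {..<n} \<and> \<sigma> ` S = S}"
    proof clarify
      fix S assume S: "S \<subseteq> {..<n}" "(\<tau> \<circ> \<sigma> \<circ> inv \<tau>) ` S = S"
      then have "\<tau> ` (\<sigma> ` inv \<tau> ` S) = S" by (simp add: image_image)
      then have "\<sigma> ` inv \<tau> ` S = inv \<tau> ` S" by (rule iffD1[OF im'])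
      then show "inv \<tau> ` S \<subseteq> {..<n} \<and> \<sigma> ` inv \<tau> ` S = inv \<tau> ` S"
        using sub'[OF S(1)] by simp
    qed
  qed (use assms in auto)
  have "Phi n w \<sigma> = (\<Sum>S\<in>{S. S \<subseteq> {..<n} \<and> \<sigma> ` S = S}. w (card (\<tau> ` S)) * rsign (\<tau> ` S) (\<tau> \<circ> \<sigma> \<circ> inv \<tau>))"
    unfolding Phi_def by (intro sum.cong) (auto simp: rsign_conj[OF assms] inj)
  then show ?thesis unfolding Phi_def
    using sum.reindex_bij_betw[OF bij, of "\<lambda>T. w (card T) * rsign T (\<tau> \<circ> \<sigma> \<circ> inv \<tau>)"] by (simp only:)
qed

text \<open>Stable subsets pair off as S and S with i added, and a fixed point does not affect the
  sign: this is the factor 1 + q contributed by a fixed point.\<close>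

lemma Phi_fixed_point:
  assumes "\<sigma> \<in> sym_group n" "\<sigma> i = i" "i < n"
  shows "Phi n w \<sigma>
    = (\<Sum>S\<in>{S. S \<subseteq> {..<n} - {i} \<and> \<sigma> ` S = S}. (w (card S) + w (Suc (card S))) * rsign S \<sigma>)"
proof -
  have inj: "inj \<sigma>" using sym_group_inj[OF assms(1)] .
  let ?F = "{S. S \<subseteq> {..<n} - {i} \<and> \<sigma> ` S = S}"
  have fin: "finite ?F" by (rule finite_subset[of _ "Pow {..<n}"]) auto
  have *: "{S. S \<subseteq> {..<n} \<and> \<sigma> ` S = S} = ?F \<union> insert i ` ?F" (is "?L = ?R")
  proof
    show "?R \<subseteq> ?L" using assms(2,3) by auto
    show "?L \<subseteq> ?R"
    proof
      fix S assume "S \<in> ?L"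
      then have S: "S \<subseteq> {..<n}" "\<sigma> ` S = S" by auto
      show "S \<in> ?R"
      proof (cases "i \<in> S")
        case True
        have "\<sigma> ` (S - {i}) = S - {i}" using S(2) assms(2) image_set_diff[OF inj, of S "{i}"] by simp
        moreover have "S - {i} \<subseteq> {..<n} - {i}" using S(1) by auto
        moreover have "S = insert i (S - {i})" using True by blast
        ultimately show ?thesis by blast
      next
        case False
        then show ?thesis using S by auto
      qed
    qed
  qed
  have "Phi n w \<sigma> = (\<Sum>S\<in>?F. w (card S) * rsign S \<sigma>) + (\<Sum>S\<in>insert i ` ?F. w (card S) * rsign S \<sigma>)"
    unfolding Phi_def * by (rule sum.union_disjoint) (use fin in auto)
  also have "(\<Sum>S\<in>insert i ` ?F. w (card S) * rsign S \<sigma>) = (\<Sum>S\<in>?F. w (card (insert i S)) * rsign (insert i S) \<sigma>)"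
    by (subst sum.reindex) (auto simp: inj_on_def)
  also have "\<dots> = (\<Sum>S\<in>?F. w (Suc (card S)) * rsign S \<sigma>)"
  proof (rule sum.cong[OF refl])
    fix S assume S: "S \<in> ?F"
    then have f: "finite S" "i \<notin> S" using finite_subset[of S "{..<n}"] by auto
    have "restr (insert i S) \<sigma> = restr S \<sigma>" using assms(2) f(2) by (auto simp: restr_def fun_eq_iff)
    then show "w (card (insert i S)) * rsign (insert i S) \<sigma> = w (Suc (card S)) * rsign S \<sigma>"
      using f by (simp add: rsign_def)
  qed
  finally show ?thesis by (simp add: sum.distrib distrib_right)
qed

lemma Phi_restrict:
  assumes "\<sigma> \<in> sym_group n"
  shows "Phi (Suc n) w \<sigma> = Phi n (\<lambda>s. w s + w (Suc s)) \<sigma>"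
proof -
  have "\<sigma> \<in> sym_group (Suc n)" "\<sigma> n = n"
    using assms by (auto simp: sym_group_def permutes_def less_Suc_eq)
  then have "Phi (Suc n) w \<sigma> = (\<Sum>S\<in>{S. S \<subseteq> {..<Suc n} - {n} \<and> \<sigma> ` S = S}. (w (card S) + w (Suc (card S))) * rsign S \<sigma>)"
    by (rule Phi_fixed_point) simp
  moreover have "{..<Suc n} - {n} = {..<n}" by auto
  ultimately show ?thesis by (simp add: Phi_def)
qed

lemma Phi_add: "Phi n (\<lambda>s. v s + w s) \<sigma> = Phi n v \<sigma> + Phi n w \<sigma>"
  unfolding Phi_def by (simp add: sum.distrib distrib_right)

text \<open>With \<open>F\<close> the polynomial in \<open>q\<close> just described, these weights extract the coefficient of \<open>q^b\<close> in
  \<open>F\<close>, \<open>F / (1 + q)\<close> and \<open>F / (1 + q)^2\<close>. The first is the character induced from the trivial times the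
  sign character of \<open>S(n - b) \<times> S(b)\<close>, the second the character of the hook with leg \<open>b\<close>.\<close>

definition delta_wt :: "int \<Rightarrow> nat \<Rightarrow> int" where
  "delta_wt b s = of_bool (int s = b)"

definition alt_wt :: "int \<Rightarrow> nat \<Rightarrow> int" where
  "alt_wt b s = (if int s \<le> b then (- 1) ^ nat (b - int s) else 0)"

definition alt2_wt :: "int \<Rightarrow> nat \<Rightarrow> int" where
  "alt2_wt b s = (if int s \<le> b then (- 1) ^ nat (b - int s) * (b - int s + 1) else 0)"

abbreviation "hook_fun n b \<equiv> Phi n (alt_wt b)"

text \<open>Multiplication by 1 + q cancels one factor of the denominator. It occurs in two forms: a
  shift of the size s, as caused by an additional fixed point, and in \<open>alt_wt_step'\<close> a
  shift of the degree b, as in Pieri's rule.\<close>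

lemma alt_wt_step: "alt_wt b s + alt_wt b (Suc s) = delta_wt b s"
proof (cases "int s < b")
  case True
  then have "nat (b - int s) = Suc (nat (b - int (Suc s)))" by simp
  then show ?thesis using True by (simp add: alt_wt_def delta_wt_def)
qed (auto simp: alt_wt_def delta_wt_def)

lemma alt_wt_step': "alt_wt b s + alt_wt (b - 1) s = delta_wt b s"
proof (cases "int s < b")
  case True
  then have "nat (b - int s) = Suc (nat (b - 1 - int s))" by simp
  then show ?thesis using True by (simp add: alt_wt_def delta_wt_def)
qed (auto simp: alt_wt_def delta_wt_def)

lemma alt2_wt_step: "alt2_wt b s + alt2_wt b (Suc s) = alt_wt b s"
proof (cases "int s < b")
  case True
  then have "nat (b - int s) = Suc (nat (b - int (Suc s)))" by simp
  then show ?thesis using True by (simp add: alt_wt_def alt2_wt_def algebra_simps)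
qed (auto simp: alt_wt_def alt2_wt_def)

text \<open>Pieri's rule: h_(n-b) e_b is the sum of the Schur functions of the hooks with legs b and
  b - 1.\<close>

lemma Phi_delta: "Phi n (delta_wt b) \<sigma> = hook_fun n b \<sigma> + hook_fun n (b - 1) \<sigma>"
  unfolding Phi_add[symmetric] by (simp add: alt_wt_step')

text \<open>The branching rule: removing a box from the arm keeps the leg, removing one from the leg
  shortens it.\<close>

lemma hook_fun_restrict:
  "\<sigma> \<in> sym_group n \<Longrightarrow> hook_fun (Suc n) b \<sigma> = hook_fun n b \<sigma> + hook_fun n (b - 1) \<sigma>"
  by (simp add: Phi_restrict alt_wt_step Phi_delta)

text \<open>At a permutation with a fixed point one factor 1 + q cancels. Hence the fixed point
  count times the class function on the left is induced from the hook with leg b on n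
  points.\<close>

lemma Phi_alt2_restrict:
  "\<sigma> \<in> sym_group n \<Longrightarrow> Phi (Suc n) (alt2_wt b) \<sigma> = hook_fun n b \<sigma>"
  by (simp add: Phi_restrict alt2_wt_step)

lemma hook_fun_neg: "b < 0 \<Longrightarrow> hook_fun n b \<sigma> = 0"
  unfolding Phi_def alt_wt_def by (intro sum.neutral) auto

lemma hook_fun_0: "hook_fun n 0 \<sigma> = 1"
proof -
  have "hook_fun n 0 \<sigma> = (\<Sum>S\<in>{{}}. alt_wt 0 (card S) * rsign S \<sigma>)"
    unfolding Phi_def
    by (rule sum.mono_neutral_right) (auto simp: alt_wt_def finite_subset)
  also have "\<dots> = 1" by (simp add: alt_wt_def rsign_def restr_def flip: id_def)
  finally show ?thesis .
qed

section \<open>Triple products by orbit counting\<close>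

definition stabs :: "nat \<Rightarrow> nat set \<times> nat set \<times> nat set \<Rightarrow> (nat \<Rightarrow> nat) set" where
  "stabs n = (\<lambda>(S, T, U). {\<sigma> \<in> sym_group n. \<sigma> ` S = S \<and> \<sigma> ` T = T \<and> \<sigma> ` U = U})"

text \<open>Cardinalities of the four regions of the Venn diagram lying in an odd number of the sets.\<close>

definition odd_cells :: "nat set \<times> nat set \<times> nat set \<Rightarrow> nat \<times> nat \<times> nat \<times> nat" where
  "odd_cells = (\<lambda>(S, T, U). (card (S - T - U), card (T - S - U), card (U - S - T), card (S \<inter> T \<inter> U)))"

definition good :: "nat set \<times> nat set \<times> nat set \<Rightarrow> bool" where
  "good = (\<lambda>(S, T, U). card (S - T - U) \<le> 1 \<and> card (T - S - U) \<le> 1 \<and> card (U - S - T) \<le> 1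
     \<and> card (S \<inter> T \<inter> U) \<le> 1)"

lemma image_comp_fixed: "\<sigma> ` A = A \<Longrightarrow> \<tau> ` A = A \<Longrightarrow> (\<sigma> \<circ> \<tau>) ` A = A"
  by (metis image_comp)

text \<open>Composing with the transposition of two points of one region is a bijection of the
  stabilizer; it flips the sign once for each set containing the region, an odd number of times in
  all.\<close>

lemma sum_stab_rsign_bad:
  assumes "x \<noteq> y" "x < n" "y < n" "x \<in> S \<longleftrightarrow> y \<in> S" "x \<in> T \<longleftrightarrow> y \<in> T" "x \<in> U \<longleftrightarrow> y \<in> U"
    and odd: "odd (of_bool (x \<in> S) + of_bool (x \<in> T) + of_bool (x \<in> U) :: int)"
    and sub: "S \<subseteq> {..<n}" "T \<subseteq> {..<n}" "U \<subseteq> {..<n}"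
  shows "(\<Sum>\<sigma>\<in>stabs n (S, T, U). rsign S \<sigma> * rsign T \<sigma> * rsign U \<sigma>) = 0"
proof -
  let ?t = "transpose x y"
  let ?f = "\<lambda>\<sigma>. rsign S \<sigma> * rsign T \<sigma> * rsign U \<sigma>"
  have t: "?t \<in> sym_group n" using assms by simp
  have im: "?t ` S = S" "?t ` T = T" "?t ` U = U" using assms(4-6) by (auto intro: transpose_image_same)
  have fin: "finite S" "finite T" "finite U" using sub finite_subset by blast+
  have "\<sigma> \<circ> ?t \<in> stabs n (S, T, U)" if "\<sigma> \<in> stabs n (S, T, U)" for \<sigma>
    using that t image_comp_fixed[of \<sigma> _ ?t] im by (auto simp: stabs_def simp del: comp_apply)
  then have st: "\<sigma> \<in> stabs n (S, T, U) \<Longrightarrow> \<sigma> \<circ> ?t \<in> stabs n (S, T, U)" for \<sigma> .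
  have "bij_betw (\<lambda>\<sigma>. \<sigma> \<circ> ?t) (stabs n (S, T, U)) (stabs n (S, T, U))"
    by (rule bij_betwI[where g = "\<lambda>\<sigma>. \<sigma> \<circ> ?t"])
      (simp_all add: comp_assoc st)
  then have "(\<Sum>\<sigma>\<in>stabs n (S, T, U). ?f \<sigma>) = (\<Sum>\<sigma>\<in>stabs n (S, T, U). ?f (\<sigma> \<circ> ?t))"
    by (rule sum.reindex_bij_betw[symmetric])
  also have "\<dots> = (\<Sum>\<sigma>\<in>stabs n (S, T, U). - ?f \<sigma>)"
  proof (rule sum.cong[OF refl])
    fix \<sigma> assume "\<sigma> \<in> stabs n (S, T, U)"
    then have \<sigma>: "inj \<sigma>" "\<sigma> ` S = S" "\<sigma> ` T = T" "\<sigma> ` U = U"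
      using sym_group_inj by (auto simp: stabs_def)
    have "?f (\<sigma> \<circ> ?t) = ?f \<sigma> * (rsign S ?t * rsign T ?t * rsign U ?t)"
      using \<sigma> im fin sym_group_inj[OF t] by (simp add: rsign_comp)
    also have "rsign S ?t * rsign T ?t * rsign U ?t = - 1"
      using assms(1,4-6) odd
      by (cases "x \<in> S"; cases "x \<in> T"; cases "x \<in> U"; simp add: rsign_transpose)
    finally show "?f (\<sigma> \<circ> ?t) = - ?f \<sigma>" by (simp only: mult_minus1_right)
  qed
  finally show ?thesis by (simp add: sum_negf)
qed

text \<open>A region inside exactly two of the sets contributes its sign squared; a region inside
  one or three of them has at most one point, hence sign 1.\<close>

lemma rsign_prod_good:
  assumes "good (S, T, U)" "\<sigma> \<in> stabs n (S, T, U)" "finite S" "finite T" "finite U"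
  shows "rsign S \<sigma> * rsign T \<sigma> * rsign U \<sigma> = 1"
proof -
  have \<sigma>: "inj \<sigma>" "\<sigma> ` S = S" "\<sigma> ` T = T" "\<sigma> ` U = U"
    using assms(2) sym_group_inj by (auto simp: stabs_def)
  note im = image_Int[OF \<sigma>(1)] image_set_diff[OF \<sigma>(1)] \<sigma>(2-4)
  let ?r = "\<lambda>A. rsign A \<sigma>"
  have split: "?r A = ?r (A - B - C) * ?r (A \<inter> B - C) * ?r (A \<inter> C - B) * ?r (A \<inter> B \<inter> C)"
    if "finite A" "\<sigma> ` A = A" "\<sigma> ` B = B" "\<sigma> ` C = C" for A B C
  proof -
    note im = image_Int[OF \<sigma>(1)] image_set_diff[OF \<sigma>(1)] that(2-4)
    have "?r A = ?r ((A - B - C) \<union> (A \<inter> B - C) \<union> (A \<inter> C - B) \<union> (A \<inter> B \<inter> C))"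
      by (rule arg_cong[of _ _ ?r]) blast
    also have "\<dots> = ?r ((A - B - C) \<union> (A \<inter> B - C) \<union> (A \<inter> C - B)) * ?r (A \<inter> B \<inter> C)"
      by (rule rsign_Un) (use that(1) \<sigma>(1) in \<open>auto simp: im image_Un\<close>)
    also have "?r ((A - B - C) \<union> (A \<inter> B - C) \<union> (A \<inter> C - B)) = ?r ((A - B - C) \<union> (A \<inter> B - C)) * ?r (A \<inter> C - B)"
      by (rule rsign_Un) (use that(1) \<sigma>(1) in \<open>auto simp: im image_Un\<close>)
    also have "?r ((A - B - C) \<union> (A \<inter> B - C)) = ?r (A - B - C) * ?r (A \<inter> B - C)"
      by (rule rsign_Un) (use that(1) \<sigma>(1) in \<open>auto simp: im image_Un\<close>)
    finally show ?thesis .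
  qed
  have one: "?r (S - T - U) = 1" "?r (T - S - U) = 1" "?r (U - S - T) = 1" "?r (S \<inter> T \<inter> U) = 1"
    by (rule rsign_le_1, use assms(1,3-5) \<sigma>(1) in \<open>simp_all add: good_def im\<close>)+
  have c: "T \<inter> S - U = S \<inter> T - U" "U \<inter> S - T = S \<inter> U - T" "U \<inter> T - S = T \<inter> U - S"
    "T \<inter> S \<inter> U = S \<inter> T \<inter> U" "U \<inter> S \<inter> T = S \<inter> T \<inter> U" by auto
  have "?r S * ?r T * ?r U = (?r (S \<inter> T - U) * ?r (S \<inter> T - U)) * (?r (S \<inter> U - T) * ?r (S \<inter> U - T))
      * (?r (T \<inter> U - S) * ?r (T \<inter> U - S))"
    using split[of S T U] split[of T S U] split[of U S T] assms(3-5) \<sigma> one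
    by (simp add: c mult_ac del: rsign_sq)
  then show ?thesis by simp
qed

lemma ex_two:
  assumes "card A > 1"
  shows "\<exists>x y. x \<noteq> y \<and> {x, y} \<subseteq> A"
proof -
  have "finite A" using assms card.infinite by fastforce
  then have "\<not> (\<forall>x\<in>A. \<forall>y\<in>A. x = y)" using card_le_Suc0_iff_eq[of A] assms by simp
  then show ?thesis by blast
qed

text \<open>The product of the three signs is a linear character of the stabilizer, so it is trivial
  or sums to 0; \<open>good\<close> is the condition for triviality.\<close>

lemma sum_stab_rsign:
  assumes sub: "S \<subseteq> {..<n}" "T \<subseteq> {..<n}" "U \<subseteq> {..<n}"
  shows "(\<Sum>\<sigma>\<in>stabs n (S, T, U). rsign S \<sigma> * rsign T \<sigma> * rsign U \<sigma>)
     = (if good (S, T, U) then int (card (stabs n (S, T, U))) else 0)"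
proof (cases "good (S, T, U)")
  case True
  have fin: "finite S" "finite T" "finite U" using sub finite_subset by blast+
  show ?thesis using rsign_prod_good[OF True _ fin] True by simp
next
  case False
  then consider "card (S - T - U) > 1" | "card (T - S - U) > 1" | "card (U - S - T) > 1" | "card (S \<inter> T \<inter> U) > 1"
    by (auto simp: good_def not_le)
  then have "\<exists>x y. x \<noteq> y \<and> ({x, y} \<subseteq> S - T - U \<or> {x, y} \<subseteq> T - S - U \<or> {x, y} \<subseteq> U - S - T \<or> {x, y} \<subseteq> S \<inter> T \<inter> U)"
    by cases (use ex_two in meson)+
  then obtain x y where xy: "x \<noteq> y" "{x, y} \<subseteq> S - T - U \<or> {x, y} \<subseteq> T - S - U \<or> {x, y} \<subseteq> U - S - T \<or> {x, y} \<subseteq> S \<inter> T \<inter> U"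
    by blast
  have "(\<Sum>\<sigma>\<in>stabs n (S, T, U). rsign S \<sigma> * rsign T \<sigma> * rsign U \<sigma>) = 0"
    by (rule sum_stab_rsign_bad[of x y]) (use xy sub in auto)
  then show ?thesis using False by simp
qed

definition act3 :: "(nat \<Rightarrow> nat) \<Rightarrow> nat set \<times> nat set \<times> nat set \<Rightarrow> nat set \<times> nat set \<times> nat set" where
  "act3 \<sigma> = (\<lambda>(S, T, U). (\<sigma> ` S, \<sigma> ` T, \<sigma> ` U))"

definition good_triples :: "nat \<Rightarrow> int \<Rightarrow> int \<Rightarrow> int \<Rightarrow> (nat set \<times> nat set \<times> nat set) set" where
  "good_triples n a b c = {(S, T, U). S \<subseteq> {..<n} \<and> T \<subseteq> {..<n} \<and> U \<subseteq> {..<n} \<and>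
     int (card S) = a \<and> int (card T) = b \<and> int (card U) = c \<and> good (S, T, U)}"

lemma finite_good_triples [simp]: "finite (good_triples n a b c)"
  by (rule finite_subset[of _ "Pow {..<n} \<times> Pow {..<n} \<times> Pow {..<n}"]) (auto simp: good_triples_def)

lemma card_act3:
  assumes "\<sigma> \<in> sym_group n"
  shows "card (\<sigma> ` S) = card S" "card (\<sigma> ` S - \<sigma> ` T) = card (S - T)"
    "card (\<sigma> ` S - \<sigma> ` T - \<sigma> ` U) = card (S - T - U)"
    "card (\<sigma> ` S \<inter> \<sigma> ` T \<inter> \<sigma> ` U) = card (S \<inter> T \<inter> U)"
proof -
  have i: "inj \<sigma>" using sym_group_inj[OF assms] .
  have c: "card (\<sigma> ` S) = card S" for S using card_image[OF inj_on_subset[OF i]] by blast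
  show "card (\<sigma> ` S) = card S" "card (\<sigma> ` S - \<sigma> ` T) = card (S - T)"
    "card (\<sigma> ` S - \<sigma> ` T - \<sigma> ` U) = card (S - T - U)"
    "card (\<sigma> ` S \<inter> \<sigma> ` T \<inter> \<sigma> ` U) = card (S \<inter> T \<inter> U)"
    by (simp_all add: image_Int[OF i, symmetric] image_set_diff[OF i, symmetric] c)
qed

lemma odd_cells_act3: "\<sigma> \<in> sym_group n \<Longrightarrow> odd_cells (act3 \<sigma> s) = odd_cells s"
  by (cases s) (simp add: odd_cells_def act3_def card_act3)

lemma good_act3: "\<sigma> \<in> sym_group n \<Longrightarrow> good (act3 \<sigma> s) = good s"
  by (cases s) (simp add: good_def act3_def card_act3)

lemma act3_closed:
  assumes "\<sigma> \<in> sym_group n" "s \<in> good_triples n a b c"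
  shows "act3 \<sigma> s \<in> good_triples n a b c"
proof -
  have p: "\<sigma> permutes {..<n}" using assms(1) by (simp add: sym_group_def)
  have sub: "\<sigma> ` S \<subseteq> {..<n}" if "S \<subseteq> {..<n}" for S
    using that permutes_image[OF p] by blast
  show ?thesis using assms(2) good_act3[OF assms(1), of s] sub
    by (cases s) (auto simp: good_triples_def act3_def card_act3[OF assms(1)])
qed

definition venn :: "nat set \<times> nat set \<times> nat set \<Rightarrow> nat \<Rightarrow> bool \<times> bool \<times> bool" where
  "venn = (\<lambda>(S, T, U) x. (x \<in> S, x \<in> T, x \<in> U))"

lemma card_split3:
  assumes "finite A"
  shows "card A = card (A - B - C) + card (A \<inter> B - C) + card (A \<inter> C - B) + card (A \<inter> B \<inter> C)"
proof -
  have "card A = card ((A - B - C) \<union> (A \<inter> B - C) \<union> (A \<inter> C - B) \<union> (A \<inter> B \<inter> C))"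
    by (rule arg_cong[of _ _ card]) blast
  also have "\<dots> = card (A - B - C) + card (A \<inter> B - C) + card (A \<inter> C - B) + card (A \<inter> B \<inter> C)"
    using assms by (subst card_Un_disjoint, blast, blast, blast)+ simp
  finally show ?thesis .
qed

lemma cells_eq:
  assumes "S \<subseteq> {..<n}" "T \<subseteq> {..<n}" "U \<subseteq> {..<n}"
  shows "card S = card (S - T - U) + card (S \<inter> T - U) + card (S \<inter> U - T) + card (S \<inter> T \<inter> U)"
    "card T = card (T - S - U) + card (S \<inter> T - U) + card (T \<inter> U - S) + card (S \<inter> T \<inter> U)"
    "card U = card (U - S - T) + card (S \<inter> U - T) + card (T \<inter> U - S) + card (S \<inter> T \<inter> U)"
    "n = card (S - T - U) + card (T - S - U) + card (U - S - T) + card (S \<inter> T \<inter> U)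
       + card (S \<inter> T - U) + card (S \<inter> U - T) + card (T \<inter> U - S) + card ({..<n} - S - T - U)"
proof -
  have fin: "finite S" "finite T" "finite U" using assms finite_subset by blast+
  have c: "T \<inter> S = S \<inter> T" "U \<inter> S = S \<inter> U" "U \<inter> T = T \<inter> U" "S \<inter> U \<inter> T = S \<inter> T \<inter> U" by auto
  show S: "card S = card (S - T - U) + card (S \<inter> T - U) + card (S \<inter> U - T) + card (S \<inter> T \<inter> U)"
    using card_split3[OF fin(1)] .
  show "card T = card (T - S - U) + card (S \<inter> T - U) + card (T \<inter> U - S) + card (S \<inter> T \<inter> U)"
    using card_split3[OF fin(2), of S U] by (simp add: c)
  show "card U = card (U - S - T) + card (S \<inter> U - T) + card (T \<inter> U - S) + card (S \<inter> T \<inter> U)"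
    using card_split3[OF fin(3), of S T] by (simp add: c)
  have "n = card (S \<union> ({..<n} - S))" using assms by (simp add: Un_absorb1)
  also have "\<dots> = card S + card ({..<n} - S)" using fin by (subst card_Un_disjoint) auto
  also have "card ({..<n} - S) = card ({..<n} - S - T - U) + card (({..<n} - S) \<inter> T - U)
     + card (({..<n} - S) \<inter> U - T) + card (({..<n} - S) \<inter> T \<inter> U)"
    by (rule card_split3) simp
  also have "({..<n} - S) \<inter> T - U = T - S - U" using assms by auto
  also have "({..<n} - S) \<inter> U - T = U - S - T" using assms by auto
  also have "({..<n} - S) \<inter> T \<inter> U = T \<inter> U - S" using assms by auto
  finally show "n = card (S - T - U) + card (T - S - U) + card (U - S - T) + card (S \<inter> T \<inter> U)
       + card (S \<inter> T - U) + card (S \<inter> U - T) + card (T \<inter> U - S) + card ({..<n} - S - T - U)"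
    using S by linarith
qed

text \<open>The total n, the sizes a, b, c and the four odd regions determine the four even regions
  through the linear equations \<open>cells_eq\<close>. This is why \<open>odd_cells\<close> is a
  complete orbit invariant.\<close>

lemma venn_orbit:
  assumes s: "s \<in> good_triples n a b c" and t: "t \<in> good_triples n a b c"
    and eq: "odd_cells s = odd_cells t"
  shows "\<exists>\<sigma>\<in>sym_group n. act3 \<sigma> s = t"
proof -
  obtain S T U where S: "s = (S, T, U)" by (cases s)
  obtain S' T' U' where T: "t = (S', T', U')" by (cases t)
  have sub: "S \<subseteq> {..<n}" "T \<subseteq> {..<n}" "U \<subseteq> {..<n}" "S' \<subseteq> {..<n}" "T' \<subseteq> {..<n}" "U' \<subseteq> {..<n}"
    and cards: "card S = card S'" "card T = card T'" "card U = card U'"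
    using s t by (auto simp: S T good_triples_def)
  note c = cells_eq[OF sub(1-3)] cells_eq[OF sub(4-6)]
  have o: "card (S - T - U) = card (S' - T' - U')" "card (T - S - U) = card (T' - S' - U')"
    "card (U - S - T) = card (U' - S' - T')" "card (S \<inter> T \<inter> U) = card (S' \<inter> T' \<inter> U')"
    using eq by (auto simp: S T odd_cells_def)
  have e: "card (S \<inter> T - U) = card (S' \<inter> T' - U')" "card (S \<inter> U - T) = card (S' \<inter> U' - T')"
    "card (T \<inter> U - S) = card (T' \<inter> U' - S')" "card ({..<n} - S - T - U) = card ({..<n} - S' - T' - U')"
    using c o cards by linarith+
  have reg: "{x \<in> {..<n}. venn (S, T, U) x = (p, q, r)} =
      (if p then if q then if r then S \<inter> T \<inter> U else S \<inter> T - U else if r then S \<inter> U - T else S - T - U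
       else if q then if r then T \<inter> U - S else T - S - U else if r then U - S - T else {..<n} - S - T - U)"
    if "S \<subseteq> {..<n}" "T \<subseteq> {..<n}" "U \<subseteq> {..<n}" for S T U p q r
    using that by (auto simp: venn_def)
  have "card {x \<in> {..<n}. venn s x = p} = card {x \<in> {..<n}. venn t x = p}" for p
    unfolding S T by (cases p) (simp only: reg[OF sub(1-3)] reg[OF sub(4-6)] o e split: if_split, simp)
  then obtain \<sigma> where \<sigma>: "\<sigma> \<in> sym_group n" "\<And>x. x < n \<Longrightarrow> venn s x = venn t (\<sigma> x)"
    by (rule colouring_orbit) blast
  then have p: "\<sigma> permutes {..<n}" by (simp add: sym_group_def)
  have im: "\<sigma> ` A = B" if AB: "A \<subseteq> {..<n}" "B \<subseteq> {..<n}" "\<And>x. x \<in> {..<n} \<Longrightarrow> x \<in> A \<longleftrightarrow> \<sigma> x \<in> B" for A B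
  proof
    show "\<sigma> ` A \<subseteq> B" using AB by auto
    show "B \<subseteq> \<sigma> ` A"
    proof
      fix y assume "y \<in> B"
      then obtain x where "x \<in> {..<n}" "y = \<sigma> x" using AB(2) permutes_image[OF p] by blast
      then show "y \<in> \<sigma> ` A" using AB(3) \<open>y \<in> B\<close> by blast
    qed
  qed
  have "\<sigma> ` S = S'" "\<sigma> ` T = T'" "\<sigma> ` U = U'"
    by (rule im; use \<sigma>(2) sub in \<open>simp add: S T venn_def\<close>)+
  then have "act3 \<sigma> s = t" by (simp add: act3_def S T)
  then show ?thesis using \<sigma>(1) by blast
qed

lemma sum_good_stabs:
  "(\<Sum>s\<in>good_triples n a b c. card (stabs n s)) = fact n * card (odd_cells ` good_triples n a b c)"
proof -
  have "(\<Sum>s\<in>good_triples n a b c. card {\<sigma> \<in> sym_group n. act3 \<sigma> s = s}) = fact n * card (odd_cells ` good_triples n a b c)"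
  proof (rule orbit_count)
    show "odd_cells s = odd_cells t \<longleftrightarrow> (\<exists>\<sigma>\<in>sym_group n. act3 \<sigma> s = t)"
      if "s \<in> good_triples n a b c" "t \<in> good_triples n a b c" for s t
      using venn_orbit[OF that] odd_cells_act3 by metis
    show "act3 \<sigma> s \<in> good_triples n a b c" if "\<sigma> \<in> sym_group n" "s \<in> good_triples n a b c" for \<sigma> s
      using that by (rule act3_closed)
  qed (auto simp: act3_def image_comp split: prod.splits)
  moreover have "{\<sigma> \<in> sym_group n. act3 \<sigma> s = s} = stabs n s" for s
    by (cases s) (auto simp: act3_def stabs_def)
  ultimately show ?thesis by simp
qed

lemma Phi_delta_sum:
  "Phi n (delta_wt a) \<sigma> = (\<Sum>S\<in>{S. S \<subseteq> {..<n} \<and> int (card S) = a}. of_bool (\<sigma> ` S = S) * rsign S \<sigma>)"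
proof -
  have "Phi n (delta_wt a) \<sigma> = (\<Sum>S\<in>{S. S \<subseteq> {..<n}}. of_bool (\<sigma> ` S = S) * (delta_wt a (card S) * rsign S \<sigma>))"
    unfolding Phi_def
    by (rule sum.mono_neutral_cong_left) auto
  also have "\<dots> = (\<Sum>S\<in>{S. S \<subseteq> {..<n} \<and> int (card S) = a}. of_bool (\<sigma> ` S = S) * (delta_wt a (card S) * rsign S \<sigma>))"
    by (rule sum.mono_neutral_right) (auto simp: delta_wt_def)
  also have "\<dots> = (\<Sum>S\<in>{S. S \<subseteq> {..<n} \<and> int (card S) = a}. of_bool (\<sigma> ` S = S) * rsign S \<sigma>)"
    by (rule sum.cong) (auto simp: delta_wt_def)
  finally show ?thesis .
qed

lemma sum3_product:
  fixes f g h :: "'a \<Rightarrow> 'b::comm_semiring_0"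
  shows "sum f A * sum g B * sum h C = (\<Sum>x\<in>A. \<Sum>y\<in>B. \<Sum>z\<in>C. f x * g y * h z)"
proof -
  have "sum f A * sum g B * sum h C = (\<Sum>x\<in>A. \<Sum>y\<in>B. f x * g y) * sum h C"
    by (simp only: sum_product)
  also have "\<dots> = (\<Sum>x\<in>A. \<Sum>y\<in>B. f x * g y * sum h C)"
    by (simp only: sum_distrib_right)
  finally show ?thesis by (simp only: sum_distrib_left)
qed

lemma sum_Phi_delta3_cells:
  "(\<Sum>\<sigma>\<in>sym_group n. Phi n (delta_wt a) \<sigma> * Phi n (delta_wt b) \<sigma> * Phi n (delta_wt c) \<sigma>)
    = fact n * int (card (odd_cells ` good_triples n a b c))"
proof -
  let ?Q = "\<lambda>a. {S. S \<subseteq> {..<n} \<and> int (card S) = a}"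
  let ?g = "\<lambda>\<sigma> S. of_bool (\<sigma> ` S = S) * rsign S \<sigma>"
  have "(\<Sum>\<sigma>\<in>sym_group n. Phi n (delta_wt a) \<sigma> * Phi n (delta_wt b) \<sigma> * Phi n (delta_wt c) \<sigma>)
    = (\<Sum>\<sigma>\<in>sym_group n. \<Sum>S\<in>?Q a. \<Sum>T\<in>?Q b. \<Sum>U\<in>?Q c. ?g \<sigma> S * ?g \<sigma> T * ?g \<sigma> U)"
    unfolding Phi_delta_sum by (intro sum.cong refl sum3_product)
  also have "\<dots> = (\<Sum>S\<in>?Q a. \<Sum>T\<in>?Q b. \<Sum>U\<in>?Q c. \<Sum>\<sigma>\<in>sym_group n. ?g \<sigma> S * ?g \<sigma> T * ?g \<sigma> U)"
    by (subst sum.swap, intro sum.cong refl)+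
  also have "\<dots> = (\<Sum>S\<in>?Q a. \<Sum>T\<in>?Q b. \<Sum>U\<in>?Q c. (if good (S, T, U) then int (card (stabs n (S, T, U))) else 0))"
  proof (intro sum.cong refl)
    fix S T U assume "S \<in> ?Q a" "T \<in> ?Q b" "U \<in> ?Q c"
    then have sub: "S \<subseteq> {..<n}" "T \<subseteq> {..<n}" "U \<subseteq> {..<n}" by auto
    have "(\<Sum>\<sigma>\<in>sym_group n. ?g \<sigma> S * ?g \<sigma> T * ?g \<sigma> U) = (\<Sum>\<sigma>\<in>stabs n (S, T, U). rsign S \<sigma> * rsign T \<sigma> * rsign U \<sigma>)"
      by (rule sum.mono_neutral_cong_right) (auto simp: stabs_def)
    then show "(\<Sum>\<sigma>\<in>sym_group n. ?g \<sigma> S * ?g \<sigma> T * ?g \<sigma> U) = (if good (S, T, U) then int (card (stabs n (S, T, U))) else 0)"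
      using sum_stab_rsign[OF sub] by simp
  qed
  also have "\<dots> = (\<Sum>s\<in>?Q a \<times> ?Q b \<times> ?Q c. if good s then int (card (stabs n s)) else 0)"
    by (simp add: sum.cartesian_product)
  also have "\<dots> = (\<Sum>s\<in>good_triples n a b c. int (card (stabs n s)))"
    by (rule sum.mono_neutral_cong_right) (auto simp: good_triples_def)
  also have "\<dots> = int (\<Sum>s\<in>good_triples n a b c. card (stabs n s))" by simp
  also have "\<dots> = fact n * int (card (odd_cells ` good_triples n a b c))"
    unfolding sum_good_stabs by simp
  finally show ?thesis .
qed

lemma exists_triple_with_cells:
  assumes "r1 + r2 + r3 + r4 + e12 + e13 + e23 + e0 = n"
  obtains S T U where "S \<subseteq> {..<n}" "T \<subseteq> {..<n}" "U \<subseteq> {..<n}"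
    "card (S - T - U) = r1" "card (T - S - U) = r2" "card (U - S - T) = r3" "card (S \<inter> T \<inter> U) = r4"
    "card (S \<inter> T - U) = e12" "card (S \<inter> U - T) = e13" "card (T \<inter> U - S) = e23"
proof -
  \<comment> \<open>Points are positions in a list of membership patterns, so region sizes become
    lengths of filtered lists.\<close>
  define xs where "xs = replicate r1 (True, False, False) @ replicate r2 (False, True, False)
    @ replicate r3 (False, False, True) @ replicate r4 (True, True, True)
    @ replicate e12 (True, True, False) @ replicate e13 (True, False, True)
    @ replicate e23 (False, True, True) @ replicate e0 (False, False, False)"
  have len: "length xs = n" using assms by (simp add: xs_def)
  define S where "S = {i. i < length xs \<and> fst (xs ! i)}"
  define T where "T = {i. i < length xs \<and> fst (snd (xs ! i))}"
  define U where "U = {i. i < length xs \<and> snd (snd (xs ! i))}"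
  have cell: "card A = length (filter P xs)" if "A = {i. i < length xs \<and> P (xs ! i)}" for A P
    unfolding that by (rule length_filter_conv_card[symmetric])
  show ?thesis
  proof (rule that[of S T U])
    show "S \<subseteq> {..<n}" "T \<subseteq> {..<n}" "U \<subseteq> {..<n}" unfolding S_def T_def U_def len by auto
    show "card (S - T - U) = r1"
      by (subst cell[where P = "\<lambda>z. fst z \<and> \<not> fst (snd z) \<and> \<not> snd (snd z)"]) (auto simp: S_def T_def U_def, simp add: xs_def)
    show "card (T - S - U) = r2"
      by (subst cell[where P = "\<lambda>z. \<not> fst z \<and> fst (snd z) \<and> \<not> snd (snd z)"]) (auto simp: S_def T_def U_def, simp add: xs_def)
    show "card (U - S - T) = r3"
      by (subst cell[where P = "\<lambda>z. \<not> fst z \<and> \<not> fst (snd z) \<and> snd (snd z)"]) (auto simp: S_def T_def U_def, simp add: xs_def)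
    show "card (S \<inter> T \<inter> U) = r4"
      by (subst cell[where P = "\<lambda>z. fst z \<and> fst (snd z) \<and> snd (snd z)"]) (auto simp: S_def T_def U_def, simp add: xs_def)
    show "card (S \<inter> T - U) = e12"
      by (subst cell[where P = "\<lambda>z. fst z \<and> fst (snd z) \<and> \<not> snd (snd z)"]) (auto simp: S_def T_def U_def, simp add: xs_def)
    show "card (S \<inter> U - T) = e13"
      by (subst cell[where P = "\<lambda>z. fst z \<and> \<not> fst (snd z) \<and> snd (snd z)"]) (auto simp: S_def T_def U_def, simp add: xs_def)
    show "card (T \<inter> U - S) = e23"
      by (subst cell[where P = "\<lambda>z. \<not> fst z \<and> fst (snd z) \<and> snd (snd z)"]) (auto simp: S_def T_def U_def, simp add: xs_def)
  qed
qed

text \<open>Deleting the odd regions leaves sets in which every point lies in none or in exactly two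
  of them. The four remaining region sizes can be solved for in nonnegative integers exactly when
  \<open>triangle_ind\<close> is 1.\<close>

lemma odd_cells_good_triples:
  "odd_cells ` good_triples n a b c = {(o1, o2, o3, o4).
     o1 \<in> {0,1} \<and> o2 \<in> {0,1} \<and> o3 \<in> {0,1} \<and> o4 \<in> {0,1} \<and>
     triangle_ind (int n - int o1 - int o2 - int o3 - int o4)
       (a - int o1 - int o4) (b - int o2 - int o4) (c - int o3 - int o4) = 1}" (is "?L = ?R")
proof
  show "?L \<subseteq> ?R"
  proof
    fix p assume "p \<in> ?L"
    then obtain S T U where STU: "(S, T, U) \<in> good_triples n a b c" and p: "p = odd_cells (S, T, U)" by auto
    then have sub: "S \<subseteq> {..<n}" "T \<subseteq> {..<n}" "U \<subseteq> {..<n}"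
      and g: "good (S, T, U)" and abc: "a = int (card S)" "b = int (card T)" "c = int (card U)"
      by (auto simp: good_triples_def)
    note c = cells_eq[OF sub]
    define o1 where "o1 = card (S - T - U)"
    define o2 where "o2 = card (T - S - U)"
    define o3 where "o3 = card (U - S - T)"
    define o4 where "o4 = card (S \<inter> T \<inter> U)"
    define j where "j = card (S \<inter> T - U)"
    define l where "l = card (S \<inter> U - T)"
    define m where "m = card (T \<inter> U - S)"
    define i where "i = card ({..<n} - S - T - U)"
    note d = o1_def o2_def o3_def o4_def j_def l_def m_def i_def
    have eqs: "a - int o1 - int o4 = int j + int l" "b - int o2 - int o4 = int j + int m"
      "c - int o3 - int o4 = int l + int m"
      "int n - int o1 - int o2 - int o3 - int o4 = int i + int j + int l + int m"
      using c[folded d] abc by linarith+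
    have "triangle_ind (int n - int o1 - int o2 - int o3 - int o4)
       (a - int o1 - int o4) (b - int o2 - int o4) (c - int o3 - int o4) = 1"
      by (subst triangle_ind_even[OF eqs]) simp
    moreover have "{o1, o2, o3, o4} \<subseteq> {0,1}" using g by (auto simp: good_def o1_def o2_def o3_def o4_def)
    moreover have "p = (o1, o2, o3, o4)" by (simp add: p odd_cells_def d)
    ultimately show "p \<in> ?R" by simp
  qed
  show "?R \<subseteq> ?L"
  proof
    fix p assume "p \<in> ?R"
    then obtain o1 o2 o3 o4 where p: "p = (o1, o2, o3, o4)" "{o1, o2, o3, o4} \<subseteq> {0,1}"
      and t: "triangle_ind (int n - int o1 - int o2 - int o3 - int o4)
       (a - int o1 - int o4) (b - int o2 - int o4) (c - int o3 - int o4) = 1" by auto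
    define A where "A = a - int o1 - int o4"
    define B where "B = b - int o2 - int o4"
    define C where "C = c - int o3 - int o4"
    define N where "N = int n - int o1 - int o2 - int o3 - int o4"
    have c: "even (A + B + C)" "C \<le> A + B" "B \<le> A + C" "A \<le> B + C" "A + B + C \<le> 2 * N"
      using t unfolding A_def[symmetric] B_def[symmetric] C_def[symmetric] N_def[symmetric]
      by (simp_all add: triangle_ind_def)
    define j where "j = (A + B - C) div 2"
    define l where "l = (A + C - B) div 2"
    define m where "m = (B + C - A) div 2"
    define i where "i = N - j - l - m"
    have s: "A = j + l" "B = j + m" "C = l + m" "N = i + j + l + m" "j \<ge> 0" "l \<ge> 0" "m \<ge> 0"
      using c unfolding i_def j_def l_def m_def by presburger+
    have i0: "i \<ge> 0" using s c(5) by linarith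
    have tot: "o1 + o2 + o3 + o4 + nat j + nat l + nat m + nat i = n"
      using s i0 N_def by linarith
    obtain S T U where STU: "S \<subseteq> {..<n}" "T \<subseteq> {..<n}" "U \<subseteq> {..<n}"
    "card (S - T - U) = o1" "card (T - S - U) = o2" "card (U - S - T) = o3" "card (S \<inter> T \<inter> U) = o4"
    "card (S \<inter> T - U) = nat j" "card (S \<inter> U - T) = nat l" "card (T \<inter> U - S) = nat m"
      using exists_triple_with_cells[OF tot] by blast
    have "int (card S) = a" "int (card T) = b" "int (card U) = c"
      using cells_eq(1-3)[OF STU(1-3)] STU(4-10) s A_def B_def C_def by linarith+
    moreover have "good (S, T, U)" using p(2) STU(4-7) by (auto simp: good_def)
    moreover have "p = odd_cells (S, T, U)" using STU(4-7) by (simp add: p odd_cells_def)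
    ultimately show "p \<in> ?L" using STU(1-3) by (auto simp: good_triples_def)
  qed
qed

lemma card_odd_cells: "int (card (odd_cells ` good_triples n a b c)) = table_count (int n) a b c"
proof -
  let ?t = "\<lambda>o1 o2 o3 o4. triangle_ind (int n - int o1 - int o2 - int o3 - int o4)
       (a - int o1 - int o4) (b - int o2 - int o4) (c - int o3 - int o4)"
  let ?B = "{0, 1::nat}"
  let ?P = "\<lambda>(o1, o2, o3, o4). ?t o1 o2 o3 o4 = 1"
  have "odd_cells ` good_triples n a b c = {p \<in> ?B \<times> ?B \<times> ?B \<times> ?B. ?P p}"
    unfolding odd_cells_good_triples by auto
  then have "int (card (odd_cells ` good_triples n a b c)) = (\<Sum>p\<in>?B \<times> ?B \<times> ?B \<times> ?B. of_bool (?P p))"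
    by (simp add: Int_def)
  also have "\<dots> = (\<Sum>p\<in>?B \<times> ?B \<times> ?B \<times> ?B. case p of (o1, o2, o3, o4) \<Rightarrow> ?t o1 o2 o3 o4)"
    by (rule sum.cong) (auto simp: triangle_ind_def)
  also have "\<dots> = (\<Sum>o1\<in>?B. \<Sum>o2\<in>?B. \<Sum>o3\<in>?B. \<Sum>o4\<in>?B. ?t o1 o2 o3 o4)"
    by (simp only: sum.cartesian_product)
  also have "\<dots> = table_count (int n) a b c" by (simp add: table_count_def)
  finally show ?thesis .
qed

lemma sum_Phi_delta3:
  "(\<Sum>\<sigma>\<in>sym_group n. Phi n (delta_wt a) \<sigma> * Phi n (delta_wt b) \<sigma> * Phi n (delta_wt c) \<sigma>)
    = fact n * table_count (int n) a b c"
  by (simp only: sum_Phi_delta3_cells card_odd_cells)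

text \<open>Multiplication by 1 + q is injective on power series.\<close>

lemma alternating_zero:
  fixes D :: "int \<Rightarrow> int"
  assumes step: "\<And>a. D a + D (a - 1) = 0" and neg: "\<And>a. a < 0 \<Longrightarrow> D a = 0"
  shows "D a = 0"
proof (cases "a < 0")
  case False
  then have "0 \<le> a" by simp
  then show ?thesis
    by (induction a rule: int_ge_induct) (use step[of 0] neg[of "-1"] step in \<open>simp_all, smt (verit)\<close>)
qed (rule neg)

lemma hook_triple_neg: "a < 0 \<or> b < 0 \<or> c < 0 \<Longrightarrow> hook_triple n a b c = 0"
  by (auto simp: hook_triple_def triangle_ind_def)

text \<open>Pieri's rule expands the known sums into eight hook sums, and
  \<open>table_count_eq\<close> gives the same expansion in terms of \<open>hook_triple\<close>. The
  difference \<open>X\<close> is therefore killed by (1 + x) (1 + y) (1 + z); \<open>Z\<close> and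
  \<open>Y\<close> strip off these factors one variable at a time.\<close>

lemma sum_hook_fun3:
  assumes "n > 0"
  shows "(\<Sum>\<sigma>\<in>sym_group n. hook_fun n a \<sigma> * hook_fun n b \<sigma> * hook_fun n c \<sigma>)
    = fact n * hook_triple (int n) a b c"
proof -
  define X where "X a b c = (\<Sum>\<sigma>\<in>sym_group n. hook_fun n a \<sigma> * hook_fun n b \<sigma> * hook_fun n c \<sigma>)
    - fact n * hook_triple (int n) a b c" for a b c
  have "(\<Sum>\<sigma>\<in>sym_group n. (hook_fun n a \<sigma> + hook_fun n (a - 1) \<sigma>) * (hook_fun n b \<sigma> + hook_fun n (b - 1) \<sigma>)
      * (hook_fun n c \<sigma> + hook_fun n (c - 1) \<sigma>)) = fact n * table_count (int n) a b c" for a b c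
    using sum_Phi_delta3[of n a b c] by (simp only: Phi_delta)
  then have X8: "X a b c + X (a - 1) b c + X a (b - 1) c + X (a - 1) (b - 1) c
     + X a b (c - 1) + X (a - 1) b (c - 1) + X a (b - 1) (c - 1) + X (a - 1) (b - 1) (c - 1) = 0" for a b c
    using assms unfolding X_def
    by (simp add: table_count_eq algebra_simps sum.distrib)
  have neg: "X a b c = 0" if "a < 0 \<or> b < 0 \<or> c < 0" for a b c
    using that unfolding X_def by (auto simp: hook_triple_neg hook_fun_neg)
  define Y where "Y a b c = X a b c + X (a - 1) b c" for a b c
  define Z where "Z a b c = Y a b c + Y a (b - 1) c" for a b c
  have Z: "Z a b c = 0" for a b c
    by (rule alternating_zero[of "Z a b"]) (use X8 neg in \<open>auto simp: Z_def Y_def algebra_simps\<close>)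
  have Y: "Y a b c = 0" for a b c
    by (rule alternating_zero[of "\<lambda>b. Y a b c"]) (use Z neg in \<open>auto simp: Z_def Y_def\<close>)
  have "X a b c = 0"
    by (rule alternating_zero[of "\<lambda>a. X a b c"]) (use Y neg in \<open>auto simp: Y_def\<close>)
  then show ?thesis by (simp add: X_def)
qed

section \<open>The class function of the near hook\<close>

definition fixpts :: "nat \<Rightarrow> (nat \<Rightarrow> nat) \<Rightarrow> int" where
  "fixpts n \<sigma> = int (card {i. i < n \<and> \<sigma> i = i})"

lemma fixpts_sum: "fixpts n \<sigma> = (\<Sum>i<n. of_bool (\<sigma> i = i))"
proof -
  have "{..<n} \<inter> {i. \<sigma> i = i} = {i. i < n \<and> \<sigma> i = i}" by auto
  then show ?thesis by (simp add: fixpts_def)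
qed

lemma fixpts_conj:
  assumes "\<tau> \<in> sym_group n" "\<sigma> \<in> sym_group n"
  shows "fixpts n (\<tau> \<circ> \<sigma> \<circ> inv \<tau>) = fixpts n \<sigma>"
proof -
  have p: "\<tau> permutes {..<n}" using assms(1) by (simp add: sym_group_def)
  have iff: "(\<tau> \<circ> \<sigma> \<circ> inv \<tau>) (\<tau> i) = \<tau> i \<longleftrightarrow> \<sigma> i = i" for i
    using assms(1) sym_group_inj[OF assms(1)] by (simp add: inj_eq)
  have "(\<Sum>i<n. of_bool ((\<tau> \<circ> \<sigma> \<circ> inv \<tau>) (\<tau> i) = \<tau> i)) = (\<Sum>i<n. of_bool ((\<tau> \<circ> \<sigma> \<circ> inv \<tau>) i = i) :: int)"
    by (rule sum.reindex_bij_betw[OF permutes_imp_bij[OF p]])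
  then show ?thesis unfolding fixpts_sum iff by simp
qed

lemma fixpts_Suc: "\<sigma> \<in> sym_group n \<Longrightarrow> fixpts (Suc n) \<sigma> = fixpts n \<sigma> + 1"
  by (simp add: fixpts_sum sym_group_def permutes_def)

lemma sym_group_Suc_fix: "{\<sigma> \<in> sym_group (Suc n). \<sigma> n = n} = sym_group n"
  by (auto simp: sym_group_def permutes_def less_Suc_eq)

lemma sym_group_Suc: "\<sigma> \<in> sym_group n \<Longrightarrow> \<sigma> \<in> sym_group (Suc n)"
  using sym_group_Suc_fix by blast

text \<open>The count is a sum over points, and all point stabilizers are conjugate to that of the
  last point, which is the symmetric group on one point fewer.\<close>

lemma sum_fixpts:
  fixes f :: "(nat \<Rightarrow> nat) \<Rightarrow> int"
  assumes cls: "\<And>\<sigma> \<tau>. \<sigma> \<in> sym_group (Suc n) \<Longrightarrow> \<tau> \<in> sym_group (Suc n) \<Longrightarrow> f (\<tau> \<circ> \<sigma> \<circ> inv \<tau>) = f \<sigma>"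
  shows "(\<Sum>\<sigma>\<in>sym_group (Suc n). fixpts (Suc n) \<sigma> * f \<sigma>) = int (Suc n) * (\<Sum>\<sigma>\<in>sym_group n. f \<sigma>)"
proof -
  let ?G = "sym_group (Suc n)"
  have "(\<Sum>\<sigma>\<in>?G. fixpts (Suc n) \<sigma> * f \<sigma>) = (\<Sum>\<sigma>\<in>?G. \<Sum>i<Suc n. of_bool (\<sigma> i = i) * f \<sigma>)"
    by (simp only: fixpts_sum sum_distrib_right)
  also have "\<dots> = (\<Sum>i<Suc n. \<Sum>\<sigma>\<in>?G. of_bool (\<sigma> i = i) * f \<sigma>)"
    by (rule sum.swap)
  also have "\<dots> = (\<Sum>i<Suc n. \<Sum>\<sigma>\<in>sym_group n. f \<sigma>)"
  proof (rule sum.cong[OF refl])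
    fix i assume "i \<in> {..<Suc n}"
    then have t: "transpose i n \<in> ?G" by simp
    have "(\<Sum>\<sigma>\<in>?G. of_bool (\<sigma> i = i) * f \<sigma>)
        = (\<Sum>\<sigma>\<in>?G. of_bool ((transpose i n \<circ> \<sigma> \<circ> inv (transpose i n)) i = i) * f (transpose i n \<circ> \<sigma> \<circ> inv (transpose i n)))"
      by (rule sum_sym_group_conj[OF t, symmetric])
    also have "\<dots> = (\<Sum>\<sigma>\<in>?G. of_bool (\<sigma> n = n) * f \<sigma>)"
      by (rule sum.cong[OF refl]) (simp only: cls[OF _ t], simp add: transpose_def)
    also have "\<dots> = (\<Sum>\<sigma>\<in>sym_group n. f \<sigma>)"
      by (rule sum.mono_neutral_cong_right) (use sym_group_Suc_fix[of n] in auto)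
    finally show "(\<Sum>\<sigma>\<in>?G. of_bool (\<sigma> i = i) * f \<sigma>) = (\<Sum>\<sigma>\<in>sym_group n. f \<sigma>)" .
  qed
  finally show ?thesis by simp
qed

text \<open>On the stabilizer of a point the count is one more than the count on the remaining
  points. The two terms correspond to the two orbits on pairs of points, equal and distinct.\<close>

lemma sum_fixpts_sq:
  fixes f :: "(nat \<Rightarrow> nat) \<Rightarrow> int"
  assumes cls: "\<And>\<sigma> \<tau>. \<sigma> \<in> sym_group (Suc (Suc n)) \<Longrightarrow> \<tau> \<in> sym_group (Suc (Suc n)) \<Longrightarrow> f (\<tau> \<circ> \<sigma> \<circ> inv \<tau>) = f \<sigma>"
  shows "(\<Sum>\<sigma>\<in>sym_group (Suc (Suc n)). (fixpts (Suc (Suc n)) \<sigma>)\<^sup>2 * f \<sigma>)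
    = int (Suc (Suc n)) * (\<Sum>\<sigma>\<in>sym_group (Suc n). f \<sigma>)
      + int (Suc (Suc n)) * int (Suc n) * (\<Sum>\<sigma>\<in>sym_group n. f \<sigma>)"
proof -
  let ?m = "fixpts (Suc (Suc n))"
  have "(\<Sum>\<sigma>\<in>sym_group (Suc (Suc n)). (?m \<sigma>)\<^sup>2 * f \<sigma>) = (\<Sum>\<sigma>\<in>sym_group (Suc (Suc n)). ?m \<sigma> * (?m \<sigma> * f \<sigma>))"
    by (simp add: power2_eq_square mult.assoc)
  also have "\<dots> = int (Suc (Suc n)) * (\<Sum>\<sigma>\<in>sym_group (Suc n). ?m \<sigma> * f \<sigma>)"
    by (rule sum_fixpts) (simp only: cls fixpts_conj)
  also have "(\<Sum>\<sigma>\<in>sym_group (Suc n). ?m \<sigma> * f \<sigma>)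
     = (\<Sum>\<sigma>\<in>sym_group (Suc n). f \<sigma>) + (\<Sum>\<sigma>\<in>sym_group (Suc n). fixpts (Suc n) \<sigma> * f \<sigma>)"
    by (simp add: fixpts_Suc distrib_right sum.distrib)
  also have "(\<Sum>\<sigma>\<in>sym_group (Suc n). fixpts (Suc n) \<sigma> * f \<sigma>) = int (Suc n) * (\<Sum>\<sigma>\<in>sym_group n. f \<sigma>)"
    by (rule sum_fixpts) (simp only: cls sym_group_Suc)
  finally show ?thesis by (simp only: distrib_left mult.assoc)
qed

text \<open>Giambelli's formula \<open>s(k|k) s(0|0) - s(k|0) s(0|k)\<close> for the near hook \<open>(k,0|k,0)\<close> in Frobenius notation:
  the first product is the hook \<open>(k + 1, 1^k)\<close> of size \<open>n - 1\<close> induced to \<open>n\<close> points.\<close>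

definition near_hook_fun :: "nat \<Rightarrow> int \<Rightarrow> (nat \<Rightarrow> nat) \<Rightarrow> int" where
  "near_hook_fun n k \<sigma> = fixpts n \<sigma> * Phi n (alt2_wt k) \<sigma> - Phi n (delta_wt (k + 1)) \<sigma>"

lemma near_hook_fun_conj:
  "\<tau> \<in> sym_group n \<Longrightarrow> \<sigma> \<in> sym_group n \<Longrightarrow> near_hook_fun n k (\<tau> \<circ> \<sigma> \<circ> inv \<tau>) = near_hook_fun n k \<sigma>"
  by (simp only: near_hook_fun_def Phi_conj fixpts_conj)

lemma sum_near_hook_fun:
  assumes "k > 0"
  shows "(\<Sum>\<sigma>\<in>sym_group (2 * k + 2). near_hook_fun (2 * k + 2) (int k) \<sigma> * near_hook_fun (2 * k + 2) (int k) \<sigma> * hook_fun (2 * k + 2) c \<sigma>)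
    = fact (2 * k + 2) * near_hook_mult (int k) c"
proof -
  define N where "N = 2 * k"
  have n: "2 * k + 2 = Suc (Suc N)" by (simp add: N_def)
  have N: "N > 0" "int N = 2 * int k" using assms by (simp_all add: N_def)
  let ?K = "int k"
  let ?p = "Phi (Suc (Suc N)) (alt2_wt ?K)"
  let ?H = "Phi (Suc (Suc N)) (delta_wt (?K + 1))"
  let ?m = "fixpts (Suc (Suc N))"
  let ?t = "hook_fun (Suc (Suc N))"
  have "(\<Sum>\<sigma>\<in>sym_group (Suc (Suc N)). near_hook_fun (Suc (Suc N)) ?K \<sigma> * near_hook_fun (Suc (Suc N)) ?K \<sigma> * ?t c \<sigma>)
    = (\<Sum>\<sigma>\<in>sym_group (Suc (Suc N)). (?m \<sigma>)\<^sup>2 * (?p \<sigma> * ?p \<sigma> * ?t c \<sigma>))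
      - 2 * (\<Sum>\<sigma>\<in>sym_group (Suc (Suc N)). ?m \<sigma> * (?p \<sigma> * ?H \<sigma> * ?t c \<sigma>))
      + (\<Sum>\<sigma>\<in>sym_group (Suc (Suc N)). ?H \<sigma> * ?H \<sigma> * ?t c \<sigma>)"
    unfolding near_hook_fun_def sum_distrib_left sum.distrib[symmetric] sum_subtractf[symmetric]
    by (rule sum.cong) (simp_all add: algebra_simps power2_eq_square)
  also have "(\<Sum>\<sigma>\<in>sym_group (Suc (Suc N)). (?m \<sigma>)\<^sup>2 * (?p \<sigma> * ?p \<sigma> * ?t c \<sigma>))
     = int (Suc (Suc N)) * (\<Sum>\<sigma>\<in>sym_group (Suc N). ?p \<sigma> * ?p \<sigma> * ?t c \<sigma>)
      + int (Suc (Suc N)) * int (Suc N) * (\<Sum>\<sigma>\<in>sym_group N. ?p \<sigma> * ?p \<sigma> * ?t c \<sigma>)"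
    by (rule sum_fixpts_sq) (simp only: Phi_conj)
  also have "(\<Sum>\<sigma>\<in>sym_group (Suc (Suc N)). ?m \<sigma> * (?p \<sigma> * ?H \<sigma> * ?t c \<sigma>))
     = int (Suc (Suc N)) * (\<Sum>\<sigma>\<in>sym_group (Suc N). ?p \<sigma> * ?H \<sigma> * ?t c \<sigma>)"
    by (rule sum_fixpts) (simp only: Phi_conj)
  also have "(\<Sum>\<sigma>\<in>sym_group (Suc N). ?p \<sigma> * ?p \<sigma> * ?t c \<sigma>)
     = fact (Suc N) * (hook_triple (int (Suc N)) ?K ?K c + hook_triple (int (Suc N)) ?K ?K (c - 1))"
    unfolding distrib_left sum_hook_fun3[OF zero_less_Suc, symmetric] sum.distrib[symmetric]
    by (rule sum.cong) (simp_all add: hook_fun_restrict Phi_alt2_restrict algebra_simps)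
  \<comment> \<open>\<open>?H\<close> has legs k + 1 and k, and restriction splits each of them: k +
    1, k, k, k - 1. This is the origin of the middle coefficient 2.\<close>
  also have "(\<Sum>\<sigma>\<in>sym_group (Suc N). ?p \<sigma> * ?H \<sigma> * ?t c \<sigma>)
     = fact (Suc N) * (
        hook_triple (int (Suc N)) ?K (?K + 1) c + hook_triple (int (Suc N)) ?K (?K + 1) (c - 1)
      + 2 * (hook_triple (int (Suc N)) ?K ?K c + hook_triple (int (Suc N)) ?K ?K (c - 1))
      + hook_triple (int (Suc N)) ?K (?K - 1) c + hook_triple (int (Suc N)) ?K (?K - 1) (c - 1))"
    unfolding distrib_left mult.left_commute[of "fact _" 2] sum_hook_fun3[OF zero_less_Suc, symmetric] sum_distrib_left sum.distrib[symmetric]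
    by (rule sum.cong) (simp_all add: hook_fun_restrict Phi_alt2_restrict Phi_delta algebra_simps)
  \<comment> \<open>On one point fewer \<open>?p\<close> is a single hook, so on two points fewer it
    has legs k and k - 1; the third hook is restricted twice, with multiplicities 1, 2, 1.\<close>
  also have "(\<Sum>\<sigma>\<in>sym_group N. ?p \<sigma> * ?p \<sigma> * ?t c \<sigma>)
     = fact N * (let W2 = (\<lambda>a b. hook_triple (int N) a b c + 2 * hook_triple (int N) a b (c - 1) + hook_triple (int N) a b (c - 2))
        in W2 ?K ?K + W2 ?K (?K - 1) + W2 (?K - 1) ?K + W2 (?K - 1) (?K - 1))"
    unfolding Let_def distrib_left mult.left_commute[of "fact _" 2] sum_hook_fun3[OF N(1), symmetric] sum_distrib_left sum.distrib[symmetric]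
    by (rule sum.cong) (simp_all add: hook_fun_restrict Phi_alt2_restrict sym_group_Suc algebra_simps)
  also have "(\<Sum>\<sigma>\<in>sym_group (Suc (Suc N)). ?H \<sigma> * ?H \<sigma> * ?t c \<sigma>)
     = fact (Suc (Suc N)) * (hook_triple (int (Suc (Suc N))) (?K + 1) (?K + 1) c + hook_triple (int (Suc (Suc N))) (?K + 1) ?K c
        + hook_triple (int (Suc (Suc N))) ?K (?K + 1) c + hook_triple (int (Suc (Suc N))) ?K ?K c)"
    unfolding distrib_left sum_hook_fun3[OF zero_less_Suc, symmetric] sum.distrib[symmetric]
    by (rule sum.cong) (simp_all add: Phi_delta algebra_simps)
  finally show ?thesis
    unfolding n near_hook_mult_def Let_def by (simp add: N(2) algebra_simps fact_Suc)
qed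

section \<open>The group algebra\<close>

lemma sum_fun_apply: "(\<Sum>i\<in>I. f i) x = (\<Sum>i\<in>I. f i x)"
  by (induction I rule: infinite_finite_induct) auto

lemma fscale_apply [simp]: "fscale c x \<sigma> = c * x \<sigma>"
  by (simp add: fscale_def)

lemma gmult_apply: "gmult n x y \<sigma> = (\<Sum>\<tau>\<in>sym_group n. x \<tau> * y (inv \<tau> \<circ> \<sigma>))"
  by (simp add: gmult_def)

lemma gmult_add_left: "gmult n (x + y) z = gmult n x z + gmult n y z"
  by (simp add: fun_eq_iff gmult_apply distrib_right sum.distrib)

lemma gmult_add_right: "gmult n x (y + z) = gmult n x y + gmult n x z"
  by (simp add: fun_eq_iff gmult_apply distrib_left sum.distrib)

lemma gmult_diff_left: "gmult n (x - y) z = gmult n x z - gmult n y z"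
  by (simp add: fun_eq_iff gmult_apply left_diff_distrib sum_subtractf)

lemma gmult_scale_left: "gmult n (fscale c x) y = fscale c (gmult n x y)"
  by (simp add: fun_eq_iff gmult_apply sum_distrib_left mult.assoc)

lemma gmult_scale_right: "gmult n x (fscale c y) = fscale c (gmult n x y)"
  by (simp add: fun_eq_iff gmult_apply sum_distrib_left mult_ac)

lemma gmult_zero_left [simp]: "gmult n 0 y = 0"
  by (simp add: fun_eq_iff gmult_apply)

lemma gmult_zero_right [simp]: "gmult n x 0 = 0"
  by (simp add: fun_eq_iff gmult_apply)

lemma gmult_sum_left: "gmult n (\<Sum>i\<in>I. f i) y = (\<Sum>i\<in>I. gmult n (f i) y)"
proof
  fix \<sigma>
  show "gmult n (\<Sum>i\<in>I. f i) y \<sigma> = (\<Sum>i\<in>I. gmult n (f i) y) \<sigma>"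
    unfolding gmult_apply sum_fun_apply sum_distrib_right by (rule sum.swap)
qed

lemma gmult_sum_right: "gmult n x (\<Sum>i\<in>I. f i) = (\<Sum>i\<in>I. gmult n x (f i))"
proof
  fix \<sigma>
  show "gmult n x (\<Sum>i\<in>I. f i) \<sigma> = (\<Sum>i\<in>I. gmult n x (f i)) \<sigma>"
    unfolding gmult_apply sum_fun_apply sum_distrib_left by (rule sum.swap)
qed

lemma fscale_sum: "fscale c (\<Sum>i\<in>I. f i) = (\<Sum>i\<in>I. fscale c (f i))"
  by (simp add: fun_eq_iff sum_fun_apply sum_distrib_left)

lemma gmult_assoc: "gmult n (gmult n x y) z = gmult n x (gmult n y z)"
proof
  fix \<sigma>
  have "gmult n (gmult n x y) z \<sigma> = (\<Sum>\<rho>\<in>sym_group n. \<Sum>\<tau>\<in>sym_group n. x \<tau> * y (inv \<tau> \<circ> \<rho>) * z (inv \<rho> \<circ> \<sigma>))"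
    by (simp add: gmult_apply sum_distrib_right)
  also have "\<dots> = (\<Sum>\<tau>\<in>sym_group n. \<Sum>\<rho>\<in>sym_group n. x \<tau> * y (inv \<tau> \<circ> \<rho>) * z (inv \<rho> \<circ> \<sigma>))"
    by (rule sum.swap)
  also have "\<dots> = (\<Sum>\<tau>\<in>sym_group n. \<Sum>\<rho>\<in>sym_group n. x \<tau> * y \<rho> * z (inv \<rho> \<circ> (inv \<tau> \<circ> \<sigma>)))"
  proof (rule sum.cong[OF refl])
    fix \<tau> assume \<tau>: "\<tau> \<in> sym_group n"
    show "(\<Sum>\<rho>\<in>sym_group n. x \<tau> * y (inv \<tau> \<circ> \<rho>) * z (inv \<rho> \<circ> \<sigma>))
        = (\<Sum>\<rho>\<in>sym_group n. x \<tau> * y \<rho> * z (inv \<rho> \<circ> (inv \<tau> \<circ> \<sigma>)))"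
      by (subst sum_sym_group_left[OF \<tau>, symmetric], rule sum.cong[OF refl])
        (use \<tau> in \<open>simp add: sym_group_inv_distrib comp_assoc\<close>)
  qed
  also have "\<dots> = gmult n x (gmult n y z) \<sigma>"
    by (simp add: gmult_apply sum_distrib_left mult.assoc)
  finally show "gmult n (gmult n x y) z \<sigma> = gmult n x (gmult n y z) \<sigma>" .
qed

lemma gmult_in_group_algebra:
  assumes "y \<in> group_algebra n"
  shows "gmult n x y \<in> group_algebra n"
proof -
  have "inv \<tau> \<circ> \<sigma> \<notin> sym_group n" if "\<sigma> \<notin> sym_group n" "\<tau> \<in> sym_group n" for \<sigma> \<tau>
    using that sym_group_comp[of \<tau> n "inv \<tau> \<circ> \<sigma>"] by auto
  then show ?thesis using assms by (auto simp: group_algebra_def gmult_apply)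
qed

lemma gelem_in_group_algebra [simp]: "\<sigma> \<in> sym_group n \<Longrightarrow> gelem \<sigma> \<in> group_algebra n"
  by (auto simp: group_algebra_def gelem_def)

lemma gmult_gelem_left:
  assumes "\<sigma> \<in> sym_group n"
  shows "gmult n (gelem \<sigma>) x \<rho> = x (inv \<sigma> \<circ> \<rho>)"
proof -
  have "gmult n (gelem \<sigma>) x \<rho> = (\<Sum>\<tau>\<in>{\<sigma>}. gelem \<sigma> \<tau> * x (inv \<tau> \<circ> \<rho>))"
    unfolding gmult_apply by (rule sum.mono_neutral_right) (use assms in \<open>auto simp: gelem_def\<close>)
  then show ?thesis by (simp add: gelem_def)
qed

lemma gmult_gelem_right:
  assumes "\<sigma> \<in> sym_group n" "\<rho> \<in> sym_group n"
  shows "gmult n x (gelem \<sigma>) \<rho> = x (\<rho> \<circ> inv \<sigma>)"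
proof -
  have eq: "inv \<tau> \<circ> \<rho> = \<sigma> \<longleftrightarrow> \<tau> = \<rho> \<circ> inv \<sigma>" if "\<tau> \<in> sym_group n" for \<tau>
  proof
    assume "inv \<tau> \<circ> \<rho> = \<sigma>"
    then have "\<tau> \<circ> \<sigma> = \<rho>" using that by auto
    then show "\<tau> = \<rho> \<circ> inv \<sigma>" using assms by auto
  next
    assume "\<tau> = \<rho> \<circ> inv \<sigma>"
    then show "inv \<tau> \<circ> \<rho> = \<sigma>" using assms by (simp add: sym_group_inv_distrib comp_assoc)
  qed
  have "gmult n x (gelem \<sigma>) \<rho> = (\<Sum>\<tau>\<in>{\<rho> \<circ> inv \<sigma>}. x \<tau> * gelem \<sigma> (inv \<tau> \<circ> \<rho>))"
    unfolding gmult_apply by (rule sum.mono_neutral_right) (use assms eq in \<open>auto simp: gelem_def\<close>)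
  also have "\<dots> = x (\<rho> \<circ> inv \<sigma>)"
    using eq[of "\<rho> \<circ> inv \<sigma>"] assms by (simp add: gelem_def)
  finally show ?thesis .
qed

lemma gmult_gelem_gelem:
  assumes "\<sigma> \<in> sym_group n" "\<tau> \<in> sym_group n"
  shows "gmult n (gelem \<sigma>) (gelem \<tau>) = gelem (\<sigma> \<circ> \<tau>)"
proof
  fix \<rho>
  have "inv \<sigma> \<circ> \<rho> = \<tau> \<longleftrightarrow> \<rho> = \<sigma> \<circ> \<tau>" using assms(1) by auto
  then show "gmult n (gelem \<sigma>) (gelem \<tau>) \<rho> = gelem (\<sigma> \<circ> \<tau>) \<rho>"
    by (subst gmult_gelem_left[OF assms(1)]) (simp add: gelem_def)
qed

lemma gmult_gelem_id_left [simp]: "gmult n (gelem id) x = x"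
  by (rule ext) (simp add: gmult_gelem_left)

lemma gmult_gelem_id_right:
  assumes x: "x \<in> group_algebra n"
  shows "gmult n x (gelem id) = x"
proof
  fix \<sigma>
  show "gmult n x (gelem id) \<sigma> = x \<sigma>"
  proof (cases "\<sigma> \<in> sym_group n")
    case True
    then show ?thesis by (simp add: gmult_gelem_right)
  next
    case False
    then show ?thesis using x gmult_in_group_algebra[OF gelem_in_group_algebra[OF sym_group_id], where x = x]
      by (simp add: group_algebra_def)
  qed
qed

lemma group_algebra_expand:
  assumes "x \<in> group_algebra n"
  shows "x = (\<Sum>\<sigma>\<in>sym_group n. fscale (x \<sigma>) (gelem \<sigma>))"
proof
  fix \<rho>
  show "x \<rho> = (\<Sum>\<sigma>\<in>sym_group n. fscale (x \<sigma>) (gelem \<sigma>)) \<rho>"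
    using assms by (cases "\<rho> \<in> sym_group n") (auto simp: sum_fun_apply gelem_def group_algebra_def if_distrib[of "(*) _"] cong: if_cong)
qed

lemma gmult_id_apply: "gmult n x y id = (\<Sum>\<tau>\<in>sym_group n. x \<tau> * y (inv \<tau>))"
  by (simp add: gmult_apply)

text \<open>The coefficient of the identity is a trace on the group algebra; moving factors
  cyclically inside it is the main device for evaluating sums over conjugates.\<close>

lemma gmult_trace_comm: "gmult n x y id = gmult n y x id"
proof -
  have "gmult n x y id = (\<Sum>\<tau>\<in>sym_group n. x (inv \<tau>) * y (inv (inv \<tau>)))"
    unfolding gmult_id_apply by (rule sum_sym_group_inv[symmetric])
  also have "\<dots> = gmult n y x id" unfolding gmult_id_apply
    by (rule sum.cong) (simp_all add: mult.commute)
  finally show ?thesis .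
qed

lemma gmult_conj_apply:
  assumes "\<tau> \<in> sym_group n" "\<sigma> \<in> sym_group n"
  shows "gmult n (gmult n (gelem \<tau>) x) (gelem (inv \<tau>)) \<sigma> = x (inv \<tau> \<circ> \<sigma> \<circ> \<tau>)"
  using assms by (simp add: gmult_gelem_right gmult_gelem_left comp_assoc)

section \<open>The anti-involution of the group algebra and its positive form\<close>

text \<open>The linear extension of inversion, without complex conjugation. The attached form is
  positive on real-valued elements, which is why \<open>realv\<close> is carried along.\<close>

definition star :: "nat \<Rightarrow> galg \<Rightarrow> galg" where
  "star n x = (\<lambda>\<sigma>. if \<sigma> \<in> sym_group n then x (inv \<sigma>) else 0)"

lemma star_gmult:
  assumes "x \<in> group_algebra n" "y \<in> group_algebra n"
  shows "star n (gmult n x y) = gmult n (star n y) (star n x)"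
proof
  fix \<sigma>
  have "star n x \<in> group_algebra n" by (simp add: star_def group_algebra_def)
  then have ga: "gmult n (star n y) (star n x) \<in> group_algebra n" by (rule gmult_in_group_algebra)
  show "star n (gmult n x y) \<sigma> = gmult n (star n y) (star n x) \<sigma>"
  proof (cases "\<sigma> \<in> sym_group n")
    case True
    have "gmult n x y (inv \<sigma>) = (\<Sum>\<rho>\<in>sym_group n. x (inv \<sigma> \<circ> \<rho>) * y (inv (inv \<sigma> \<circ> \<rho>) \<circ> inv \<sigma>))"
      unfolding gmult_apply by (rule sum_sym_group_left[symmetric]) (simp add: True)
    also have "\<dots> = (\<Sum>\<rho>\<in>sym_group n. star n y \<rho> * star n x (inv \<rho> \<circ> \<sigma>))"
      by (rule sum.cong) (use True in \<open>simp_all add: star_def sym_group_inv_distrib[of _ n] comp_assoc\<close>)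
    finally show ?thesis using True by (simp add: star_def gmult_apply)
  next
    case False
    then show ?thesis using ga by (simp add: star_def group_algebra_def)
  qed
qed

lemma star_scale: "star n (fscale c x) = fscale c (star n x)"
  by (auto simp: star_def fun_eq_iff)

lemma star_star: "x \<in> group_algebra n \<Longrightarrow> star n (star n x) = x"
  by (auto simp: star_def fun_eq_iff group_algebra_def)

lemma star_in_group_algebra [simp]: "star n x \<in> group_algebra n"
  by (simp add: star_def group_algebra_def)

definition realv :: "galg \<Rightarrow> bool" where
  "realv x \<longleftrightarrow> (\<forall>\<sigma>. x \<sigma> \<in> \<real>)"

lemma realv_gmult: "realv x \<Longrightarrow> realv y \<Longrightarrow> realv (gmult n x y)"
  by (simp add: realv_def gmult_apply)

lemma star_positive:
  assumes "x \<in> group_algebra n" "realv x" "gmult n x (star n x) id = 0"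
  shows "x = 0"
proof -
  have r: "x \<sigma> = of_real (Re (x \<sigma>))" for \<sigma> using assms(2) by (simp add: realv_def)
  have "gmult n x (star n x) id = (\<Sum>\<tau>\<in>sym_group n. x \<tau> * x \<tau>)"
    unfolding gmult_id_apply by (rule sum.cong) (simp_all add: star_def)
  also have "\<dots> = (\<Sum>\<tau>\<in>sym_group n. of_real (Re (x \<tau>) * Re (x \<tau>)))"
    by (rule sum.cong[OF refl]) (metis r of_real_mult)
  also have "\<dots> = of_real (\<Sum>\<tau>\<in>sym_group n. Re (x \<tau>) * Re (x \<tau>))" by simp
  finally have "(\<Sum>\<tau>\<in>sym_group n. Re (x \<tau>) * Re (x \<tau>)) = 0" using assms(3) by (metis of_real_eq_0_iff)
  then have "\<forall>\<tau>\<in>sym_group n. Re (x \<tau>) = 0" by (subst (asm) sum_nonneg_eq_0_iff) auto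
  then have "x \<tau> = 0" for \<tau> using r[of \<tau>] assms(1)
    by (cases "\<tau> \<in> sym_group n") (auto simp: group_algebra_def)
  then show ?thesis by (simp add: fun_eq_iff)
qed

section \<open>Young symmetrizers\<close>

text \<open>Induction by removing the maximum, which is at least the number of the other elements.
  The equality case lets one global identity of sums force equality in every row in
  \<open>transversal_factor\<close>.\<close>

lemma sum_lessThan_le_sum:
  fixes J :: "nat set"
  assumes "finite J"
  shows "\<Sum>{..<card J} \<le> \<Sum>J \<and> (\<Sum>{..<card J} = \<Sum>J \<longrightarrow> J = {..<card J})"
  using assms
proof (induction J rule: finite_linorder_max_induct)
  case (insert m J)
  have m: "m \<notin> J" using insert(2) by blast
  have sub: "J \<subseteq> {..<m}" using insert(2) by blast
  then have c: "card J \<le> m" using card_mono[of "{..<m}" J] by simp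
  have e: "\<Sum>(insert m J) = m + \<Sum>J" "card (insert m J) = Suc (card J)" using insert(1) m by auto
  have "J = {..<m}" if "card J = m" using card_subset_eq[OF _ sub] that by simp
  have s: "\<Sum>{..<Suc (card J)} = card J + \<Sum>{..<card J}" by simp
  have ih: "\<Sum>{..<card J} \<le> \<Sum>J" using insert(3) by blast
  have "insert m J = {..<Suc (card J)}" if "\<Sum>{..<Suc (card J)} = m + \<Sum>J"
  proof -
    have "card J = m" using that c ih unfolding s by linarith
    then show ?thesis using \<open>card J = m \<Longrightarrow> J = {..<m}\<close> by (simp add: lessThan_Suc)
  qed
  moreover have "\<Sum>{..<Suc (card J)} \<le> m + \<Sum>J" using c ih unfolding s by linarith
  ultimately show ?case unfolding e by blast
qed simp

text \<open>A tableau given only by the row and column of each entry.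
  \<open>row_left_justified\<close> makes the column indices of each row an initial segment, as
  needed for the minimality of their sum.\<close>

locale young_data =
  fixes n :: nat and r c :: "nat \<Rightarrow> nat"
  assumes cell_inj: "inj_on (\<lambda>x. (r x, c x)) {..<n}"
    and row_left_justified: "x < n \<Longrightarrow> j \<le> c x \<Longrightarrow> \<exists>y<n. r y = r x \<and> c y = j"
begin

abbreviation "G \<equiv> sym_group n"
abbreviation "A \<equiv> group_algebra n"

abbreviation mul :: "galg \<Rightarrow> galg \<Rightarrow> galg" (infixl "\<star>" 70) where "x \<star> y \<equiv> gmult n x y"

definition "P = {\<sigma> \<in> G. \<forall>x<n. r (\<sigma> x) = r x}"
definition "Q = {\<sigma> \<in> G. \<forall>x<n. c (\<sigma> x) = c x}"
definition a :: galg where "a = (\<lambda>\<sigma>. if \<sigma> \<in> P then 1 else 0)"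
definition b :: galg where "b = (\<lambda>\<sigma>. if \<sigma> \<in> Q then of_int (sign \<sigma>) else 0)"

lemma G_less: "\<sigma> \<in> G \<Longrightarrow> x < n \<Longrightarrow> \<sigma> x < n"
  using permutes_in_image[of \<sigma> "{..<n}" x] by (auto simp: sym_group_def)

lemma P_G: "\<sigma> \<in> P \<Longrightarrow> \<sigma> \<in> G" and Q_G: "\<sigma> \<in> Q \<Longrightarrow> \<sigma> \<in> G"
  by (auto simp: P_def Q_def)

lemma P_comp: "\<sigma> \<in> P \<Longrightarrow> \<tau> \<in> P \<Longrightarrow> \<sigma> \<circ> \<tau> \<in> P"
  by (auto simp: P_def G_less)

lemma Q_comp: "\<sigma> \<in> Q \<Longrightarrow> \<tau> \<in> Q \<Longrightarrow> \<sigma> \<circ> \<tau> \<in> Q"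
  by (auto simp: Q_def G_less)

lemma P_inv: assumes "\<sigma> \<in> P" shows "inv \<sigma> \<in> P"
proof -
  have s: "\<sigma> \<in> G" using assms P_G by blast
  then have "r (inv \<sigma> x) = r x" if "x < n" for x
    using assms G_less[OF sym_group_inv[OF s] that] sym_group_inv_comp(3)[OF s, of x] unfolding P_def by force
  then show ?thesis using s by (simp add: P_def)
qed

lemma Q_inv: assumes "\<sigma> \<in> Q" shows "inv \<sigma> \<in> Q"
proof -
  have s: "\<sigma> \<in> G" using assms Q_G by blast
  then have "c (inv \<sigma> x) = c x" if "x < n" for x
    using assms G_less[OF sym_group_inv[OF s] that] sym_group_inv_comp(3)[OF s, of x] unfolding Q_def by force
  then show ?thesis using s by (simp add: Q_def)
qed

lemma P_Int_Q: assumes "\<sigma> \<in> P" "\<sigma> \<in> Q" shows "\<sigma> = id"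
proof
  fix x show "\<sigma> x = id x"
  proof (cases "x < n")
    case True
    then have "(r (\<sigma> x), c (\<sigma> x)) = (r x, c x)" using assms by (simp add: P_def Q_def)
    then have "\<sigma> x = x" using inj_onD[OF cell_inj, of "\<sigma> x" x] G_less[OF P_G[OF assms(1)] True] True by simp
    then show ?thesis by simp
  next
    case False
    then show ?thesis using P_G[OF assms(1)] by (simp add: sym_group_def permutes_def)
  qed
qed

lemma transpose_P: "x < n \<Longrightarrow> y < n \<Longrightarrow> r x = r y \<Longrightarrow> transpose x y \<in> P"
  by (auto simp: P_def transpose_def)

lemma transpose_Q: "x < n \<Longrightarrow> y < n \<Longrightarrow> c x = c y \<Longrightarrow> transpose x y \<in> Q"
  by (auto simp: Q_def transpose_def)

lemma a_A [simp]: "a \<in> A" and b_A [simp]: "b \<in> A"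
  by (auto simp: group_algebra_def a_def b_def P_def Q_def)

lemma gelem_P_a: assumes "p \<in> P" shows "gelem p \<star> a = a" "a \<star> gelem p = a"
proof -
  have p: "p \<in> G" using assms P_G by blast
  have 1: "inv p \<circ> \<rho> \<in> P \<longleftrightarrow> \<rho> \<in> P" for \<rho>
    using P_comp[OF assms, of "inv p \<circ> \<rho>"] P_comp[OF P_inv[OF assms], of \<rho>] p by auto
  have 2: "\<rho> \<circ> inv p \<in> P \<longleftrightarrow> \<rho> \<in> P" for \<rho>
    using P_comp[OF _ assms, of "\<rho> \<circ> inv p"] P_comp[OF _ P_inv[OF assms], of \<rho>] p by auto
  show "gelem p \<star> a = a" by (rule ext) (simp add: gmult_gelem_left[OF p] a_def 1)
  show "a \<star> gelem p = a"
  proof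
    fix \<rho> show "(a \<star> gelem p) \<rho> = a \<rho>"
    proof (cases "\<rho> \<in> G")
      case True
      then show ?thesis by (simp add: gmult_gelem_right[OF p True] a_def 2)
    next
      case False
      then show ?thesis using gmult_in_group_algebra[OF gelem_in_group_algebra[OF p], of a] a_A
        by (simp add: group_algebra_def)
    qed
  qed
qed

lemma gelem_Q_b: assumes "q \<in> Q" shows "gelem q \<star> b = fscale (of_int (sign q)) b" "b \<star> gelem q = fscale (of_int (sign q)) b"
proof -
  have q: "q \<in> G" using assms Q_G by blast
  have 1: "inv q \<circ> \<rho> \<in> Q \<longleftrightarrow> \<rho> \<in> Q" for \<rho>
    using Q_comp[OF assms, of "inv q \<circ> \<rho>"] Q_comp[OF Q_inv[OF assms], of \<rho>] q by auto
  have 2: "\<rho> \<circ> inv q \<in> Q \<longleftrightarrow> \<rho> \<in> Q" for \<rho>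
    using Q_comp[OF _ assms, of "\<rho> \<circ> inv q"] Q_comp[OF _ Q_inv[OF assms], of \<rho>] q by auto
  have pq: "permutation q" using sym_group_permutation[OF q] .
  have s1: "sign (inv q \<circ> \<rho>) = sign q * sign \<rho>" "sign (\<rho> \<circ> inv q) = sign q * sign \<rho>" if "\<rho> \<in> Q" for \<rho>
    using sym_group_permutation[OF Q_G[OF that]] pq sym_group_permutation[OF sym_group_inv[OF q]]
    by (simp_all add: sign_compose sign_inverse)
  show "gelem q \<star> b = fscale (of_int (sign q)) b" by (rule ext) (simp add: gmult_gelem_left[OF q] b_def 1 s1)
  show "b \<star> gelem q = fscale (of_int (sign q)) b"
  proof
    fix \<rho> show "(b \<star> gelem q) \<rho> = fscale (of_int (sign q)) b \<rho>"
    proof (cases "\<rho> \<in> G")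
      case True
      then show ?thesis by (simp add: gmult_gelem_right[OF q True] b_def 2 s1)
    next
      case False
      then show ?thesis using gmult_in_group_algebra[OF gelem_in_group_algebra[OF q], of b] b_A
        by (simp add: group_algebra_def)
    qed
  qed
qed

lemma conj_transpose:
  assumes "\<sigma> \<in> G"
  shows "transpose x y \<circ> \<sigma> = \<sigma> \<circ> transpose (inv \<sigma> x) (inv \<sigma> y)"
proof -
  have "\<sigma> (inv \<sigma> x) = x" "\<sigma> (inv \<sigma> y) = y" "inj \<sigma>" using assms sym_group_inj by auto
  then show ?thesis
    by (auto simp: fun_eq_iff transpose_def inj_eq)
qed

text \<open>The transposition is absorbed by \<open>z\<close> on the left. Moved past \<sigma> it
  exchanges two entries of one column, so \<open>b\<close> absorbs it with sign -1, and the product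
  equals its own negative.\<close>

lemma vanish:
  assumes "\<sigma> \<in> G" "x < n" "y < n" "x \<noteq> y" "c (inv \<sigma> x) = c (inv \<sigma> y)"
    and z: "z \<star> gelem (transpose x y) = z"
  shows "z \<star> gelem \<sigma> \<star> b = 0"
proof -
  let ?x = "inv \<sigma> x" and ?y = "inv \<sigma> y"
  have xy: "?x < n" "?y < n" using G_less[OF sym_group_inv[OF assms(1)]] assms(2,3) by auto
  have ne: "?x \<noteq> ?y" using assms(1,4) by (metis sym_group_inv_comp(3))
  have q: "transpose ?x ?y \<in> Q" using transpose_Q xy assms(5) by blast
  have "z \<star> gelem \<sigma> \<star> b = z \<star> gelem (transpose x y \<circ> \<sigma>) \<star> b"
    using z assms(1-3) by (metis gmult_assoc gmult_gelem_gelem sym_group_transpose)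
  also have "\<dots> = z \<star> gelem \<sigma> \<star> (gelem (transpose ?x ?y) \<star> b)"
    unfolding conj_transpose[OF assms(1)] using assms(1) xy by (simp add: gmult_gelem_gelem[symmetric] gmult_assoc)
  also have "\<dots> = fscale (- 1) (z \<star> gelem \<sigma> \<star> b)"
    using ne unfolding gelem_Q_b(1)[OF q] gmult_scale_right by (simp add: sign_swap_id)
  finally have "(z \<star> gelem \<sigma> \<star> b) \<rho> = - ((z \<star> gelem \<sigma> \<star> b) \<rho>)" for \<rho>
    by (metis fscale_apply mult_minus1)
  then show ?thesis by (simp add: fun_eq_iff)
qed

text \<open>A permutation separating the rows from the columns gives a \<open>0/1\<close> matrix with the row and column sums
  of the diagram; comparing the sums of the column indices shows that the matrix is the diagram itself.\<close>

lemma transversal_factor: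
  assumes \<sigma>: "\<sigma> \<in> G"
    and sep: "\<And>x y. x < n \<Longrightarrow> y < n \<Longrightarrow> x \<noteq> y \<Longrightarrow> r x = r y \<Longrightarrow> c (inv \<sigma> x) \<noteq> c (inv \<sigma> y)"
  obtains p q where "p \<in> P" "q \<in> Q" "\<sigma> = p \<circ> q"
proof -
  define X where "X i = {x. x < n \<and> r x = i}" for i
  have fX: "finite (X i)" for i by (simp add: X_def)
  define J where "J i = (\<lambda>x. c (inv \<sigma> x)) ` X i" for i
  have injJ: "inj_on (\<lambda>x. c (inv \<sigma> x)) (X i)" for i
    using sep by (fastforce simp: inj_on_def X_def)
  have injc: "inj_on c (X i)" for i
    using cell_inj by (auto simp: inj_on_def X_def)
  have cX: "c ` X i = {..<card (X i)}" for i
  proof -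
    have down: "j \<in> c ` X i" if "j' \<in> c ` X i" "j \<le> j'" for j j'
    proof -
      from that obtain x where "x < n" "r x = i" "j \<le> c x" by (auto simp: X_def)
      then show ?thesis using row_left_justified[of x j] by (force simp: X_def)
    qed
    have "\<exists>m. c ` X i = {..<m}"
    proof (cases "X i = {}")
      case False
      let ?M = "Max (c ` X i)"
      have M: "?M \<in> c ` X i" using False fX by simp
      have "c ` X i = {..<Suc ?M}"
        using down[OF M] fX by (auto simp: less_Suc_eq_le)
      then show ?thesis by blast
    qed (auto intro: exI[of _ 0])
    then obtain m where m: "c ` X i = {..<m}" by blast
    then have "m = card (X i)" using card_image[OF injc[of i]] by simp
    then show ?thesis using m by simp
  qed
  have le: "\<Sum>(c ` X i) \<le> \<Sum>(J i)" for i
    using sum_lessThan_le_sum[of "J i"] card_image[OF injJ[of i]] fX by (simp add: J_def cX)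
  have split: "(\<Sum>x<n. f x) = (\<Sum>i\<in>r ` {..<n}. \<Sum>x\<in>X i. f x)" for f :: "nat \<Rightarrow> nat"
    using sum.image_gen[of "{..<n}" f r] by (simp add: X_def lessThan_def)
  \<comment> \<open>The total of all column indices is invariant under \<sigma>, so the inequalities
    \<open>le\<close> must be equalities in every row.\<close>
  have "(\<Sum>i\<in>r ` {..<n}. \<Sum>(J i)) = (\<Sum>x<n. c (inv \<sigma> x))"
    unfolding split by (rule sum.cong) (simp_all add: J_def sum.reindex[OF injJ])
  also have "\<dots> = (\<Sum>x<n. c x)"
    using sum.reindex_bij_betw[of "inv \<sigma>" "{..<n}" "{..<n}" c] permutes_imp_bij[of "inv \<sigma>" "{..<n}"] sym_group_inv[OF \<sigma>]
    by (simp add: sym_group_def)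
  also have "\<dots> = (\<Sum>i\<in>r ` {..<n}. \<Sum>(c ` X i))"
    unfolding split by (rule sum.cong) (simp_all add: sum.reindex[OF injc])
  finally have tot: "(\<Sum>i\<in>r ` {..<n}. \<Sum>(c ` X i)) = (\<Sum>i\<in>r ` {..<n}. \<Sum>(J i))" by simp
  have eqs: "\<Sum>(c ` X i) = \<Sum>(J i)" if "i \<in> r ` {..<n}" for i
    using sum_mono_inv[OF tot le that] by simp
  have JX: "J i = c ` X i" if "i \<in> r ` {..<n}" for i
    using sum_lessThan_le_sum[of "J i"] eqs[OF that] card_image[OF injJ[of i]] fX by (simp add: J_def cX)
  have "\<exists>y<n. r y = r x \<and> c y = c (inv \<sigma> x)" if "x < n" for x
  proof -
    have "c (inv \<sigma> x) \<in> J (r x)" using that by (auto simp: J_def X_def)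
    then show ?thesis using JX[of "r x"] that by (auto simp: X_def)
  qed
  \<comment> \<open>\<open>f x\<close> is the cell in the row of \<open>x\<close> and in the column
    that \<open>inv \<sigma>\<close> assigns to \<open>x\<close>. The permutation \<open>p\<close>
    built from it preserves rows, \<open>p \<circ> \<sigma>\<close> preserves columns, and \<sigma>
    is \<open>inv p\<close> followed on the right by \<open>p \<circ> \<sigma>\<close>.\<close>
  then obtain f where f: "\<And>x. x < n \<Longrightarrow> f x < n \<and> r (f x) = r x \<and> c (f x) = c (inv \<sigma> x)" by metis
  define p where "p x = (if x < n then f x else x)" for x
  have "inj_on f {..<n}"
  proof (rule inj_onI)
    fix x y assume "x \<in> {..<n}" "y \<in> {..<n}" "f x = f y"
    then show "x = y" using f[of x] f[of y] sep[of x y] by auto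
  qed
  then have "inj_on p {..<n}" by (simp add: inj_on_def p_def)
  moreover have "p ` {..<n} \<subseteq> {..<n}" using f by (auto simp: p_def)
  ultimately have "bij_betw p {..<n} {..<n}" by (simp add: bij_betw_def endo_inj_surj)
  then have p: "p permutes {..<n}" by (rule bij_imp_permutes) (simp add: p_def)
  then have pG: "p \<in> G" by (simp add: sym_group_def)
  have pP: "p \<in> P" using pG f by (simp add: P_def p_def)
  have "p \<circ> \<sigma> \<in> Q" unfolding Q_def
    using pG \<sigma> f G_less[OF \<sigma>] by (simp add: p_def)
  then show ?thesis using that[OF P_inv[OF pP], of "p \<circ> \<sigma>"] pG by simp
qed

text \<open>If \<open>inv \<sigma>\<close> brings two entries of a row into one column, the product
  vanishes; otherwise \<sigma> factors as in \<open>transversal_factor\<close>, \<open>a\<close>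
  absorbs the row part and \<open>b\<close> absorbs the column part up to sign.\<close>

lemma a_gelem_b:
  assumes "\<sigma> \<in> G"
  obtains l where "a \<star> gelem \<sigma> \<star> b = fscale l (a \<star> b)"
proof (cases "\<exists>x y. x < n \<and> y < n \<and> x \<noteq> y \<and> r x = r y \<and> c (inv \<sigma> x) = c (inv \<sigma> y)")
  case True
  then obtain x y where xy: "x < n" "y < n" "x \<noteq> y" "r x = r y" "c (inv \<sigma> x) = c (inv \<sigma> y)" by blast
  have "a \<star> gelem \<sigma> \<star> b = 0"
    using vanish[OF assms xy(1-3,5)] gelem_P_a(2)[OF transpose_P[OF xy(1,2,4)]] by blast
  then show ?thesis using that[of 0] by (simp add: fun_eq_iff)
next
  case False
  obtain p q where pq: "p \<in> P" "q \<in> Q" "\<sigma> = p \<circ> q"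
    by (rule transversal_factor[OF assms]) (use False in blast)+
  have "a \<star> gelem \<sigma> \<star> b = (a \<star> gelem p) \<star> (gelem q \<star> b)"
    unfolding pq(3) gmult_gelem_gelem[OF P_G[OF pq(1)] Q_G[OF pq(2)], symmetric] gmult_assoc ..
  then have "a \<star> gelem \<sigma> \<star> b = fscale (of_int (sign q)) (a \<star> b)"
    using gelem_P_a(2)[OF pq(1)] gelem_Q_b(1)[OF pq(2)] by (simp add: gmult_scale_right)
  then show ?thesis by (rule that)
qed

lemma ab_id: "(a \<star> b) id = 1"
proof -
  have "(a \<star> b) id = (\<Sum>\<tau>\<in>{id}. a \<tau> * b (inv \<tau>))"
    unfolding gmult_id_apply
  proof (rule sum.mono_neutral_right)
    show "\<forall>\<tau>\<in>G - {id}. a \<tau> * b (inv \<tau>) = 0"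
    proof
      fix \<tau> assume \<tau>: "\<tau> \<in> G - {id}"
      show "a \<tau> * b (inv \<tau>) = 0"
      proof (cases "\<tau> \<in> P \<and> inv \<tau> \<in> Q")
        case True
        then have "\<tau> \<in> Q" using Q_inv[of "inv \<tau>"] \<tau> by (metis DiffD1 sym_group_inv_comp(9))
        then show ?thesis using P_Int_Q True \<tau> by blast
      qed (auto simp: a_def b_def)
    qed
  qed auto
  then show ?thesis by (simp add: a_def b_def P_def Q_def)
qed

text \<open>Linear extension of \<open>a_gelem_b\<close>. As the coefficient of
  \<open>a \<star> b\<close> at the identity is 1, the scalar can be read off there, and every
  sandwiched product becomes a single coefficient.\<close>

lemma a_mul_b:
  assumes "x \<in> A"
  shows "a \<star> x \<star> b = fscale ((a \<star> x \<star> b) id) (a \<star> b)"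
proof -
  have "\<forall>\<sigma>\<in>G. \<exists>l. a \<star> gelem \<sigma> \<star> b = fscale l (a \<star> b)" using a_gelem_b by metis
  then obtain l where l: "\<And>\<sigma>. \<sigma> \<in> G \<Longrightarrow> a \<star> gelem \<sigma> \<star> b = fscale (l \<sigma>) (a \<star> b)" by metis
  have "a \<star> x \<star> b = (\<Sum>\<sigma>\<in>G. fscale (x \<sigma>) (a \<star> gelem \<sigma> \<star> b))"
    by (subst group_algebra_expand[OF assms])
      (simp only: gmult_sum_left gmult_sum_right gmult_scale_left gmult_scale_right)
  also have "\<dots> = (\<Sum>\<sigma>\<in>G. fscale (x \<sigma>) (fscale (l \<sigma>) (a \<star> b)))"
    by (rule sum.cong) (simp_all add: l)
  also have "\<dots> = fscale (\<Sum>\<sigma>\<in>G. x \<sigma> * l \<sigma>) (a \<star> b)"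
    by (simp add: fun_eq_iff sum_fun_apply sum_distrib_right mult.assoc)
  finally have e: "a \<star> x \<star> b = fscale (\<Sum>\<sigma>\<in>G. x \<sigma> * l \<sigma>) (a \<star> b)" .
  then have "(a \<star> x \<star> b) id = (\<Sum>\<sigma>\<in>G. x \<sigma> * l \<sigma>)" by (simp add: ab_id)
  then show ?thesis using e by simp
qed

lemma star_a: "star n a = a"
proof
  fix \<sigma>
  have "inv \<sigma> \<in> P \<longleftrightarrow> \<sigma> \<in> P" if "\<sigma> \<in> G" using that P_inv[of \<sigma>] P_inv[of "inv \<sigma>"] by auto
  then show "star n a \<sigma> = a \<sigma>" by (auto simp: star_def a_def P_G)
qed

lemma star_b: "star n b = b"
proof
  fix \<sigma>
  have "inv \<sigma> \<in> Q \<longleftrightarrow> \<sigma> \<in> Q" if "\<sigma> \<in> G" using that Q_inv[of \<sigma>] Q_inv[of "inv \<sigma>"] by auto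
  then show "star n b \<sigma> = b \<sigma>" using Q_G
    by (auto simp: star_def b_def sign_inverse sym_group_permutation)
qed

text \<open>The mirror image of \<open>a_mul_b\<close> under \<open>star\<close>, which fixes
  \<open>a\<close> and \<open>b\<close> and reverses products.\<close>

lemma b_mul_a:
  assumes "x \<in> A"
  shows "b \<star> x \<star> a = fscale ((b \<star> x \<star> a) id) (b \<star> a)"
proof -
  have A: "a \<star> star n x \<star> b \<in> A" "star n x \<star> b \<in> A" "x \<star> a \<in> A" by (simp_all add: gmult_in_group_algebra)
  have s: "star n (a \<star> star n x \<star> b) = b \<star> x \<star> a"
    using A assms by (simp add: gmult_assoc star_gmult star_a star_b star_star)
  have "b \<star> x \<star> a = fscale ((a \<star> star n x \<star> b) id) (b \<star> a)"
    unfolding s[symmetric] by (subst a_mul_b) (simp_all add: star_scale star_gmult star_a star_b ab_id)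
  moreover have "(b \<star> a) id = 1" using ab_id gmult_trace_comm[of n b a] by simp
  ultimately show ?thesis by simp
qed

definition cc :: galg where "cc = a \<star> b"
definition kappa :: complex where "kappa = (cc \<star> cc) id"

lemma cc_A [simp]: "cc \<in> A" by (simp add: cc_def gmult_in_group_algebra)

lemma cc_id [simp]: "cc id = 1" by (simp add: cc_def ab_id)

lemma cc_cc: "cc \<star> cc = fscale kappa cc"
  using a_mul_b[of "b \<star> a"] by (simp add: cc_def kappa_def gmult_assoc gmult_in_group_algebra)

lemma realv_a: "realv a" and realv_b: "realv b"
  by (simp_all add: realv_def a_def b_def)

lemma realv_cc: "realv cc" by (simp add: cc_def realv_gmult realv_a realv_b)

lemma kappa_real: "kappa \<in> \<real>"
  using realv_gmult[OF realv_cc realv_cc] unfolding realv_def kappa_def by blast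

lemma a_a: "a \<star> a = fscale (of_nat (card P)) a"
proof -
  have fin: "finite P" using finite_subset[of P G] P_G by auto
  have "a = (\<Sum>p\<in>P. gelem p)"
    by (rule ext) (use fin in \<open>simp add: sum_fun_apply a_def gelem_def\<close>)
  then have "a \<star> a = (\<Sum>p\<in>P. gelem p) \<star> a" by simp
  also have "\<dots> = (\<Sum>p\<in>P. a)" unfolding gmult_sum_left by (rule sum.cong) (simp_all add: gelem_P_a)
  finally show ?thesis by (simp add: fun_eq_iff sum_fun_apply)
qed

lemma b_b: "b \<star> b = fscale (of_nat (card Q)) b"
proof -
  have fin: "finite Q" using finite_subset[of Q G] Q_G by auto
  have "b = (\<Sum>q\<in>Q. fscale (of_int (sign q)) (gelem q))"
    by (rule ext) (use fin in \<open>simp add: sum_fun_apply b_def gelem_def if_distrib[of "(*) _"] cong: if_cong\<close>)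
  then have "b \<star> b = (\<Sum>q\<in>Q. fscale (of_int (sign q)) (gelem q)) \<star> b" by simp
  also have "\<dots> = (\<Sum>q\<in>Q. b)" unfolding gmult_sum_left gmult_scale_left
    by (rule sum.cong) (simp_all add: gelem_Q_b fun_eq_iff sign_def)
  finally show ?thesis by (simp add: fun_eq_iff sum_fun_apply)
qed

lemma card_P_pos: "card P > 0"
proof -
  have "finite P" using finite_subset[of P G] P_G by auto
  moreover have "id \<in> P" by (auto simp: P_def)
  ultimately show ?thesis by (auto simp: card_gt_0_iff)
qed

text \<open>The form \<open>(x \<star> star n x) id\<close> is positive definite on real elements, so \<open>cc \<star> cc = 0\<close> would
  force first \<open>a \<star> b \<star> a\<close> and then \<open>a \<star> b\<close> to vanish.\<close>

lemma kappa_nonzero: "kappa \<noteq> 0"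
proof
  assume k: "kappa = 0"
  have cc0: "a \<star> b \<star> (a \<star> b) = 0" using cc_cc k by (simp add: cc_def fun_eq_iff)
  define y where "y = a \<star> b \<star> a"
  have yA: "y \<in> A" by (simp add: y_def gmult_in_group_algebra)
  have ry: "realv y" by (simp add: y_def realv_gmult realv_a realv_b)
  have sy: "star n y = y"
    by (simp add: y_def star_gmult star_a star_b gmult_assoc gmult_in_group_algebra)
  have "y \<star> y = a \<star> b \<star> (a \<star> a) \<star> b \<star> a" by (simp add: y_def gmult_assoc)
  also have "\<dots> = fscale (of_nat (card P)) ((a \<star> b \<star> (a \<star> b)) \<star> a)"
    by (simp add: a_a gmult_assoc gmult_scale_left gmult_scale_right)
  also have "\<dots> = 0" by (simp add: cc0 fun_eq_iff)
  finally have "y = 0" using star_positive[OF yA ry] by (simp add: sy)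
  have "cc \<star> star n cc = a \<star> (b \<star> b) \<star> a"
    by (simp add: cc_def star_gmult star_a star_b gmult_assoc)
  also have "\<dots> = fscale (of_nat (card Q)) y" by (simp add: b_b y_def gmult_scale_left gmult_scale_right gmult_assoc)
  also have "\<dots> = 0" by (simp add: \<open>y = 0\<close> fun_eq_iff)
  finally have "cc = 0" using star_positive[OF cc_A realv_cc] by simp
  then show False using cc_id by simp
qed

end

section \<open>Irreducible characters\<close>

context young_data begin

definition ideal :: "galg set" where "ideal = (\<lambda>x. x \<star> cc) ` A"

text \<open>\<open>chi \<sigma>\<close> is the trace of \<open>x \<mapsto> \<sigma> x cc / kappa\<close> on the whole group algebra; right multiplication by
  \<open>cc / kappa\<close> is a projection onto the ideal.\<close>

definition chi :: "(nat \<Rightarrow> nat) \<Rightarrow> complex" where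
  "chi \<sigma> = inverse kappa * (\<Sum>\<tau>\<in>G. cc (inv \<tau> \<circ> inv \<sigma> \<circ> \<tau>))"

lemma subspace_A: "fvs.subspace A"
  unfolding fvs.subspace_def by (simp add: group_algebra_def)

lemma subspace_ideal: "fvs.subspace ideal"
proof -
  have "fvs.subspace ((\<lambda>x. x \<star> cc) ` A)"
    unfolding fvs.subspace_def
  proof (intro conjI ballI allI)
    show "0 \<in> (\<lambda>x. x \<star> cc) ` A"
      by (rule image_eqI[of _ _ 0]) (auto simp: subspace_A fvs.subspace_0)
  next
    fix x y assume "x \<in> (\<lambda>x. x \<star> cc) ` A" "y \<in> (\<lambda>x. x \<star> cc) ` A"
    then obtain u v where "u \<in> A" "v \<in> A" "x = u \<star> cc" "y = v \<star> cc" by auto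
    then show "x + y \<in> (\<lambda>x. x \<star> cc) ` A"
      by (intro image_eqI[of _ _ "u + v"]) (simp_all add: gmult_add_left fvs.subspace_add[OF subspace_A] del: plus_fun_apply)
  next
    fix k x assume "x \<in> (\<lambda>x. x \<star> cc) ` A"
    then obtain u where "u \<in> A" "x = u \<star> cc" by auto
    then show "fscale k x \<in> (\<lambda>x. x \<star> cc) ` A"
      by (intro image_eqI[of _ _ "fscale k u"]) (simp_all add: gmult_scale_left fvs.subspace_scale[OF subspace_A])
  qed
  then show ?thesis by (simp add: ideal_def)
qed

lemma ideal_A: "x \<in> ideal \<Longrightarrow> x \<in> A"
  by (auto simp: ideal_def gmult_in_group_algebra)

lemma ideal_cc: "x \<in> ideal \<Longrightarrow> x \<star> cc = fscale kappa x"
  by (auto simp: ideal_def gmult_assoc cc_cc gmult_scale_right)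

lemma finite_independent_ideal:
  assumes "fvs.independent B" "fvs.span B = ideal"
  shows "finite B"
proof -
  have "A \<subseteq> fvs.span (gelem ` G)"
  proof
    fix x assume "x \<in> A"
    then show "x \<in> fvs.span (gelem ` G)"
      by (subst group_algebra_expand, assumption) (intro fvs.span_sum fvs.span_scale fvs.span_base imageI)
  qed
  then have "B \<subseteq> fvs.span (gelem ` G)" using ideal_A assms(2) fvs.span_base[of _ B] by blast
  then show ?thesis using fvs.independent_span_bound[of "gelem ` G" B] assms(1) by simp
qed

text \<open>Inserting the projection \<open>p\<close> onto the ideal extends the trace to the whole
  group algebra; the interchange of sums is tr(XY) = tr(YX). The result no longer involves
  \<open>B\<close>.\<close>

lemma sum_representation_gelem:
  assumes B: "fvs.independent B" "fvs.span B = ideal" and \<sigma>: "\<sigma> \<in> G"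
  shows "(\<Sum>u\<in>B. fvs.representation B (gelem \<sigma> \<star> u) u) = chi \<sigma>"
proof -
  have fin: "finite B" using finite_independent_ideal[OF B] .
  let ?rep = "fvs.representation B"
  define p where "p x = fscale (inverse kappa) (x \<star> cc)" for x
  have p_ideal: "p x \<in> fvs.span B" if "x \<in> A" for x
    unfolding p_def B(2) using that by (intro fvs.subspace_scale[OF subspace_ideal]) (auto simp: ideal_def)
  have p_id: "p x = x" if "x \<in> ideal" for x
    unfolding p_def ideal_cc[OF that] using kappa_nonzero by (simp add: fun_eq_iff)
  have B_ideal: "u \<in> ideal" if "u \<in> B" for u using fvs.span_base[OF that] B(2) by simp
  have f_ideal: "gelem \<sigma> \<star> u \<in> ideal" if uB: "u \<in> B" for u
  proof -
    obtain x where "x \<in> A" "u = x \<star> cc" using B_ideal[OF uB] by (auto simp: ideal_def)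
    then show ?thesis unfolding ideal_def
      by (intro image_eqI[of _ _ "gelem \<sigma> \<star> x"]) (simp_all add: gmult_assoc gmult_in_group_algebra)
  qed
  have p_expand: "p x = (\<Sum>g\<in>G. fscale (x g) (p (gelem g)))" if "x \<in> A" for x
  proof -
    have "p x = fscale (inverse kappa) ((\<Sum>g\<in>G. fscale (x g) (gelem g)) \<star> cc)"
      unfolding p_def using group_algebra_expand[OF that] by simp
    also have "\<dots> = (\<Sum>g\<in>G. fscale (x g) (p (gelem g)))"
      unfolding gmult_sum_left fscale_sum gmult_scale_left p_def
      by (rule sum.cong) (simp_all add: fun_eq_iff)
    finally show ?thesis .
  qed
  have "(\<Sum>u\<in>B. ?rep (gelem \<sigma> \<star> u) u) = (\<Sum>u\<in>B. ?rep (p (gelem \<sigma> \<star> u)) u)"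
    by (rule sum.cong) (simp_all add: p_id f_ideal)
  also have "\<dots> = (\<Sum>u\<in>B. \<Sum>g\<in>G. (gelem \<sigma> \<star> u) g * ?rep (p (gelem g)) u)"
  proof (rule sum.cong[OF refl])
    fix u assume u: "u \<in> B"
    have "?rep (p (gelem \<sigma> \<star> u)) = (\<lambda>v. \<Sum>g\<in>G. ?rep (fscale ((gelem \<sigma> \<star> u) g) (p (gelem g))) v)"
      unfolding p_expand[OF ideal_A[OF f_ideal[OF u]]]
      by (rule fvs.representation_sum[OF B(1)]) (auto intro!: fvs.span_scale p_ideal)
    then show "?rep (p (gelem \<sigma> \<star> u)) u = (\<Sum>g\<in>G. (gelem \<sigma> \<star> u) g * ?rep (p (gelem g)) u)"
      by (simp add: fvs.representation_scale[OF B(1)] p_ideal)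
  qed
  also have "\<dots> = (\<Sum>g\<in>G. \<Sum>u\<in>B. (gelem \<sigma> \<star> u) g * ?rep (p (gelem g)) u)"
    by (rule sum.swap)
  also have "\<dots> = (\<Sum>g\<in>G. (gelem \<sigma> \<star> p (gelem g)) g)"
  proof (rule sum.cong[OF refl])
    fix g assume g: "g \<in> G"
    have "p (gelem g) = (\<Sum>u\<in>B. fscale (?rep (p (gelem g)) u) u)"
      by (rule fvs.sum_representation_eq[symmetric, OF B(1) p_ideal fin subset_refl]) (simp add: g)
    then have "gelem \<sigma> \<star> p (gelem g) = gelem \<sigma> \<star> (\<Sum>u\<in>B. fscale (?rep (p (gelem g)) u) u)" by simp
    then show "(\<Sum>u\<in>B. (gelem \<sigma> \<star> u) g * ?rep (p (gelem g)) u) = (gelem \<sigma> \<star> p (gelem g)) g"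
      by (simp add: gmult_sum_right gmult_scale_right sum_fun_apply mult.commute)
  qed
  also have "\<dots> = (\<Sum>g\<in>G. inverse kappa * cc (inv g \<circ> inv \<sigma> \<circ> g))"
  proof (rule sum.cong[OF refl])
    fix g assume g: "g \<in> G"
    show "(gelem \<sigma> \<star> p (gelem g)) g = inverse kappa * cc (inv g \<circ> inv \<sigma> \<circ> g)"
      unfolding p_def gmult_scale_right using g \<sigma>
      by (simp add: gmult_gelem_left comp_assoc)
  qed
  finally show ?thesis by (simp add: chi_def sum_distrib_left)
qed

text \<open>Every basis yields the same sum, so the one picked by the choice operator does too; what
  remains is that a basis exists.\<close>

lemma trace_on_ideal:
  assumes "\<sigma> \<in> G"
  shows "trace_on ideal (\<lambda>x. gelem \<sigma> \<star> x) = chi \<sigma>"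
proof -
  obtain B where "B \<subseteq> ideal" "fvs.independent B" "ideal \<subseteq> fvs.span B"
    using fvs.maximal_independent_subset[of ideal] by blast
  moreover from this have "fvs.span B = ideal"
    using fvs.span_minimal[OF _ subspace_ideal, of B] by blast
  ultimately have "\<exists>B. fvs.independent B \<and> fvs.span B = ideal" by blast
  from someI_ex[OF this] show ?thesis
    unfolding trace_on_def Let_def using sum_representation_gelem[OF _ _ assms] by blast
qed

lemma chi_real: "chi \<sigma> \<in> \<real>"
  unfolding chi_def using realv_cc kappa_real by (intro Reals_mult sum_in_Reals) (auto simp: realv_def)

text \<open>\<open>chi\<close> sums the conjugates of \<open>cc\<close>, read at inverses. A class
  function pairs equally with all of them, so the n! terms collapse to one.\<close>

lemma inner_chi:
  assumes cls: "\<And>\<sigma> \<tau>. \<sigma> \<in> G \<Longrightarrow> \<tau> \<in> G \<Longrightarrow> f (\<tau> \<circ> \<sigma> \<circ> inv \<tau>) = f \<sigma>"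
  shows "(\<Sum>\<sigma>\<in>G. f \<sigma> * chi \<sigma>) = fact n * inverse kappa * (f \<star> cc) id"
proof -
  have "(\<Sum>\<sigma>\<in>G. f \<sigma> * chi \<sigma>) = (\<Sum>\<tau>\<in>G. \<Sum>\<sigma>\<in>G. inverse kappa * (f \<sigma> * cc (inv \<tau> \<circ> inv \<sigma> \<circ> \<tau>)))"
    unfolding chi_def sum_distrib_left by (subst sum.swap) (simp add: mult_ac)
  also have "\<dots> = (\<Sum>\<tau>\<in>G. inverse kappa * (f \<star> cc) id)"
  proof (rule sum.cong[OF refl])
    fix \<tau> assume \<tau>: "\<tau> \<in> G"
    have "(\<Sum>\<sigma>\<in>G. inverse kappa * (f \<sigma> * cc (inv \<tau> \<circ> inv \<sigma> \<circ> \<tau>)))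
      = (\<Sum>\<sigma>\<in>G. inverse kappa * (f (\<tau> \<circ> \<sigma> \<circ> inv \<tau>) * cc (inv \<tau> \<circ> inv (\<tau> \<circ> \<sigma> \<circ> inv \<tau>) \<circ> \<tau>)))"
      by (rule sum_sym_group_conj[OF \<tau>, symmetric])
    also have "\<dots> = (\<Sum>\<sigma>\<in>G. inverse kappa * (f \<sigma> * cc (inv \<sigma>)))"
    proof (rule sum.cong[OF refl])
      fix \<sigma> assume \<sigma>: "\<sigma> \<in> G"
      have "inv \<tau> \<circ> inv (\<tau> \<circ> \<sigma> \<circ> inv \<tau>) \<circ> \<tau> = inv \<sigma>"
        using \<tau> \<sigma> by (simp add: sym_group_inv_distrib[of _ n] comp_assoc)
      then show "inverse kappa * (f (\<tau> \<circ> \<sigma> \<circ> inv \<tau>) * cc (inv \<tau> \<circ> inv (\<tau> \<circ> \<sigma> \<circ> inv \<tau>) \<circ> \<tau>))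
        = inverse kappa * (f \<sigma> * cc (inv \<sigma>))" using cls[OF \<sigma> \<tau>] by simp
    qed
    finally show "(\<Sum>\<sigma>\<in>G. inverse kappa * (f \<sigma> * cc (inv \<tau> \<circ> inv \<sigma> \<circ> \<tau>))) = inverse kappa * (f \<star> cc) id"
      by (simp add: gmult_id_apply sum_distrib_left)
  qed
  finally show ?thesis by (simp add: card_sym_group)
qed

lemma chi_class:
  assumes "\<sigma> \<in> G" "\<rho> \<in> G"
  shows "chi (\<rho> \<circ> \<sigma> \<circ> inv \<rho>) = chi \<sigma>"
proof -
  have "(\<Sum>\<tau>\<in>G. cc (inv \<tau> \<circ> inv (\<rho> \<circ> \<sigma> \<circ> inv \<rho>) \<circ> \<tau>)) =
     (\<Sum>\<tau>\<in>G. cc (inv (\<rho> \<circ> \<tau>) \<circ> inv (\<rho> \<circ> \<sigma> \<circ> inv \<rho>) \<circ> (\<rho> \<circ> \<tau>)))"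
    by (rule sum_sym_group_left[OF assms(2), symmetric])
  also have "\<dots> = (\<Sum>\<tau>\<in>G. cc (inv \<tau> \<circ> inv \<sigma> \<circ> \<tau>))"
  proof (rule sum.cong[OF refl])
    fix \<tau> assume \<tau>: "\<tau> \<in> G"
    have "inv (\<rho> \<circ> \<tau>) \<circ> inv (\<rho> \<circ> \<sigma> \<circ> inv \<rho>) \<circ> (\<rho> \<circ> \<tau>) = inv \<tau> \<circ> inv \<sigma> \<circ> \<tau>"
      using \<tau> assms by (simp add: sym_group_inv_distrib[of _ n] comp_assoc)
    then show "cc (inv (\<rho> \<circ> \<tau>) \<circ> inv (\<rho> \<circ> \<sigma> \<circ> inv \<rho>) \<circ> (\<rho> \<circ> \<tau>)) = cc (inv \<tau> \<circ> inv \<sigma> \<circ> \<tau>)" by simp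
  qed
  finally show ?thesis by (simp add: chi_def)
qed

lemma gelem_id_apply: "\<tau> \<in> G \<Longrightarrow> (gelem \<tau> \<star> x) id = x (inv \<tau>)"
  by (simp add: gmult_gelem_left)

lemma gelem_inv_id_apply: "\<tau> \<in> G \<Longrightarrow> (x \<star> gelem (inv \<tau>)) id = x \<tau>"
  by (simp add: gmult_gelem_right)

text \<open>Cyclicity brings \<open>b\<close> to the front, where
  \<open>b \<star> gelem \<tau> \<star> a\<close> is \<open>cc (inv \<tau>)\<close> times
  \<open>b \<star> a\<close>; what is left is the coefficient of
  \<open>a \<star> b \<star> a \<star> y\<close> at \<tau>. The sum over \<tau> becomes a single
  product, in which \<open>y\<close> matters only through the scalar \<open>l\<close>.\<close>

lemma sum_conj_cc:
  assumes "y \<in> A" and y: "a \<star> y \<star> a \<star> b = fscale l (a \<star> b)"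
  shows "(\<Sum>\<tau>\<in>G. (gelem \<tau> \<star> (a \<star> y) \<star> gelem (inv \<tau>) \<star> cc) id) = kappa * l"
proof -
  have "(gelem \<tau> \<star> (a \<star> y) \<star> gelem (inv \<tau>) \<star> cc) id = (a \<star> b \<star> a \<star> y) \<tau> * cc (inv \<tau>)"
    if \<tau>: "\<tau> \<in> G" for \<tau>
  proof -
    have "(gelem \<tau> \<star> (a \<star> y) \<star> gelem (inv \<tau>) \<star> cc) id = (gelem \<tau> \<star> a \<star> y \<star> gelem (inv \<tau>) \<star> a \<star> b) id"
      by (simp add: cc_def gmult_assoc)
    also have "\<dots> = (b \<star> (gelem \<tau> \<star> a \<star> y \<star> gelem (inv \<tau>) \<star> a)) id"
      by (rule gmult_trace_comm)
    also have "b \<star> (gelem \<tau> \<star> a \<star> y \<star> gelem (inv \<tau>) \<star> a) = (b \<star> gelem \<tau> \<star> a) \<star> (y \<star> gelem (inv \<tau>) \<star> a)"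
      by (simp add: gmult_assoc)
    also have "b \<star> gelem \<tau> \<star> a = fscale (cc (inv \<tau>)) (b \<star> a)"
    proof -
      have "(b \<star> gelem \<tau> \<star> a) id = (gelem \<tau> \<star> (a \<star> b)) id"
        using gmult_trace_comm[of n b "gelem \<tau> \<star> a"] by (simp add: gmult_assoc)
      then have "(b \<star> gelem \<tau> \<star> a) id = cc (inv \<tau>)" using \<tau> by (simp add: gelem_id_apply cc_def)
      then show ?thesis using b_mul_a[OF gelem_in_group_algebra[OF \<tau>]] by simp
    qed
    also have "(fscale (cc (inv \<tau>)) (b \<star> a) \<star> (y \<star> gelem (inv \<tau>) \<star> a)) id
       = cc (inv \<tau>) * ((b \<star> a \<star> y \<star> gelem (inv \<tau>)) \<star> a) id"
      by (simp add: gmult_scale_left gmult_assoc)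
    also have "((b \<star> a \<star> y \<star> gelem (inv \<tau>)) \<star> a) id = (a \<star> (b \<star> a \<star> y \<star> gelem (inv \<tau>))) id"
      by (rule gmult_trace_comm)
    also have "a \<star> (b \<star> a \<star> y \<star> gelem (inv \<tau>)) = (a \<star> b \<star> a \<star> y) \<star> gelem (inv \<tau>)"
      by (simp add: gmult_assoc)
    finally show ?thesis by (simp only: gelem_inv_id_apply[OF \<tau>] mult.commute)
  qed
  then have "(\<Sum>\<tau>\<in>G. (gelem \<tau> \<star> (a \<star> y) \<star> gelem (inv \<tau>) \<star> cc) id)
     = (\<Sum>\<tau>\<in>G. (a \<star> b \<star> a \<star> y) \<tau> * cc (inv \<tau>))" by (rule sum.cong[OF refl])
  also have "\<dots> = (a \<star> b \<star> a \<star> y \<star> cc) id" by (simp add: gmult_id_apply)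
  also have "a \<star> b \<star> a \<star> y \<star> cc = a \<star> b \<star> (a \<star> y \<star> a \<star> b)" by (simp add: cc_def gmult_assoc)
  also have "\<dots> = fscale l (cc \<star> cc)" by (simp add: y gmult_scale_right cc_def)
  finally show ?thesis by (simp only: cc_cc fscale_apply cc_id mult_1_right mult_1_left mult.commute)
qed

text \<open>The norm of \<open>chi\<close>, in the form supplied by \<open>inner_chi\<close>. By
  \<open>a_mul_b\<close>, pairing a conjugate of \<open>cc\<close> with \<open>cc\<close> gives a
  coefficient of \<open>a \<star> b \<star> a\<close> times one of
  \<open>b \<star> a \<star> b\<close>; summed over conjugates this is the identity coefficient of
  the cube of \<open>cc\<close>, namely kappa^2.\<close>

lemma chi_cc: "(chi \<star> cc) id = kappa"
proof -
  have "(\<Sum>\<sigma>\<in>G. (\<Sum>\<tau>\<in>G. cc (inv \<tau> \<circ> inv \<sigma> \<circ> \<tau>)) * cc (inv \<sigma>))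
     = (\<Sum>\<tau>\<in>G. \<Sum>\<sigma>\<in>G. cc (inv \<tau> \<circ> inv \<sigma> \<circ> \<tau>) * cc (inv \<sigma>))"
    unfolding sum_distrib_right by (rule sum.swap)
  also have "\<dots> = (\<Sum>\<tau>\<in>G. (a \<star> b \<star> a) (inv \<tau>) * (b \<star> a \<star> b) \<tau>)"
  proof (rule sum.cong[OF refl])
    fix \<tau> assume \<tau>: "\<tau> \<in> G"
    have sc: "star n cc = b \<star> a" by (simp add: cc_def star_gmult star_a star_b)
    have "(\<Sum>\<sigma>\<in>G. cc (inv \<tau> \<circ> inv \<sigma> \<circ> \<tau>) * cc (inv \<sigma>)) = (\<Sum>\<sigma>\<in>G. cc (inv \<tau> \<circ> \<sigma> \<circ> \<tau>) * cc \<sigma>)"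
      by (rule sum_sym_group_inv[of "\<lambda>\<sigma>. cc (inv \<tau> \<circ> \<sigma> \<circ> \<tau>) * cc \<sigma>"])
    also have "\<dots> = (gelem \<tau> \<star> cc \<star> gelem (inv \<tau>) \<star> (b \<star> a)) id"
      unfolding gmult_id_apply sc[symmetric]
      by (rule sum.cong) (use \<tau> in \<open>simp_all add: gmult_conj_apply star_def\<close>)
    also have "\<dots> = ((gelem \<tau> \<star> a \<star> b \<star> gelem (inv \<tau>) \<star> b) \<star> a) id" by (simp add: cc_def gmult_assoc)
    also have "\<dots> = (a \<star> (gelem \<tau> \<star> a \<star> b \<star> gelem (inv \<tau>) \<star> b)) id" by (rule gmult_trace_comm)
    also have "a \<star> (gelem \<tau> \<star> a \<star> b \<star> gelem (inv \<tau>) \<star> b) = (a \<star> (gelem \<tau> \<star> a) \<star> b) \<star> (gelem (inv \<tau>) \<star> b)"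
      by (simp add: gmult_assoc)
    also have "a \<star> (gelem \<tau> \<star> a) \<star> b = fscale ((a \<star> b \<star> a) (inv \<tau>)) (a \<star> b)"
    proof -
      have "(a \<star> (gelem \<tau> \<star> a) \<star> b) id = ((gelem \<tau> \<star> a \<star> b) \<star> a) id"
        using gmult_trace_comm[of n a "gelem \<tau> \<star> a \<star> b"] by (simp add: gmult_assoc)
      then have "(a \<star> (gelem \<tau> \<star> a) \<star> b) id = (a \<star> b \<star> a) (inv \<tau>)"
        using gelem_id_apply[OF \<tau>, of "a \<star> b \<star> a"] by (simp add: gmult_assoc)
      then show ?thesis using a_mul_b[of "gelem \<tau> \<star> a"] by (simp add: gmult_in_group_algebra)
    qed
    also have "(fscale ((a \<star> b \<star> a) (inv \<tau>)) (a \<star> b) \<star> (gelem (inv \<tau>) \<star> b)) id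
       = (a \<star> b \<star> a) (inv \<tau>) * ((a \<star> b \<star> gelem (inv \<tau>)) \<star> b) id"
      by (simp add: gmult_scale_left gmult_assoc)
    also have "((a \<star> b \<star> gelem (inv \<tau>)) \<star> b) id = ((b \<star> a \<star> b) \<star> gelem (inv \<tau>)) id"
      using gmult_trace_comm[of n "a \<star> b \<star> gelem (inv \<tau>)" b] by (simp add: gmult_assoc)
    finally show "(\<Sum>\<sigma>\<in>G. cc (inv \<tau> \<circ> inv \<sigma> \<circ> \<tau>) * cc (inv \<sigma>)) = (a \<star> b \<star> a) (inv \<tau>) * (b \<star> a \<star> b) \<tau>"
      by (simp only: gelem_inv_id_apply[OF \<tau>])
  qed
  also have "\<dots> = ((b \<star> a \<star> b) \<star> (a \<star> b \<star> a)) id"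
    by (simp add: gmult_id_apply mult.commute)
  also have "\<dots> = (a \<star> b \<star> a \<star> b \<star> a \<star> b) id"
    using gmult_trace_comm[of n "b" "a \<star> b \<star> a \<star> b \<star> a"] by (simp add: gmult_assoc)
  also have "a \<star> b \<star> a \<star> b \<star> a \<star> b = cc \<star> cc \<star> cc" by (simp add: cc_def gmult_assoc)
  also have "\<dots> = fscale (kappa * kappa) cc" by (simp add: cc_cc gmult_scale_left fun_eq_iff)
  finally have "(\<Sum>\<sigma>\<in>G. (\<Sum>\<tau>\<in>G. cc (inv \<tau> \<circ> inv \<sigma> \<circ> \<tau>)) * cc (inv \<sigma>)) = kappa * kappa"
    by (simp only: fscale_apply cc_id mult_1_right)
  moreover have "(chi \<star> cc) id = inverse kappa * (\<Sum>\<sigma>\<in>G. (\<Sum>\<tau>\<in>G. cc (inv \<tau> \<circ> inv \<sigma> \<circ> \<tau>)) * cc (inv \<sigma>))"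
    by (simp only: gmult_id_apply chi_def mult.assoc sum_distrib_left[symmetric])
  ultimately show ?thesis using kappa_nonzero by simp
qed

text \<open>The equality case of the Cauchy-Schwarz inequality: both class functions have norm \<open>1\<close>, and so has
  their inner product, which is \<open>(f \<star> cc) id / kappa\<close>.\<close>

lemma chi_eqI:
  fixes f :: "(nat \<Rightarrow> nat) \<Rightarrow> int"
  assumes cls: "\<And>\<sigma> \<tau>. \<sigma> \<in> G \<Longrightarrow> \<tau> \<in> G \<Longrightarrow> f (\<tau> \<circ> \<sigma> \<circ> inv \<tau>) = f \<sigma>"
    and norm: "(\<Sum>\<sigma>\<in>G. f \<sigma> * f \<sigma>) = fact n"
    and inner: "((\<lambda>\<sigma>. of_int (f \<sigma>)) \<star> cc) id = kappa"
    and \<sigma>: "\<sigma> \<in> G"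
  shows "chi \<sigma> = of_int (f \<sigma>)"
proof -
  define d where "d \<sigma> = chi \<sigma> - of_int (f \<sigma>)" for \<sigma>
  have d_real: "d \<sigma> = of_real (Re (d \<sigma>))" for \<sigma>
    using chi_real[of \<sigma>] by (simp add: d_def complex_is_Real_iff complex_eq_iff)
  have 1: "(\<Sum>\<sigma>\<in>G. chi \<sigma> * chi \<sigma>) = fact n"
  proof -
    have "(\<Sum>\<sigma>\<in>G. chi \<sigma> * chi \<sigma>) = fact n * inverse kappa * (chi \<star> cc) id"
      by (rule inner_chi[where f = chi]) (rule chi_class)
    then show ?thesis by (simp only: chi_cc mult.assoc left_inverse[OF kappa_nonzero] mult_1_right)
  qed
  have 2: "(\<Sum>\<sigma>\<in>G. of_int (f \<sigma>) * chi \<sigma>) = fact n"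
  proof -
    have "(\<Sum>\<sigma>\<in>G. of_int (f \<sigma>) * chi \<sigma>) = fact n * inverse kappa * ((\<lambda>\<sigma>. of_int (f \<sigma>)) \<star> cc) id"
      by (rule inner_chi[where f = "\<lambda>\<sigma>. of_int (f \<sigma>)"]) (simp only: cls)
    then show ?thesis by (simp only: inner mult.assoc left_inverse[OF kappa_nonzero] mult_1_right)
  qed
  have 3: "(\<Sum>\<sigma>\<in>G. of_int (f \<sigma>) * of_int (f \<sigma>)) = (fact n :: complex)"
    using arg_cong[OF norm, of "of_int :: int \<Rightarrow> complex"]
    by (simp only: of_int_sum of_int_mult of_int_fact)
  have "(\<Sum>\<sigma>\<in>G. d \<sigma> * d \<sigma>) = (\<Sum>\<sigma>\<in>G. chi \<sigma> * chi \<sigma>) - 2 * (\<Sum>\<sigma>\<in>G. of_int (f \<sigma>) * chi \<sigma>)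
     + (\<Sum>\<sigma>\<in>G. of_int (f \<sigma>) * of_int (f \<sigma>))"
    unfolding sum_distrib_left sum_subtractf[symmetric] sum.distrib[symmetric]
    by (rule sum.cong) (simp_all add: d_def algebra_simps)
  also have "\<dots> = 0" unfolding 1 2 3 by simp
  finally have "(\<Sum>\<sigma>\<in>G. d \<sigma> * d \<sigma>) = 0" .
  moreover have "(\<Sum>\<sigma>\<in>G. d \<sigma> * d \<sigma>) = of_real (\<Sum>\<sigma>\<in>G. Re (d \<sigma>) * Re (d \<sigma>))"
    unfolding of_real_sum by (rule sum.cong[OF refl]) (metis d_real of_real_mult)
  ultimately have "(\<Sum>\<sigma>\<in>G. Re (d \<sigma>) * Re (d \<sigma>)) = 0" by (metis of_real_eq_0_iff)
  then have "Re (d \<sigma>) = 0" using \<sigma> by (subst (asm) sum_nonneg_eq_0_iff) auto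
  then have "d \<sigma> = 0" using d_real[of \<sigma>] by simp
  then show ?thesis by (simp add: d_def)
qed

end

section \<open>Block symmetrizers\<close>

lemma orbit_sum:
  fixes act :: "(nat \<Rightarrow> nat) \<Rightarrow> 's \<Rightarrow> 's" and F :: "'s \<Rightarrow> complex"
  assumes comp: "\<And>\<sigma> \<tau> s. act (\<sigma> \<circ> \<tau>) s = act \<sigma> (act \<tau> s)"
    and id: "\<And>s. act id s = s"
    and orbit: "(\<lambda>\<tau>. act \<tau> t) ` sym_group n = A"
  shows "(\<Sum>\<tau>\<in>sym_group n. F (act \<tau> t)) = of_nat (card {\<sigma> \<in> sym_group n. act \<sigma> t = t}) * (\<Sum>s\<in>A. F s)"
proof -
  have "(\<Sum>\<tau>\<in>sym_group n. F (act \<tau> t)) = (\<Sum>s\<in>A. \<Sum>\<tau>\<in>{\<tau> \<in> sym_group n. act \<tau> t = s}. F (act \<tau> t))"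
    using sum.image_gen[OF finite_sym_group, of "\<lambda>\<tau>. F (act \<tau> t)" n "\<lambda>\<tau>. act \<tau> t"] unfolding orbit .
  also have "\<dots> = (\<Sum>s\<in>A. of_nat (card {\<sigma> \<in> sym_group n. act \<sigma> t = t}) * F s)"
  proof (rule sum.cong[OF refl])
    fix s assume "s \<in> A"
    then obtain \<rho> where \<rho>: "\<rho> \<in> sym_group n" "act \<rho> t = s" using orbit by auto
    then have \<rho>': "act (inv \<rho>) s = t" using comp[of "inv \<rho>" \<rho> t] id by simp
    have "bij_betw (\<lambda>\<sigma>. \<rho> \<circ> \<sigma>) {\<sigma> \<in> sym_group n. act \<sigma> t = t} {\<tau> \<in> sym_group n. act \<tau> t = s}"
      by (rule bij_betwI[where g = "\<lambda>\<sigma>. inv \<rho> \<circ> \<sigma>"]) (use \<rho> \<rho>' in \<open>auto simp: comp\<close>)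
    then have "card {\<tau> \<in> sym_group n. act \<tau> t = s} = card {\<sigma> \<in> sym_group n. act \<sigma> t = t}"
      by (rule bij_betw_same_card[symmetric])
    then show "(\<Sum>\<tau>\<in>{\<tau> \<in> sym_group n. act \<tau> t = s}. F (act \<tau> t)) = of_nat (card {\<sigma> \<in> sym_group n. act \<sigma> t = t}) * F s"
      by simp
  qed
  finally show ?thesis by (simp add: sum_distrib_left)
qed

text \<open>For disjoint X and S the Young subgroup S(X) x S(S). It is written as a stabilizer so
  that, with X the complement of S, it consists of the permutations for which S occurs in the sum
  \<open>Phi\<close>.\<close>

definition block_perms :: "nat set \<Rightarrow> nat set \<Rightarrow> (nat \<Rightarrow> nat) set" where
  "block_perms X S = {\<sigma>. \<sigma> permutes (X \<union> S) \<and> \<sigma> ` S = S}"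

lemma block_perms_image_left:
  assumes "\<sigma> \<in> block_perms X S" "X \<inter> S = {}"
  shows "\<sigma> ` X = X"
proof -
  have p: "\<sigma> permutes (X \<union> S)" "\<sigma> ` S = S" using assms(1) by (auto simp: block_perms_def)
  have "\<sigma> ` X = \<sigma> ` ((X \<union> S) - S)" using assms(2) by (intro arg_cong[where f = "(`) \<sigma>"]) auto
  also have "\<dots> = (X \<union> S) - S"
    using image_set_diff[OF permutes_inj[OF p(1)]] permutes_image[OF p(1)] p(2) by simp
  finally show ?thesis using assms(2) by auto
qed

lemma block_perms_bij:
  assumes "X \<inter> S = {}"
  shows "bij_betw (\<lambda>(p, q). p \<circ> q) ({p. p permutes X} \<times> {q. q permutes S}) (block_perms X S)"
proof (rule bij_betwI[where g = "\<lambda>\<sigma>. (restr X \<sigma>, restr S \<sigma>)"])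
  show "(\<lambda>(p, q). p \<circ> q) \<in> {p. p permutes X} \<times> {q. q permutes S} \<rightarrow> block_perms X S"
  proof clarify
    fix p q assume p: "p permutes X" and q: "q permutes S"
    have "p \<circ> q permutes (X \<union> S)"
      by (rule permutes_compose) (use p q permutes_subset in blast)+
    moreover have "(p \<circ> q) ` S = S"
    proof -
      have "p ` S = S" using p assms by (force simp: permutes_def image_iff)
      then show ?thesis using permutes_image[OF q] by (metis image_comp)
    qed
    ultimately show "p \<circ> q \<in> block_perms X S" by (simp add: block_perms_def)
  qed
  show "(\<lambda>\<sigma>. (restr X \<sigma>, restr S \<sigma>)) \<in> block_perms X S \<rightarrow> {p. p permutes X} \<times> {q. q permutes S}"
  proof
    fix \<sigma> assume \<sigma>: "\<sigma> \<in> block_perms X S"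
    then have "inj \<sigma>" "\<sigma> ` S = S" "\<sigma> ` X = X"
      using block_perms_image_left[OF \<sigma> assms] permutes_inj by (auto simp: block_perms_def)
    then show "(restr X \<sigma>, restr S \<sigma>) \<in> {p. p permutes X} \<times> {q. q permutes S}"
      by (simp add: restr_permutes)
  qed
next
  fix u assume "u \<in> {p. p permutes X} \<times> {q. q permutes S}"
  then obtain p q where u: "u = (p, q)" "p permutes X" "q permutes S" by auto
  have "restr X (p \<circ> q) x = p x" for x
    using u assms by (cases "x \<in> X"; cases "x \<in> S") (auto simp: restr_def permutes_def)
  moreover have "restr S (p \<circ> q) x = q x" for x
    using u assms permutes_in_image[OF u(3), of x] by (cases "x \<in> S") (auto simp: restr_def permutes_def)
  ultimately show "(restr X (case u of (p, q) \<Rightarrow> p \<circ> q), restr S (case u of (p, q) \<Rightarrow> p \<circ> q)) = u"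
    by (simp add: u(1) fun_eq_iff del: comp_apply)
next
  fix \<sigma> assume \<sigma>: "\<sigma> \<in> block_perms X S"
  have "restr X \<sigma> (restr S \<sigma> x) = \<sigma> x" for x
    using \<sigma> assms by (cases "x \<in> S"; cases "x \<in> X") (auto simp: restr_def block_perms_def permutes_def)
  then show "(case (restr X \<sigma>, restr S \<sigma>) of (p, q) \<Rightarrow> p \<circ> q) = \<sigma>" by (simp add: fun_eq_iff)
qed

lemma card_block_perms:
  assumes "finite X" "finite S" "X \<inter> S = {}"
  shows "card (block_perms X S) = fact (card X) * fact (card S)"
  using bij_betw_same_card[OF block_perms_bij[OF assms(3)]] assms
  by (simp add: card_cartesian_product card_permutations)

text \<open>The symmetrizer of \<open>X\<close> times the antisymmetrizer of \<open>S\<close>, for disjoint \<open>X\<close> and \<open>S\<close>.\<close>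

definition block_elem :: "nat set \<Rightarrow> nat set \<Rightarrow> galg" where
  "block_elem X S = (\<lambda>\<sigma>. if \<sigma> \<in> block_perms X S then of_int (rsign S \<sigma>) else 0)"

lemma block_elem_sym: "block_elem X {} \<sigma> = (if \<sigma> permutes X then 1 else 0)"
proof -
  have "restr {} \<sigma> = id" by (auto simp: restr_def)
  then show ?thesis by (simp add: block_elem_def block_perms_def rsign_def)
qed

lemma block_elem_alt: "block_elem {} S \<sigma> = (if \<sigma> permutes S then of_int (rsign S \<sigma>) else 0)"
  by (auto simp: block_elem_def block_perms_def permutes_image)

lemma block_perms_sym_group:
  assumes "X \<subseteq> {..<n}" "S \<subseteq> {..<n}" "\<sigma> \<in> block_perms X S"
  shows "\<sigma> \<in> sym_group n"
  using assms permutes_subset[of \<sigma> "X \<union> S" "{..<n}"] by (auto simp: block_perms_def sym_group_def)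

lemma block_elem_in_group_algebra:
  "X \<subseteq> {..<n} \<Longrightarrow> S \<subseteq> {..<n} \<Longrightarrow> block_elem X S \<in> group_algebra n"
  using block_perms_sym_group by (auto simp: group_algebra_def block_elem_def)

lemma block_perms_comp:
  "\<sigma> \<in> block_perms X S \<Longrightarrow> \<tau> \<in> block_perms X S \<Longrightarrow> \<sigma> \<circ> \<tau> \<in> block_perms X S"
  unfolding block_perms_def by (auto simp del: comp_apply intro!: permutes_compose image_comp_fixed)

lemma transpose_block_perms:
  "x \<in> X \<Longrightarrow> y \<in> X \<Longrightarrow> X \<inter> S = {} \<Longrightarrow> transpose x y \<in> block_perms X S"
  unfolding block_perms_def by (auto intro!: permutes_swap_id transpose_image_same)

lemma block_elem_transpose:
  assumes "X \<subseteq> {..<n}" "S \<subseteq> {..<n}" "X \<inter> S = {}" "x \<in> X" "y \<in> X" "x \<noteq> y"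
  shows "gmult n (block_elem X S) (gelem (transpose x y)) = block_elem X S"
proof
  fix \<sigma>
  let ?t = "transpose x y"
  have t: "?t \<in> block_perms X S" using transpose_block_perms assms by blast
  have tn: "?t \<in> sym_group n" using assms by (auto intro: sym_group_transpose)
  have iff: "\<sigma> \<circ> ?t \<in> block_perms X S \<longleftrightarrow> \<sigma> \<in> block_perms X S"
    using block_perms_comp[OF _ t, of \<sigma>] block_perms_comp[OF _ t, of "\<sigma> \<circ> ?t"]
    by (auto simp: comp_assoc)
  have inv: "inv ?t = ?t" by (simp add: inv_swap_id)
  show "gmult n (block_elem X S) (gelem ?t) \<sigma> = block_elem X S \<sigma>"
  proof (cases "\<sigma> \<in> sym_group n")
    case True
    have "rsign S (\<sigma> \<circ> ?t) = rsign S \<sigma>" if "\<sigma> \<in> block_perms X S"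
    proof -
      have "rsign S (\<sigma> \<circ> ?t) = rsign S \<sigma> * rsign S ?t"
        using that t assms(2) sym_group_inj[OF True] sym_group_inj[OF tn]
        by (intro rsign_comp) (auto simp: block_perms_def finite_subset)
      moreover have "rsign S ?t = 1" using assms(3-6) by (subst rsign_transpose) auto
      ultimately show ?thesis by simp
    qed
    then show ?thesis using True by (simp add: gmult_gelem_right tn inv block_elem_def iff)
  next
    case False
    then show ?thesis using gmult_in_group_algebra[OF gelem_in_group_algebra[OF tn], of "block_elem X S"]
        block_elem_in_group_algebra[OF assms(1,2)] by (simp add: group_algebra_def)
  qed
qed

lemma block_elem_conj:
  assumes "\<tau> \<in> sym_group n" "X \<subseteq> {..<n}" "S \<subseteq> {..<n}"
  shows "gmult n (gmult n (gelem \<tau>) (block_elem X S)) (gelem (inv \<tau>)) = block_elem (\<tau> ` X) (\<tau> ` S)"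
proof
  fix \<sigma>
  have p: "\<tau> permutes {..<n}" using assms(1) by (simp add: sym_group_def)
  have sub: "\<tau> ` X \<subseteq> {..<n}" "\<tau> ` S \<subseteq> {..<n}" using permutes_image[OF p] assms(2,3) by blast+
  show "gmult n (gmult n (gelem \<tau>) (block_elem X S)) (gelem (inv \<tau>)) \<sigma> = block_elem (\<tau> ` X) (\<tau> ` S) \<sigma>"
  proof (cases "\<sigma> \<in> sym_group n")
    case True
    define \<rho> where "\<rho> = inv \<tau> \<circ> \<sigma> \<circ> \<tau>"
    have \<rho>: "\<rho> \<in> sym_group n" "\<sigma> = \<tau> \<circ> \<rho> \<circ> inv \<tau>"
      using assms(1) True by (simp_all add: \<rho>_def comp_assoc)
    have perm: "\<alpha> permutes Y \<longleftrightarrow> (\<forall>x. x \<notin> Y \<longrightarrow> \<alpha> x = x)" if "\<alpha> \<in> sym_group n" for \<alpha> Y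
      using that by (auto simp: permutes_def sym_group_def)
    have imp: "\<tau> ` A = \<tau> ` B \<longleftrightarrow> A = B" for A B
      using inj_image_eq_iff[OF sym_group_inj[OF assms(1)]] .
    have "(\<sigma> ` \<tau> ` S = \<tau> ` S) = (\<rho> ` S = S)"
    proof -
      have "\<sigma> ` \<tau> ` S = \<tau> ` \<rho> ` S" unfolding \<rho>(2) using assms(1) by (simp add: image_image)
      then show ?thesis by (simp add: imp)
    qed
    moreover have "\<sigma> permutes (\<tau> ` X \<union> \<tau> ` S) \<longleftrightarrow> \<rho> permutes (X \<union> S)"
    proof -
      have "(\<forall>x. x \<notin> \<tau> ` (X \<union> S) \<longrightarrow> \<sigma> x = x) \<longleftrightarrow> (\<forall>y. \<tau> y \<notin> \<tau> ` (X \<union> S) \<longrightarrow> \<sigma> (\<tau> y) = \<tau> y)"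
        using assms(1) by (metis sym_group_inv_comp(3))
      also have "\<dots> \<longleftrightarrow> (\<forall>y. y \<notin> X \<union> S \<longrightarrow> \<rho> y = y)"
        using sym_group_inj[OF assms(1)] assms(1) by (simp add: inj_image_mem_iff \<rho>(2) inj_eq)
      finally show ?thesis unfolding perm[OF True] perm[OF \<rho>(1)] image_Un .
    qed
    ultimately have "\<sigma> \<in> block_perms (\<tau> ` X) (\<tau> ` S) \<longleftrightarrow> \<rho> \<in> block_perms X S"
      by (simp add: block_perms_def)
    moreover have "rsign (\<tau> ` S) \<sigma> = rsign S \<rho>" if "\<rho> \<in> block_perms X S"
      unfolding \<rho>(2) by (rule rsign_conj) (use assms \<rho> that in \<open>auto simp: block_perms_def\<close>)
    ultimately show ?thesis
      using gmult_conj_apply[OF assms(1) True, of "block_elem X S"] by (simp add: block_elem_def \<rho>_def[symmetric])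
  next
    case False
    then show ?thesis
      using gmult_in_group_algebra[OF gelem_in_group_algebra[OF sym_group_inv[OF assms(1)]]]
        block_elem_in_group_algebra[OF sub]
      by (simp add: group_algebra_def)
  qed
qed

text \<open>A permutation factors through the two blocks in at most one way, so the convolution sum
  has at most one nonzero term.\<close>

lemma block_elem_split:
  assumes "X \<subseteq> {..<n}" "S \<subseteq> {..<n}" "X \<inter> S = {}"
  shows "gmult n (block_elem X {}) (block_elem {} S) = block_elem X S"
proof
  fix \<sigma>
  have fin: "finite S" using assms finite_subset by blast
  have "gmult n (block_elem X {}) (block_elem {} S) \<sigma>
     = (\<Sum>\<tau>\<in>sym_group n. if \<tau> permutes X \<and> (inv \<tau> \<circ> \<sigma>) permutes S then of_int (rsign S (inv \<tau> \<circ> \<sigma>)) else 0)"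
    unfolding gmult_apply
    by (rule sum.cong) (simp_all add: block_elem_sym block_elem_alt)
  also have "\<dots> = block_elem X S \<sigma>"
  proof (cases "\<sigma> \<in> block_perms X S")
    case True
    have i: "inj \<sigma>" "\<sigma> ` S = S" "\<sigma> ` X = X"
      using block_perms_image_left[OF True assms(3)] True permutes_inj by (auto simp: block_perms_def)
    obtain p q where pq: "p permutes X" "q permutes S" "\<sigma> = p \<circ> q"
    proof -
      have "\<sigma> \<in> (\<lambda>(p, q). p \<circ> q) ` ({p. p permutes X} \<times> {q. q permutes S})"
        unfolding bij_betw_imp_surj_on[OF block_perms_bij[OF assms(3)]] by (rule True)
      then show thesis using that by auto
    qed
    have pG: "p \<in> sym_group n" using permutes_subset[OF pq(1) assms(1)] by (simp add: sym_group_def)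
    have uniq: "\<tau> = p" if \<tau>: "\<tau> \<in> sym_group n" "\<tau> permutes X" "(inv \<tau> \<circ> \<sigma>) permutes S" for \<tau>
    proof -
      have "(\<tau>, inv \<tau> \<circ> \<sigma>) = (p, q)"
        using bij_betw_imp_inj_on[OF block_perms_bij[OF assms(3)]]
        by (rule inj_onD) (use \<tau> pq in auto)
      then show ?thesis by simp
    qed
    have "inv p \<circ> \<sigma> = q" using pq(3) pG by simp
    have r: "rsign S q = rsign S \<sigma>"
    proof -
      have "p (q x) = q x" if "x \<in> S" for x
      proof -
        have "q x \<notin> X" using that assms(3) permutes_in_image[OF pq(2), of x] by blast
        then show ?thesis by (rule permutes_not_in[OF pq(1)])
      qed
      then have "restr S q = restr S \<sigma>" by (auto simp: pq(3) restr_def)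
      then show ?thesis by (simp add: rsign_def)
    qed
    have "(\<Sum>\<tau>\<in>sym_group n. if \<tau> permutes X \<and> (inv \<tau> \<circ> \<sigma>) permutes S then of_int (rsign S (inv \<tau> \<circ> \<sigma>)) else 0)
       = (\<Sum>\<tau>\<in>{p}. if \<tau> permutes X \<and> (inv \<tau> \<circ> \<sigma>) permutes S then of_int (rsign S (inv \<tau> \<circ> \<sigma>)) else 0)"
      by (rule sum.mono_neutral_right) (use uniq pG in auto)
    also have "\<dots> = of_int (rsign S \<sigma>)" using pq \<open>inv p \<circ> \<sigma> = q\<close> r by simp
    finally show ?thesis using True by (simp add: block_elem_def)
  next
    case False
    have "\<not> (\<tau> permutes X \<and> (inv \<tau> \<circ> \<sigma>) permutes S)" if "\<tau> \<in> sym_group n" for \<tau>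
    proof
      assume "\<tau> permutes X \<and> (inv \<tau> \<circ> \<sigma>) permutes S"
      then have "(\<lambda>(p, q). p \<circ> q) (\<tau>, inv \<tau> \<circ> \<sigma>) \<in> block_perms X S"
        by (intro bij_betwE[OF block_perms_bij[OF assms(3)], rule_format]) simp
      then have "\<tau> \<circ> (inv \<tau> \<circ> \<sigma>) \<in> block_perms X S" by simp
      then show False using False that by simp
    qed
    then show ?thesis using False by (auto simp: block_elem_def intro!: sum.neutral)
  qed
  finally show "gmult n (block_elem X {}) (block_elem {} S) \<sigma> = block_elem X S \<sigma>" .
qed

lemma block_elem_alt_expand:
  assumes "finite S"
  shows "block_elem {} S = (\<Sum>q | q permutes S. fscale (of_int (sign q)) (gelem q))"
proof -
  have "rsign S q = sign q" if "q permutes S" for q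
  proof -
    have "restr S q = q" using that by (auto simp: restr_def permutes_def)
    then show ?thesis by (simp add: rsign_def)
  qed
  then show ?thesis
    by (intro ext) (use finite_permutations[OF assms] in
      \<open>simp add: sum_fun_apply block_elem_alt gelem_def if_distrib[of "(*) _"] cong: if_cong\<close>)
qed

lemma gelem_block_elem_commute:
  assumes "\<tau> \<in> sym_group n" "X \<subseteq> {..<n}" "\<tau> ` X = X"
  shows "gmult n (gelem \<tau>) (block_elem X {}) = gmult n (block_elem X {}) (gelem \<tau>)"
proof -
  let ?e = "block_elem X {}"
  have "gmult n (gelem \<tau>) ?e \<in> group_algebra n"
    by (intro gmult_in_group_algebra block_elem_in_group_algebra assms) simp
  then have "gmult n (gelem \<tau>) ?e = gmult n (gmult n (gelem \<tau>) ?e) (gelem (inv \<tau> \<circ> \<tau>))"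
    using assms(1) by (simp add: gmult_gelem_id_right)
  also have "\<dots> = gmult n (gmult n (gmult n (gelem \<tau>) ?e) (gelem (inv \<tau>))) (gelem \<tau>)"
    unfolding gmult_gelem_gelem[OF sym_group_inv[OF assms(1)] assms(1), symmetric] by (simp only: gmult_assoc)
  finally show ?thesis using block_elem_conj[OF assms(1,2), of "{}"] by (simp add: assms(3))
qed

lemma block_elem_commute:
  assumes "X \<subseteq> {..<n}" "S \<subseteq> {..<n}" "X \<inter> S = {}"
  shows "gmult n (block_elem {} S) (block_elem X {}) = gmult n (block_elem X {}) (block_elem {} S)"
proof -
  have fS: "finite S" using assms(2) finite_subset by blast
  have "gmult n (gelem q) (block_elem X {}) = gmult n (block_elem X {}) (gelem q)" if q: "q permutes S" for q
  proof (rule gelem_block_elem_commute[OF _ assms(1)])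
    show "q \<in> sym_group n" using permutes_subset[OF q assms(2)] by (simp add: sym_group_def)
    have "q x = x" if "x \<in> X" for x by (rule permutes_not_in[OF q]) (use that assms(3) in blast)
    then show "q ` X = X" by simp
  qed
  then show ?thesis
    unfolding block_elem_alt_expand[OF fS] gmult_sum_left gmult_sum_right gmult_scale_left gmult_scale_right
    by (intro sum.cong) auto
qed

section \<open>Characters of hooks\<close>

context young_data begin

lemma a_expand: "a = (\<Sum>p\<in>P. gelem p)"
proof (rule ext)
  have "finite P" using finite_subset[of P G] P_G by auto
  then show "a \<sigma> = (\<Sum>p\<in>P. gelem p) \<sigma>" for \<sigma>
    by (simp add: sum_fun_apply a_def gelem_def)
qed

text \<open>Pigeonhole: for each row permutation \<open>p\<close> in the expansion of
  \<open>a\<close>, two points of \<open>X\<close> are brought into the same column, and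
  \<open>vanish\<close> applies.\<close>

lemma block_elem_cc_eq_0:
  assumes "X \<subseteq> {..<n}" "S \<subseteq> {..<n}" "X \<inter> S = {}" "card (c ` {..<n}) < card X"
  shows "block_elem X S \<star> cc = 0"
proof -
  have fX: "finite X" using assms(1) finite_subset by blast
  have "block_elem X S \<star> gelem p \<star> b = 0" if "p \<in> P" for p
  proof -
    have pG: "p \<in> G" using that P_G by blast
    have "\<not> inj_on (\<lambda>x. c (inv p x)) X"
    proof
      assume "inj_on (\<lambda>x. c (inv p x)) X"
      then have "card X = card ((\<lambda>x. c (inv p x)) ` X)" by (simp add: card_image)
      also have "\<dots> \<le> card (c ` {..<n})"
        by (rule card_mono) (use assms(1) G_less[OF sym_group_inv[OF pG]] in auto)
      finally show False using assms(4) by simp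
    qed
    then obtain x y where xy: "x \<in> X" "y \<in> X" "x \<noteq> y" "c (inv p x) = c (inv p y)"
      by (auto simp: inj_on_def)
    show ?thesis
      by (rule vanish[OF pG _ _ xy(3,4) block_elem_transpose[OF assms(1-3) xy(1-3)]]) (use xy assms(1) in auto)
  qed
  then show ?thesis
    unfolding cc_def gmult_assoc[symmetric] a_expand
    by (simp add: gmult_sum_left gmult_sum_right)
qed

lemma permutes_Q:
  assumes "q permutes S" "S \<subseteq> {..<n}" "\<And>x y. x \<in> S \<Longrightarrow> y \<in> S \<Longrightarrow> c x = c y"
  shows "q \<in> Q"
proof -
  have "c (q x) = c x" for x
    using assms(3)[of "q x" x] permutes_in_image[OF assms(1)] permutes_not_in[OF assms(1), of x] by (cases "x \<in> S") auto
  then show ?thesis using permutes_subset[OF assms(1,2)] by (simp add: Q_def sym_group_def)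
qed

lemma block_elem_alt_b:
  assumes "S \<subseteq> {..<n}" "\<And>x y. x \<in> S \<Longrightarrow> y \<in> S \<Longrightarrow> c x = c y"
  shows "block_elem {} S \<star> b = fscale (fact (card S)) b"
proof -
  have fS: "finite S" using assms(1) finite_subset by blast
  have "block_elem {} S \<star> b = (\<Sum>q | q permutes S. fscale (of_int (sign q)) (gelem q) \<star> b)"
    by (simp only: block_elem_alt_expand[OF fS] gmult_sum_left)
  also have "\<dots> = (\<Sum>q | q permutes S. b)"
  proof (rule sum.cong[OF refl])
    fix q assume "q \<in> {q. q permutes S}"
    then have "q \<in> Q" using permutes_Q[of q S] assms by blast
    then show "fscale (of_int (sign q)) (gelem q) \<star> b = b"
      by (simp add: gmult_scale_left gelem_Q_b fun_eq_iff sign_def)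
  qed
  also have "\<dots> = fscale (of_nat (card {q. q permutes S})) b"
    by (rule ext) (subst sum_fun_apply, simp)
  finally show ?thesis using fS by (simp add: card_permutations)
qed

end

text \<open>\<open>Phi\<close> is a weighted sum of \<open>block_elem\<close>s over all subsets: the
  stability condition is built in, because the element of S vanishes at permutations that move
  S.\<close>

lemma fixsets_sum_swap:
  fixes F :: "(nat \<Rightarrow> nat) \<Rightarrow> complex"
  shows "(\<Sum>\<sigma>\<in>sym_group n. of_int (Phi n w \<sigma>) * F \<sigma>)
    = (\<Sum>S | S \<subseteq> {..<n}. of_int (w (card S)) * (\<Sum>\<sigma>\<in>sym_group n. block_elem ({..<n} - S) S \<sigma> * F \<sigma>))"
proof -
  have "(\<Sum>\<sigma>\<in>sym_group n. of_int (Phi n w \<sigma>) * F \<sigma>)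
     = (\<Sum>\<sigma>\<in>sym_group n. \<Sum>S | S \<subseteq> {..<n}. of_int (w (card S)) * (block_elem ({..<n} - S) S \<sigma> * F \<sigma>))"
  proof (rule sum.cong[OF refl])
    fix \<sigma> assume \<sigma>: "\<sigma> \<in> sym_group n"
    have "of_int (Phi n w \<sigma>) = (\<Sum>S | S \<subseteq> {..<n}. of_int (w (card S)) * block_elem ({..<n} - S) S \<sigma>)"
      unfolding Phi_def of_int_sum
      by (rule sum.mono_neutral_cong_left)
        (use \<sigma> in \<open>auto simp: block_elem_def block_perms_def sym_group_def Un_absorb1 Un_absorb2\<close>)
    then show "of_int (Phi n w \<sigma>) * F \<sigma> = (\<Sum>S | S \<subseteq> {..<n}. of_int (w (card S)) * (block_elem ({..<n} - S) S \<sigma> * F \<sigma>))"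
      by (simp add: sum_distrib_right mult.assoc)
  qed
  also have "\<dots> = (\<Sum>S | S \<subseteq> {..<n}. \<Sum>\<sigma>\<in>sym_group n. of_int (w (card S)) * (block_elem ({..<n} - S) S \<sigma> * F \<sigma>))"
    by (rule sum.swap)
  finally show ?thesis by (simp only: sum_distrib_left)
qed

lemma orbit_subsets:
  assumes "S \<subseteq> {..<n}"
  shows "(\<lambda>\<tau>. \<tau> ` S) ` sym_group n = {T. T \<subseteq> {..<n} \<and> card T = card S}"
proof
  show "(\<lambda>\<tau>. \<tau> ` S) ` sym_group n \<subseteq> {T. T \<subseteq> {..<n} \<and> card T = card S}"
  proof clarify
    fix \<tau> assume \<tau>: "\<tau> \<in> sym_group n"
    then have "\<tau> permutes {..<n}" by (simp add: sym_group_def)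
    then have "\<tau> ` S \<subseteq> {..<n}" using permutes_image[of \<tau> "{..<n}"] assms by blast
    then show "\<tau> ` S \<subseteq> {..<n} \<and> card (\<tau> ` S) = card S" by (simp add: card_act3[OF \<tau>])
  qed
  show "{T. T \<subseteq> {..<n} \<and> card T = card S} \<subseteq> (\<lambda>\<tau>. \<tau> ` S) ` sym_group n"
  proof clarify
    fix T assume T: "T \<subseteq> {..<n}" "card T = card S"
    have c: "card {x \<in> {..<n}. (x \<in> U) = p} = (if p then card U else n - card U)" if "U \<subseteq> {..<n}" for U p
    proof -
      have "{x \<in> {..<n}. x \<in> U} = U" "{x \<in> {..<n}. x \<notin> U} = {..<n} - U" using that by auto
      then show ?thesis using that by (simp add: card_Diff_subset finite_subset)
    qed
    obtain \<sigma> where \<sigma>: "\<sigma> \<in> sym_group n" "\<And>x. x < n \<Longrightarrow> (x \<in> S) = (\<sigma> x \<in> T)"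
      by (rule colouring_orbit[of n "\<lambda>x. x \<in> S" "\<lambda>x. x \<in> T"]) (simp only: c[OF assms] c[OF T(1)] T(2), blast)
    have "\<sigma> ` S \<subseteq> T" using \<sigma>(2) assms by auto
    moreover have "card (\<sigma> ` S) = card T" using T card_act3(1)[OF \<sigma>(1)] by simp
    ultimately have "\<sigma> ` S = T" using T(1) finite_subset by (metis card_subset_eq finite_lessThan)
    then show "T \<in> (\<lambda>\<tau>. \<tau> ` S) ` sym_group n" using \<sigma>(1) by blast
  qed
qed

text \<open>\<open>R0\<close> is the first row of the hook and \<open>S0\<close> the first column without the corner.\<close>

locale hook_data = young_data +
  fixes S0 :: "nat set" and R0 :: "nat set"
  assumes S0: "S0 \<subseteq> {..<n}" and R0: "R0 = {..<n} - S0"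
    and S0_col: "\<And>x y. x \<in> S0 \<Longrightarrow> y \<in> S0 \<Longrightarrow> c x = c y"
    and P_eq: "P = {p. p permutes R0}"
    and cols: "card (c ` {..<n}) \<le> card R0"
begin

lemma a_block: "a = block_elem R0 {}"
  by (rule ext) (simp add: a_def block_elem_sym P_eq)

lemma card_R0: "card R0 = n - card S0"
  using S0 finite_subset[OF S0] by (simp add: R0 card_Diff_subset)

lemma card_S0_le: "card S0 \<le> n"
  using card_mono[OF _ S0] by simp

text \<open>\<open>?y\<close> commutes with \<open>a\<close>, the supports being disjoint, and is
  absorbed by \<open>b\<close>, so the scalar in \<open>sum_conj_cc\<close> is \<open>card P\<close>
  times (card S0)!. The stabilizer of \<open>S0\<close> has the same order, and the two cancel on
  passing from the group to the orbit of \<open>S0\<close>.\<close>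

lemma block_sum:
  "(\<Sum>T | T \<subseteq> {..<n} \<and> card T = card S0. (block_elem ({..<n} - T) T \<star> cc) id) = kappa"
proof -
  let ?y = "block_elem {} S0"
  have disj: "R0 \<inter> S0 = {}" "R0 \<subseteq> {..<n}" by (auto simp: R0)
  have yb: "?y \<star> b = fscale (fact (card S0)) b" by (rule block_elem_alt_b[OF S0]) (rule S0_col)
  have y: "a \<star> ?y \<star> a \<star> b = fscale (of_nat (card P) * fact (card S0)) (a \<star> b)"
  proof -
    have "a \<star> ?y \<star> a \<star> b = a \<star> (?y \<star> a) \<star> b" by (simp add: gmult_assoc)
    also have "?y \<star> a = a \<star> ?y" unfolding a_block by (rule block_elem_commute) (use disj S0 in auto)
    also have "a \<star> (a \<star> ?y) \<star> b = (a \<star> a) \<star> (?y \<star> b)" by (simp add: gmult_assoc)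
    also have "\<dots> = fscale (of_nat (card P) * fact (card S0)) (a \<star> b)"
      unfolding a_a yb
      by (simp add: gmult_scale_left gmult_scale_right fun_eq_iff)
    finally show ?thesis .
  qed
  have ay: "a \<star> ?y = block_elem R0 S0" unfolding a_block by (rule block_elem_split) (use disj S0 in auto)
  have cP: "card P = fact (card R0)" unfolding P_eq by (rule card_permutations) (simp_all add: R0)
  have stab: "{\<sigma> \<in> G. \<sigma> ` S0 = S0} = block_perms R0 S0"
    using S0 by (auto simp: block_perms_def sym_group_def R0 Un_absorb1 Un_absorb2)
  have card_stab: "card (block_perms R0 S0) = card P * fact (card S0)"
    unfolding cP by (rule card_block_perms) (use disj S0 finite_subset in \<open>auto simp: R0\<close>)
  have "kappa * (of_nat (card P) * fact (card S0)) = (\<Sum>\<tau>\<in>G. (gelem \<tau> \<star> (a \<star> ?y) \<star> gelem (inv \<tau>) \<star> cc) id)"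
    by (rule sum_conj_cc[OF _ y, symmetric]) (simp add: block_elem_in_group_algebra S0)
  also have "\<dots> = (\<Sum>\<tau>\<in>G. (block_elem ({..<n} - \<tau> ` S0) (\<tau> ` S0) \<star> cc) id)"
  proof (rule sum.cong[OF refl])
    fix \<tau> assume \<tau>: "\<tau> \<in> G"
    then have "\<tau> ` {..<n} = {..<n}" using permutes_image by (auto simp: sym_group_def)
    then have "\<tau> ` R0 = {..<n} - \<tau> ` S0" unfolding R0 image_set_diff[OF sym_group_inj[OF \<tau>]] by simp
    then show "(gelem \<tau> \<star> (a \<star> ?y) \<star> gelem (inv \<tau>) \<star> cc) id = (block_elem ({..<n} - \<tau> ` S0) (\<tau> ` S0) \<star> cc) id"
      unfolding ay block_elem_conj[OF \<tau> disj(2) S0] by simp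
  qed
  also have "\<dots> = of_nat (card {\<sigma> \<in> G. \<sigma> ` S0 = S0}) *
      (\<Sum>T | T \<subseteq> {..<n} \<and> card T = card S0. (block_elem ({..<n} - T) T \<star> cc) id)"
    by (rule orbit_sum[where act = "\<lambda>\<tau> S. \<tau> ` S" and F = "\<lambda>T. (block_elem ({..<n} - T) T \<star> cc) id"])
      (auto simp: image_comp orbit_subsets[OF S0])
  finally show ?thesis using card_P_pos by (simp add: stab card_stab)
qed

text \<open>For S smaller than \<open>S0\<close> the complement exceeds the number of columns, by
  \<open>cols\<close>; for larger S the weight is 0. Only the size of \<open>S0\<close> survives,
  with weight 1.\<close>

lemma hook_fun_cc: "((\<lambda>\<sigma>. of_int (hook_fun n (int (card S0)) \<sigma>)) \<star> cc) id = kappa"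
proof -
  let ?b = "int (card S0)"
  have "((\<lambda>\<sigma>. of_int (hook_fun n ?b \<sigma>)) \<star> cc) id
     = (\<Sum>S | S \<subseteq> {..<n}. of_int (alt_wt ?b (card S)) * (block_elem ({..<n} - S) S \<star> cc) id)"
    unfolding gmult_id_apply by (rule fixsets_sum_swap)
  also have "\<dots> = (\<Sum>S | S \<subseteq> {..<n} \<and> card S = card S0. (block_elem ({..<n} - S) S \<star> cc) id)"
  proof (rule sum.mono_neutral_cong_right)
    show "\<forall>S\<in>{S. S \<subseteq> {..<n}} - {S. S \<subseteq> {..<n} \<and> card S = card S0}.
        of_int (alt_wt ?b (card S)) * (block_elem ({..<n} - S) S \<star> cc) id = 0"
    proof
      fix S assume S: "S \<in> {S. S \<subseteq> {..<n}} - {S. S \<subseteq> {..<n} \<and> card S = card S0}"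
      show "of_int (alt_wt ?b (card S)) * (block_elem ({..<n} - S) S \<star> cc) id = 0"
      proof (cases "card S < card S0")
        case True
        have "card ({..<n} - S) = n - card S" using S finite_subset[of S "{..<n}"] by (auto simp: card_Diff_subset)
        then have "block_elem ({..<n} - S) S \<star> cc = 0"
          using True cols card_R0 card_S0_le S by (intro block_elem_cc_eq_0) auto
        then show ?thesis by simp
      next
        case False
        then show ?thesis using S by (auto simp: alt_wt_def)
      qed
    qed
  qed (auto simp: alt_wt_def)
  finally show ?thesis by (simp only: block_sum)
qed

end

section \<open>Characters of near hooks\<close>

lemma block_perms_fix:
  assumes "\<sigma> \<in> block_perms Y W" "i \<in> W" "i \<notin> Y" "\<sigma> i = i"
  shows "\<sigma> \<in> block_perms Y (W - {i})" "rsign (W - {i}) \<sigma> = rsign W \<sigma>"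
proof -
  have p: "\<sigma> permutes (Y \<union> W)" "\<sigma> ` W = W" using assms(1) by (auto simp: block_perms_def)
  have "\<sigma> ` (W - {i}) = W - {i}" using image_set_diff[OF permutes_inj[OF p(1)], of W "{i}"] p(2) assms(4) by simp
  moreover have "\<sigma> permutes (Y \<union> (W - {i}))"
    by (rule permutes_superset[OF p(1)]) (use assms in auto)
  ultimately show "\<sigma> \<in> block_perms Y (W - {i})" by (simp add: block_perms_def)
  have "restr (W - {i}) \<sigma> = restr W \<sigma>" using assms(4) by (auto simp: restr_def fun_eq_iff)
  then show "rsign (W - {i}) \<sigma> = rsign W \<sigma>" by (simp add: rsign_def)
qed

lemma block_perms_insert:
  assumes "\<sigma> \<in> block_perms Y (W - {i})" "i \<in> W" "i \<notin> Y"
  shows "\<sigma> i = i" "\<sigma> \<in> block_perms Y W"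
proof -
  have p: "\<sigma> permutes (Y \<union> (W - {i}))" "\<sigma> ` (W - {i}) = W - {i}" using assms(1) by (auto simp: block_perms_def)
  show i: "\<sigma> i = i" by (rule permutes_not_in[OF p(1)]) (use assms(3) in auto)
  have "\<sigma> permutes (Y \<union> W)" by (rule permutes_subset[OF p(1)]) auto
  moreover have "\<sigma> ` W = W"
  proof -
    have "W = insert i (W - {i})" using assms(2) by auto
    then show ?thesis using i p(2) by (metis image_insert)
  qed
  ultimately show "\<sigma> \<in> block_perms Y W" by (simp add: block_perms_def)
qed

text \<open>The group on \<open>W\<close> is a union of cosets of the stabilizer of
  \<open>i\<close>, represented by the identity and the transpositions of \<open>i\<close> with the
  other points; the latter carry the sign -1.\<close>

lemma block_elem_coset_split:
  assumes "Y \<subseteq> {..<n}" "W \<subseteq> {..<n}" "Y \<inter> W = {}" "i \<in> W"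
  shows "block_elem Y W = block_elem Y (W - {i})
    - (\<Sum>w\<in>W - {i}. gmult n (gelem (transpose w i)) (block_elem Y (W - {i})))"
proof
  fix \<sigma>
  let ?e = "block_elem Y (W - {i})"
  have iY: "i \<notin> Y" using assms by auto
  have fW: "finite W" using assms(2) finite_subset by blast
  have t: "transpose w i \<in> sym_group n" "inv (transpose w i) = transpose w i" if "w \<in> W" for w
    using that assms(2,4) by (auto intro: sym_group_transpose simp: inv_swap_id)
  have tb: "transpose w i \<in> block_perms Y W" if "w \<in> W" for w
    using that assms(4) by (auto simp: block_perms_def intro!: permutes_swap_id transpose_image_same)
  have e: "(\<Sum>w\<in>W - {i}. gmult n (gelem (transpose w i)) ?e) \<sigma> = (\<Sum>w\<in>W - {i}. ?e (transpose w i \<circ> \<sigma>))"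
    unfolding sum_fun_apply by (rule sum.cong[OF refl]) (simp add: gmult_gelem_left t)
  show "block_elem Y W \<sigma> = (?e - (\<Sum>w\<in>W - {i}. gmult n (gelem (transpose w i)) ?e)) \<sigma>"
  proof (cases "\<sigma> \<in> block_perms Y W")
    case False
    have "?e \<sigma> = 0" using block_perms_insert(2)[OF _ assms(4) iY] False by (auto simp: block_elem_def)
    moreover have "?e (transpose w i \<circ> \<sigma>) = 0" if "w \<in> W - {i}" for w
    proof -
      have "transpose w i \<circ> \<sigma> \<notin> block_perms Y (W - {i})"
      proof
        assume "transpose w i \<circ> \<sigma> \<in> block_perms Y (W - {i})"
        then have "transpose w i \<circ> \<sigma> \<in> block_perms Y W" by (rule block_perms_insert(2)[OF _ assms(4) iY])
        moreover have "transpose w i \<in> block_perms Y W" using tb that by blast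
        ultimately have "transpose w i \<circ> (transpose w i \<circ> \<sigma>) \<in> block_perms Y W"
          by (rule block_perms_comp[rotated])
        then show False using False by (simp add: comp_assoc[symmetric])
      qed
      then show ?thesis by (simp add: block_elem_def)
    qed
    moreover have "block_elem Y W \<sigma> = 0" using False by (simp add: block_elem_def)
    ultimately show ?thesis by (simp add: e)
  next
    case True
    have inj: "inj \<sigma>" "\<sigma> ` W = W" using True permutes_inj by (auto simp: block_perms_def)
    have other: "?e (transpose w i \<circ> \<sigma>) = 0" if "w \<in> W - {i}" "w \<noteq> \<sigma> i" for w
    proof -
      have "(transpose w i \<circ> \<sigma>) i \<noteq> i" using that by (auto simp: transpose_def)
      then have "transpose w i \<circ> \<sigma> \<notin> block_perms Y (W - {i})"
        using block_perms_insert(1)[OF _ assms(4) iY] by blast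
      then show ?thesis by (simp add: block_elem_def)
    qed
    show ?thesis
    proof (cases "\<sigma> i = i")
      case fixed: True
      have "?e (transpose w i \<circ> \<sigma>) = 0" if "w \<in> W - {i}" for w
        using other[OF that] that fixed by auto
      moreover have "?e \<sigma> = block_elem Y W \<sigma>"
        using block_perms_fix[OF True assms(4) iY fixed] True by (simp add: block_elem_def)
      ultimately show ?thesis by (simp add: e)
    next
      case moved: False
      \<comment> \<open>The transposition of \<open>i\<close> with its image is the only
        representative whose coset contains \<sigma>.\<close>
      define v where "v = \<sigma> i"
      have v: "v \<in> W - {i}" using inj(2) assms(4) moved by (auto simp: v_def)
      have "?e \<sigma> = 0" using block_perms_insert(1)[OF _ assms(4) iY] moved by (auto simp: block_elem_def)
      moreover have "(\<Sum>w\<in>W - {i}. ?e (transpose w i \<circ> \<sigma>)) = ?e (transpose v i \<circ> \<sigma>)"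
        using other v fW by (subst sum.remove[of _ v]) (auto simp: v_def intro!: sum.neutral)
      moreover have "?e (transpose v i \<circ> \<sigma>) = - block_elem Y W \<sigma>"
      proof -
        have vW: "v \<in> W" "v \<noteq> i" using v by auto
        have b: "transpose v i \<circ> \<sigma> \<in> block_perms Y W" using block_perms_comp[OF tb[OF vW(1)] True] .
        have f: "(transpose v i \<circ> \<sigma>) i = i" by (simp add: v_def)
        have "rsign W (transpose v i \<circ> \<sigma>) = rsign W (transpose v i) * rsign W \<sigma>"
          using tb[OF vW(1)] inj fW by (intro rsign_comp) (auto simp: block_perms_def)
        also have "rsign W (transpose v i) = - 1" using vW assms(4) by (subst rsign_transpose) auto
        finally have r: "rsign W (transpose v i \<circ> \<sigma>) = - rsign W \<sigma>" by (simp only: mult_minus1)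
        note bf = block_perms_fix[OF b assms(4) iY f]
        show ?thesis unfolding block_elem_def bf(2) r using bf(1) True by (simp del: comp_apply)
      qed
      ultimately show ?thesis by (simp add: e)
    qed
  qed
qed

lemma orbit_triples:
  assumes "S \<subseteq> {..<n}" "i < n" "i \<notin> S" "w \<in> S"
  shows "(\<lambda>\<tau>. (\<tau> ` S, \<tau> i, \<tau> w)) ` sym_group n
    = {(T, j, v). T \<subseteq> {..<n} \<and> card T = card S \<and> j < n \<and> j \<notin> T \<and> v \<in> T}"
proof
  show "(\<lambda>\<tau>. (\<tau> ` S, \<tau> i, \<tau> w)) ` sym_group n
    \<subseteq> {(T, j, v). T \<subseteq> {..<n} \<and> card T = card S \<and> j < n \<and> j \<notin> T \<and> v \<in> T}"
  proof clarify
    fix \<tau> assume \<tau>: "\<tau> \<in> sym_group n"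
    then have p: "\<tau> permutes {..<n}" by (simp add: sym_group_def)
    have "\<tau> ` S \<subseteq> {..<n}" using permutes_image[OF p] assms by blast
    moreover have "\<tau> i < n" using permutes_in_image[OF p, of i] assms(2) by simp
    moreover have "\<tau> i \<notin> \<tau> ` S" using sym_group_inj[OF \<tau>] assms(3) by (simp add: inj_image_mem_iff)
    ultimately show "\<tau> ` S \<subseteq> {..<n} \<and> card (\<tau> ` S) = card S \<and> \<tau> i < n \<and> \<tau> i \<notin> \<tau> ` S \<and> \<tau> w \<in> \<tau> ` S"
      using assms(4) by (simp add: card_act3[OF \<tau>])
  qed
  show "{(T, j, v). T \<subseteq> {..<n} \<and> card T = card S \<and> j < n \<and> j \<notin> T \<and> v \<in> T}
    \<subseteq> (\<lambda>\<tau>. (\<tau> ` S, \<tau> i, \<tau> w)) ` sym_group n"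
  proof clarify
    fix T j v assume T: "T \<subseteq> {..<n}" "card T = card S" "j < n" "j \<notin> T" "v \<in> T"
    \<comment> \<open>Four colours: the distinguished outer point, the distinguished inner point,
      the rest of \<open>U\<close>, and the rest of the complement.\<close>
    define col where "col U a b x = (if x = a then 0 else if x = b then 1 else if x \<in> U then 2 else (3::nat))"
      for U and a b x :: nat
    have c: "card {x \<in> {..<n}. col U a b x = p} = (if p = 0 \<or> p = 1 then 1 else if p = 2 then card U - 1 else if p = 3 then n - card U - 1 else 0)"
      if U: "U \<subseteq> {..<n}" "a < n" "a \<notin> U" "b \<in> U" for U a b p
    proof -
      have fU: "finite U" using U(1) finite_subset by blast
      consider "p = 0" | "p = 1" | "p = 2" | "p = 3" | "p > 3" by linarith
      then show ?thesis
      proof cases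
        case 1
        then have "{x \<in> {..<n}. col U a b x = p} = {a}" using U by (auto simp: col_def)
        then show ?thesis using 1 by simp
      next
        case 2
        then have "{x \<in> {..<n}. col U a b x = p} = {b}" using U by (auto simp: col_def)
        then show ?thesis using 2 by simp
      next
        case 3
        then have "{x \<in> {..<n}. col U a b x = p} = U - {b}" using U by (auto simp: col_def)
        then show ?thesis using 3 U fU by simp
      next
        case 4
        then have "{x \<in> {..<n}. col U a b x = p} = {..<n} - U - {a}" using U by (auto simp: col_def)
        then show ?thesis using 4 U fU by (simp add: card_Diff_subset)
      next
        case 5
        then have "{x \<in> {..<n}. col U a b x = p} = {}" by (auto simp: col_def)
        then have "card {x \<in> {..<n}. col U a b x = p} = 0" by (simp only: card.empty)
        then show ?thesis using 5 by simp
      qed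
    qed
    obtain \<sigma> where \<sigma>: "\<sigma> \<in> sym_group n" "\<And>x. x < n \<Longrightarrow> col S i w x = col T j v (\<sigma> x)"
      by (rule colouring_orbit[of n "col S i w" "col T j v"]) (simp only: c[OF assms] c[OF T(1,3-5)] T(2), blast)
    have "\<sigma> i = j" using \<sigma>(2)[OF assms(2)] by (auto simp: col_def split: if_splits)
    moreover have "\<sigma> w = v" using \<sigma>(2)[of w] assms by (auto simp: col_def split: if_splits)
    moreover have "\<sigma> ` S = T"
    proof -
      have "\<sigma> x \<in> T" if "x \<in> S" for x
        using \<sigma>(2)[of x] that assms T by (auto simp: col_def split: if_splits)
      then have "\<sigma> ` S \<subseteq> T" by auto
      moreover have "card (\<sigma> ` S) = card T" using T card_act3(1)[OF \<sigma>(1)] by simp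
      ultimately show ?thesis using T(1) finite_subset by (metis card_subset_eq finite_lessThan)
    qed
    ultimately show "(T, j, v) \<in> (\<lambda>\<tau>. (\<tau> ` S, \<tau> i, \<tau> w)) ` sym_group n" using \<sigma>(1) by (intro image_eqI[of _ _ \<sigma>]) auto
  qed
qed

text \<open>A term for each fixed point \<open>i\<close>: the subsets S and S with \<open>i\<close>
  added are merged as in \<open>Phi_fixed_point\<close>, and the corresponding element leaves
  \<open>i\<close> out of both blocks.\<close>

lemma fixpts_Phi_sum:
  fixes F :: "(nat \<Rightarrow> nat) \<Rightarrow> complex"
  shows "(\<Sum>\<sigma>\<in>sym_group n. of_int (fixpts n \<sigma> * Phi n w \<sigma>) * F \<sigma>)
    = (\<Sum>i<n. \<Sum>S | S \<subseteq> {..<n} - {i}. of_int (w (card S) + w (Suc (card S))) *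
        (\<Sum>\<sigma>\<in>sym_group n. block_elem ({..<n} - S - {i}) S \<sigma> * F \<sigma>))"
proof -
  let ?u = "\<lambda>S. w (card S) + w (Suc (card S))"
  have fin: "finite {S. S \<subseteq> {..<n} - {i}}" for i by simp
  have "(\<Sum>\<sigma>\<in>sym_group n. of_int (fixpts n \<sigma> * Phi n w \<sigma>) * F \<sigma>)
     = (\<Sum>\<sigma>\<in>sym_group n. \<Sum>i<n. \<Sum>S | S \<subseteq> {..<n} - {i}. of_int (?u S) * (block_elem ({..<n} - S - {i}) S \<sigma> * F \<sigma>))"
  proof (rule sum.cong[OF refl])
    fix \<sigma> assume \<sigma>: "\<sigma> \<in> sym_group n"
    have "of_int (of_bool (\<sigma> i = i) * Phi n w \<sigma>)
       = (\<Sum>S | S \<subseteq> {..<n} - {i}. of_int (?u S) * block_elem ({..<n} - S - {i}) S \<sigma>)" if i: "i < n" for i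
    proof (cases "\<sigma> i = i")
      case True
      have perm: "\<sigma> permutes ({..<n} - {i})"
        by (rule permutes_superset[of _ "{..<n}"]) (use \<sigma> True in \<open>auto simp: sym_group_def\<close>)
      have "of_int (Phi n w \<sigma>) = (\<Sum>S | S \<subseteq> {..<n} - {i} \<and> \<sigma> ` S = S. of_int (?u S * rsign S \<sigma>))"
        unfolding Phi_fixed_point[OF \<sigma> True i] by simp
      also have "\<dots> = (\<Sum>S | S \<subseteq> {..<n} - {i}. of_int (?u S) * block_elem ({..<n} - S - {i}) S \<sigma>)"
      proof (rule sum.mono_neutral_cong_left[OF fin])
        show "\<forall>S\<in>{S. S \<subseteq> {..<n} - {i}} - {S. S \<subseteq> {..<n} - {i} \<and> \<sigma> ` S = S}.
            of_int (?u S) * block_elem ({..<n} - S - {i}) S \<sigma> = 0"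
          by (auto simp: block_elem_def block_perms_def)
        fix S assume S: "S \<in> {S. S \<subseteq> {..<n} - {i} \<and> \<sigma> ` S = S}"
        then have "({..<n} - S - {i}) \<union> S = {..<n} - {i}" by auto
        then show "of_int (?u S * rsign S \<sigma>) = of_int (?u S) * block_elem ({..<n} - S - {i}) S \<sigma>"
          using S perm by (simp add: block_elem_def block_perms_def)
      qed auto
      finally show ?thesis using True by simp
    next
      case False
      have "\<sigma> \<notin> block_perms ({..<n} - S - {i}) S" if "S \<subseteq> {..<n} - {i}" for S
      proof
        assume "\<sigma> \<in> block_perms ({..<n} - S - {i}) S"
        then have "\<sigma> i = i" using that by (intro permutes_not_in) (auto simp: block_perms_def)
        then show False using False by simp
      qed
      then show ?thesis using False by (auto simp: block_elem_def intro!: sum.neutral)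
    qed
    then have "of_int (fixpts n \<sigma> * Phi n w \<sigma>) = (\<Sum>i<n. \<Sum>S | S \<subseteq> {..<n} - {i}. of_int (?u S) * block_elem ({..<n} - S - {i}) S \<sigma>)"
      unfolding fixpts_sum sum_distrib_right of_int_sum by (intro sum.cong) auto
    then show "of_int (fixpts n \<sigma> * Phi n w \<sigma>) * F \<sigma>
       = (\<Sum>i<n. \<Sum>S | S \<subseteq> {..<n} - {i}. of_int (?u S) * (block_elem ({..<n} - S - {i}) S \<sigma> * F \<sigma>))"
      by (simp add: sum_distrib_right mult.assoc)
  qed
  also have "\<dots> = (\<Sum>i<n. \<Sum>S | S \<subseteq> {..<n} - {i}. \<Sum>\<sigma>\<in>sym_group n. of_int (?u S) * (block_elem ({..<n} - S - {i}) S \<sigma> * F \<sigma>))"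
    by (subst sum.swap, rule sum.cong[OF refl], rule sum.swap)
  finally show ?thesis by (simp only: sum_distrib_left)
qed

text \<open>\<open>R0\<close> is the first row of the near hook, \<open>S0\<close> the first column without the corner, and \<open>w0\<close> and \<open>i0\<close> are
  the two cells of the second row.\<close>

locale near_hook_data = young_data +
  fixes S0 R0 :: "nat set" and i0 w0 k :: nat
  assumes S0: "S0 \<subseteq> {..<n}" and i0: "i0 < n" "i0 \<notin> S0" and w0: "w0 \<in> S0"
    and R0: "R0 = {..<n} - S0 - {i0}" and card_S0: "card S0 = k"
    and S0_col: "\<And>x y. x \<in> S0 \<Longrightarrow> y \<in> S0 \<Longrightarrow> c x = c y"
    and row1: "r w0 = r i0"
    and P_eq: "P = {p. p permutes R0} \<union> (\<lambda>p. transpose w0 i0 \<circ> p) ` {p. p permutes R0}"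
    and cols: "card (c ` {..<n}) \<le> card R0"
begin

abbreviation "p0 \<equiv> block_elem R0 {}"
abbreviation "y0 \<equiv> block_elem {} S0"
abbreviation "t0 \<equiv> gelem (transpose w0 i0)"

lemma w0_n: "w0 < n" and w0_i0: "w0 \<noteq> i0"
  using S0 w0 i0 by auto

lemma R0_sub: "R0 \<subseteq> {..<n}" and disj: "R0 \<inter> S0 = {}" and w0_R0: "w0 \<notin> R0" and i0_R0: "i0 \<notin> R0"
  using w0 by (auto simp: R0)

lemma finite_S0: "finite S0" and finite_R0: "finite R0"
  using S0 R0_sub finite_subset by blast+

lemma card_R0: "card R0 = n - k - 1"
  using i0 finite_S0 S0 by (simp add: R0 card_Diff_subset card_S0)

lemma k_pos: "k > 0" using card_S0 w0 finite_S0 card_gt_0_iff by blast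

lemma t0_G: "transpose w0 i0 \<in> G" using w0_n i0 by simp

lemma t0_P: "transpose w0 i0 \<in> P" using transpose_P[OF w0_n i0(1) row1] .

lemma perm_R0_P: "p permutes R0 \<Longrightarrow> p \<in> P" using P_eq by blast

lemma t0_perm_R0: "p permutes R0 \<Longrightarrow> \<not> (transpose w0 i0 \<circ> p) permutes R0"
proof
  assume p: "p permutes R0" "(transpose w0 i0 \<circ> p) permutes R0"
  have "(transpose w0 i0 \<circ> p) w0 = i0" using permutes_not_in[OF p(1) w0_R0] by simp
  then show False using permutes_not_in[OF p(2) w0_R0] w0_i0 by simp
qed

lemma a_split: "a = p0 + t0 \<star> p0"
proof
  fix \<sigma>
  have tt: "transpose w0 i0 \<circ> (transpose w0 i0 \<circ> \<rho>) = \<rho>" for \<rho> by (simp add: fun_eq_iff)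
  have "\<sigma> \<in> (\<lambda>p. transpose w0 i0 \<circ> p) ` {p. p permutes R0} \<longleftrightarrow> (transpose w0 i0 \<circ> \<sigma>) permutes R0"
    using tt by (metis (no_types, lifting) image_iff mem_Collect_eq)
  then have "\<sigma> \<in> P \<longleftrightarrow> \<sigma> permutes R0 \<or> (transpose w0 i0 \<circ> \<sigma>) permutes R0" unfolding P_eq by blast
  moreover have "\<not> (\<sigma> permutes R0 \<and> (transpose w0 i0 \<circ> \<sigma>) permutes R0)" using t0_perm_R0 by blast
  ultimately show "a \<sigma> = (p0 + t0 \<star> p0) \<sigma>"
    by (auto simp: a_def block_elem_sym gmult_gelem_left[OF t0_G] inv_swap_id)
qed

lemma t0_p0: "t0 \<star> p0 = p0 \<star> t0"
  by (rule gelem_block_elem_commute[OF t0_G R0_sub]) (use w0_R0 i0_R0 in \<open>intro transpose_image_same, simp\<close>)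

lemma a_p0: "a \<star> p0 = fscale (fact (card R0)) a"
proof -
  have fin: "finite {p. p permutes R0}" by (rule finite_permutations[OF finite_R0])
  have "p0 = (\<Sum>p\<in>{p. p permutes R0}. gelem p)"
    by (rule ext) (use fin in \<open>simp add: sum_fun_apply block_elem_sym gelem_def\<close>)
  then have "a \<star> p0 = (\<Sum>p\<in>{p. p permutes R0}. a \<star> gelem p)" by (simp only: gmult_sum_right)
  also have "\<dots> = (\<Sum>p\<in>{p. p permutes R0}. a)"
    by (rule sum.cong) (auto simp: gelem_P_a perm_R0_P)
  also have "\<dots> = fscale (of_nat (card {p. p permutes R0})) a"
    by (rule ext) (subst sum_fun_apply, simp)
  finally show ?thesis using finite_R0 by (simp add: card_permutations)
qed

lemma y0_b: "y0 \<star> b = fscale (fact k) b"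
  unfolding card_S0[symmetric] by (rule block_elem_alt_b[OF S0]) (rule S0_col)

text \<open>For \<open>v = w0\<close> the transposition lies in the row group. For any other
  \<open>v\<close> it brings the second row, \<open>w0\<close> and \<open>i0\<close>, into the
  column of \<open>S0\<close>, so the product vanishes.\<close>

lemma a_transpose_b:
  assumes "v \<in> S0"
  shows "a \<star> gelem (transpose v i0) \<star> b = (if v = w0 then a \<star> b else 0)"
proof (cases "v = w0")
  case True
  then show ?thesis using gelem_P_a(2)[OF t0_P] by simp
next
  case False
  have v: "v < n" "v \<noteq> i0" using assms S0 i0 by auto
  have "inv (transpose v i0) w0 = w0" "inv (transpose v i0) i0 = v"
    using False w0_i0 by (simp_all add: inv_swap_id transpose_def)
  then have "c (inv (transpose v i0) w0) = c (inv (transpose v i0) i0)"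
    using S0_col[OF w0 assms] by simp
  then have "a \<star> gelem (transpose v i0) \<star> b = 0"
    by (intro vanish[OF _ w0_n i0(1) w0_i0]) (use v i0 gelem_P_a(2)[OF t0_P] in auto)
  then show ?thesis using False by simp
qed

text \<open>Moving \<open>t0\<close> to the left past a permutation \<open>q\<close> of
  \<open>S0\<close> turns it into the transposition of \<open>q w0\<close> and \<open>i0\<close>. By
  \<open>a_transpose_b\<close> only the (k - 1)! permutations fixing \<open>w0\<close> survive, and
  \<open>b\<close> cancels their signs.\<close>

lemma a_y0_t0_b: "a \<star> y0 \<star> t0 \<star> b = fscale (fact (k - 1)) (a \<star> b)"
proof -
  let ?S = "{q. q permutes S0}"
  have fin: "finite ?S" by (rule finite_permutations[OF finite_S0])
  have Q: "q \<in> Q" if "q permutes S0" for q by (rule permutes_Q[OF that S0]) (rule S0_col)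
  have "a \<star> y0 \<star> t0 \<star> b = (\<Sum>q\<in>?S. fscale (of_int (sign q)) (a \<star> gelem q \<star> t0 \<star> b))"
    unfolding block_elem_alt_expand[OF finite_S0] by (simp only: gmult_sum_left gmult_sum_right gmult_scale_left gmult_scale_right)
  also have "\<dots> = (\<Sum>q\<in>?S. if q w0 = w0 then a \<star> b else 0)"
  proof (rule sum.cong[OF refl])
    fix q assume "q \<in> ?S"
    then have q: "q permutes S0" by simp
    have qG: "q \<in> G" using Q[OF q] Q_G by blast
    have qi: "q i0 = i0" using permutes_not_in[OF q i0(2)] .
    have qw: "q w0 \<in> S0" using permutes_in_image[OF q] w0 by blast
    have "inv q i0 = i0" using sym_group_inv_comp(4)[OF qG, of i0] qi by simp
    then have "q \<circ> transpose w0 i0 = transpose (q w0) i0 \<circ> q"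
      using conj_transpose[OF qG, of "q w0" i0] sym_group_inv_comp(4)[OF qG, of w0] by simp
    then have "gelem q \<star> t0 = gelem (transpose (q w0) i0) \<star> gelem q"
      using qG t0_G qw S0 i0 by (simp add: gmult_gelem_gelem subset_eq)
    then have "a \<star> gelem q \<star> t0 \<star> b = a \<star> gelem (transpose (q w0) i0) \<star> (gelem q \<star> b)"
      by (metis gmult_assoc)
    also have "\<dots> = fscale (of_int (sign q)) (a \<star> gelem (transpose (q w0) i0) \<star> b)"
      by (simp only: gelem_Q_b(1)[OF Q[OF q]] gmult_scale_right)
    finally show "fscale (of_int (sign q)) (a \<star> gelem q \<star> t0 \<star> b) = (if q w0 = w0 then a \<star> b else 0)"
      unfolding a_transpose_b[OF qw] by (auto simp: fun_eq_iff sign_def)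
  qed
  also have "\<dots> = (\<Sum>q\<in>{q \<in> ?S. q w0 = w0}. a \<star> b)"
    by (rule sum.mono_neutral_cong_right) (use fin in auto)
  also have "\<dots> = fscale (of_nat (card {q \<in> ?S. q w0 = w0})) (a \<star> b)"
    by (rule ext) (subst sum_fun_apply, simp)
  also have "{q \<in> ?S. q w0 = w0} = {q. q permutes (S0 - {w0})}"
    by (auto intro: permutes_superset permutes_subset dest: permutes_not_in)
  also have "card {q. q permutes (S0 - {w0})} = fact (k - 1)"
    by (rule card_permutations) (use finite_S0 w0 card_S0 in auto)
  finally show ?thesis by (simp only: of_nat_fact)
qed

text \<open>Of the two parts of \<open>a\<close>, the one without \<open>t0\<close> contributes k!
  and the one with \<open>t0\<close> contributes (k - 1)!. Their sum (k - 1)! (k + 1) is the source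
  of the factor k + 1 below.\<close>

lemma a_y0_a_b: "a \<star> y0 \<star> a \<star> b = fscale (fact (card R0) * (fact k + fact (k - 1))) (a \<star> b)"
proof -
  have "a \<star> y0 \<star> a \<star> b = a \<star> y0 \<star> (p0 + p0 \<star> t0) \<star> b" using a_split t0_p0 by simp
  also have "\<dots> = a \<star> (y0 \<star> p0) \<star> b + a \<star> (y0 \<star> p0) \<star> t0 \<star> b"
    by (simp only: gmult_add_left gmult_add_right gmult_assoc)
  also have "y0 \<star> p0 = p0 \<star> y0" by (rule block_elem_commute[OF R0_sub S0 disj])
  also have "a \<star> (p0 \<star> y0) \<star> b + a \<star> (p0 \<star> y0) \<star> t0 \<star> b
     = (a \<star> p0) \<star> (y0 \<star> b) + (a \<star> p0) \<star> y0 \<star> t0 \<star> b"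
    by (simp only: gmult_assoc)
  also have "\<dots> = fscale (fact (card R0)) (a \<star> (y0 \<star> b)) + fscale (fact (card R0)) (a \<star> y0 \<star> t0 \<star> b)"
    by (simp only: a_p0 gmult_scale_left)
  also have "\<dots> = fscale (fact (card R0) * (fact k + fact (k - 1))) (a \<star> b)"
    unfolding a_y0_t0_b y0_b gmult_scale_right by (simp add: fun_eq_iff algebra_simps)
  finally show ?thesis .
qed

text \<open>The pairings with \<open>cc\<close> of the terms in the two parts of
  \<open>near_hook_fun\<close>: \<open>E\<close> comes from the part with fixed points,
  \<open>EW\<close> from the subtracted part. \<open>E'\<close> is the coset term linking them in
  \<open>EW_insert\<close>.\<close>

definition E :: "nat set \<Rightarrow> nat \<Rightarrow> complex" where
  "E S i = (block_elem ({..<n} - S - {i}) S \<star> cc) id"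

definition E' :: "nat set \<Rightarrow> nat \<Rightarrow> nat \<Rightarrow> complex" where
  "E' S i w = (gelem (transpose w i) \<star> block_elem ({..<n} - S - {i}) S \<star> cc) id"

definition EW :: "nat set \<Rightarrow> complex" where
  "EW W = (block_elem ({..<n} - W) W \<star> cc) id"

lemma EW_insert:
  assumes "S \<subseteq> {..<n}" "i < n" "i \<notin> S"
  shows "EW (insert i S) = E S i - (\<Sum>w\<in>S. E' S i w)"
proof -
  have s: "insert i S - {i} = S" "{..<n} - insert i S = {..<n} - S - {i}" using assms(3) by auto
  have "block_elem ({..<n} - insert i S) (insert i S) = block_elem ({..<n} - insert i S) (insert i S - {i})
    - (\<Sum>w\<in>insert i S - {i}. gelem (transpose w i) \<star> block_elem ({..<n} - insert i S) (insert i S - {i}))"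
    by (rule block_elem_coset_split) (use assms in auto)
  then show ?thesis unfolding s EW_def E_def E'_def
    by (simp add: gmult_diff_left gmult_sum_left sum_fun_apply)
qed

text \<open>The conjugates of \<open>a \<star> y0\<close> run over the orbit of (S0, i0, w0), and
  its two summands give \<open>E\<close> and \<open>E'\<close>. The stabilizer has order (card R0)!
  (k - 1)!; dividing the scalar of \<open>a_y0_a_b\<close> by it leaves k + 1.\<close>

lemma sum_triples:
  "(\<Sum>(S, i, w)\<in>{(S, i, w). S \<subseteq> {..<n} \<and> card S = k \<and> i < n \<and> i \<notin> S \<and> w \<in> S}. E S i + E' S i w)
    = kappa * of_nat (k + 1)"
proof -
  define F where "F = (\<lambda>(S, i, w). E S i + E' S i w)"
  let ?T = "{(T, j, v). T \<subseteq> {..<n} \<and> card T = k \<and> j < n \<and> j \<notin> T \<and> v \<in> T}"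
  define act :: "(nat \<Rightarrow> nat) \<Rightarrow> nat set \<times> nat \<times> nat \<Rightarrow> nat set \<times> nat \<times> nat"
    where "act \<tau> = (\<lambda>(S, i, w). (\<tau> ` S, \<tau> i, \<tau> w))" for \<tau>
  have ay: "a \<star> y0 = block_elem R0 S0 + t0 \<star> block_elem R0 S0"
    unfolding a_split by (simp add: gmult_add_left gmult_assoc block_elem_split[OF R0_sub S0 disj])
  have conj: "(gelem \<tau> \<star> (a \<star> y0) \<star> gelem (inv \<tau>) \<star> cc) id = F (act \<tau> (S0, i0, w0))" if \<tau>: "\<tau> \<in> G" for \<tau>
  proof -
    have inv: "inv \<tau> \<in> G" using \<tau> by simp
    have tn: "\<tau> w0 < n" "\<tau> i0 < n" using G_less[OF \<tau>] w0_n i0 by auto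
    have "\<tau> ` {..<n} = {..<n}" using \<tau> permutes_image by (auto simp: sym_group_def)
    then have R: "\<tau> ` R0 = {..<n} - \<tau> ` S0 - {\<tau> i0}"
      unfolding R0 image_set_diff[OF sym_group_inj[OF \<tau>]] by simp
    have "\<tau> \<circ> transpose w0 i0 = transpose (\<tau> w0) (\<tau> i0) \<circ> \<tau>"
      using conj_transpose[OF \<tau>, of "\<tau> w0" "\<tau> i0"] \<tau> by simp
    then have tr: "gelem \<tau> \<star> t0 = gelem (transpose (\<tau> w0) (\<tau> i0)) \<star> gelem \<tau>"
      using \<tau> t0_G tn by (simp add: gmult_gelem_gelem)
    let ?e = "block_elem R0 S0"
    have "gelem \<tau> \<star> (a \<star> y0) \<star> gelem (inv \<tau>)
       = gelem \<tau> \<star> ?e \<star> gelem (inv \<tau>) + gelem \<tau> \<star> t0 \<star> ?e \<star> gelem (inv \<tau>)"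
      unfolding ay by (simp only: gmult_add_left gmult_add_right gmult_assoc)
    also have "\<dots> = gelem \<tau> \<star> ?e \<star> gelem (inv \<tau>) + gelem (transpose (\<tau> w0) (\<tau> i0)) \<star> (gelem \<tau> \<star> ?e \<star> gelem (inv \<tau>))"
      unfolding tr by (simp only: gmult_assoc)
    finally show ?thesis
      unfolding block_elem_conj[OF \<tau> R0_sub S0] R by (simp add: F_def act_def E_def E'_def gmult_add_left)
  qed
  have stab: "{\<sigma> \<in> G. act \<sigma> (S0, i0, w0) = (S0, i0, w0)} = block_perms R0 (S0 - {w0})"
  proof
    show "{\<sigma> \<in> G. act \<sigma> (S0, i0, w0) = (S0, i0, w0)} \<subseteq> block_perms R0 (S0 - {w0})"
    proof
      fix \<sigma> assume "\<sigma> \<in> {\<sigma> \<in> G. act \<sigma> (S0, i0, w0) = (S0, i0, w0)}"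
      then have \<sigma>: "\<sigma> permutes {..<n}" "\<sigma> ` S0 = S0" "\<sigma> i0 = i0" "\<sigma> w0 = w0" by (auto simp: act_def sym_group_def)
      have "\<sigma> permutes (R0 \<union> (S0 - {w0}))"
        by (rule permutes_superset[OF \<sigma>(1)]) (use \<sigma>(3,4) in \<open>auto simp: R0\<close>)
      moreover have "\<sigma> ` (S0 - {w0}) = S0 - {w0}"
        using image_set_diff[OF permutes_inj[OF \<sigma>(1)], of S0 "{w0}"] \<sigma>(2,4) by simp
      ultimately show "\<sigma> \<in> block_perms R0 (S0 - {w0})" by (simp add: block_perms_def)
    qed
    show "block_perms R0 (S0 - {w0}) \<subseteq> {\<sigma> \<in> G. act \<sigma> (S0, i0, w0) = (S0, i0, w0)}"
    proof
      fix \<sigma> assume s: "\<sigma> \<in> block_perms R0 (S0 - {w0})"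
      note b = block_perms_insert[OF s w0 w0_R0]
      have "\<sigma> i0 = i0" using b(2) i0 i0_R0 by (intro permutes_not_in[of \<sigma> "R0 \<union> S0"]) (auto simp: block_perms_def)
      then show "\<sigma> \<in> {\<sigma> \<in> G. act \<sigma> (S0, i0, w0) = (S0, i0, w0)}"
        using b block_perms_sym_group[OF R0_sub S0 b(2)] by (simp add: act_def block_perms_def)
    qed
  qed
  have card_stab: "card (block_perms R0 (S0 - {w0})) = fact (card R0) * fact (k - 1)"
    using card_block_perms[OF finite_R0, of "S0 - {w0}"] finite_S0 disj w0 card_S0 by auto
  have "kappa * (fact (card R0) * (fact k + fact (k - 1))) = (\<Sum>\<tau>\<in>G. (gelem \<tau> \<star> (a \<star> y0) \<star> gelem (inv \<tau>) \<star> cc) id)"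
    by (rule sum_conj_cc[OF _ a_y0_a_b, symmetric]) (simp add: block_elem_in_group_algebra S0)
  also have "\<dots> = (\<Sum>\<tau>\<in>G. F (act \<tau> (S0, i0, w0)))" by (rule sum.cong) (simp_all add: conj)
  also have "\<dots> = of_nat (card {\<sigma> \<in> G. act \<sigma> (S0, i0, w0) = (S0, i0, w0)}) *
      (\<Sum>s\<in>{(T, j, v). T \<subseteq> {..<n} \<and> card T = card S0 \<and> j < n \<and> j \<notin> T \<and> v \<in> T}. F s)"
  proof (rule orbit_sum)
    show "act (\<sigma> \<circ> \<tau>) s = act \<sigma> (act \<tau> s)" for \<sigma> \<tau> s
      by (cases s) (simp add: act_def image_comp)
    show "act id s = s" for s by (cases s) (simp add: act_def)
    show "(\<lambda>\<tau>. act \<tau> (S0, i0, w0)) ` G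
      = {(T, j, v). T \<subseteq> {..<n} \<and> card T = card S0 \<and> j < n \<and> j \<notin> T \<and> v \<in> T}"
      unfolding act_def prod.case by (rule orbit_triples[OF S0 i0 w0])
  qed
  finally have eq: "kappa * (fact (card R0) * (fact k + fact (k - 1))) = fact (card R0) * fact (k - 1) * (\<Sum>s\<in>?T. F s)"
    by (simp only: stab card_stab card_S0 of_nat_mult of_nat_fact)
  have "fact k = of_nat k * (fact (k - 1) :: complex)" using k_pos by (simp add: fact_reduce)
  then have "fact (card R0) * fact (k - 1) * (kappa * of_nat (k + 1)) = kappa * (fact (card R0) * (fact k + fact (k - 1)))"
    by (simp add: algebra_simps)
  also note eq
  finally have e: "fact (card R0) * fact (k - 1) * (kappa * of_nat (k + 1)) = fact (card R0) * fact (k - 1) * (\<Sum>s\<in>?T. F s)" .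
  have "fact (card R0) * fact (k - 1) \<noteq> (0 :: complex)" by simp
  then have "(\<Sum>s\<in>?T. F s) = kappa * of_nat (k + 1)"
    using mult_left_cancel[THEN iffD1, OF _ e] by simp
  then show ?thesis by (simp only: F_def)
qed

text \<open>With fewer than k points in S, the symmetrized block has more than
  \<open>card R0\<close> points, hence more points than there are columns.\<close>

lemma E_eq_0:
  assumes "S \<subseteq> {..<n} - {i}" "i < n" "card S < k"
  shows "E S i = 0"
proof -
  have S: "S \<subseteq> {..<n}" "i \<notin> S" "finite S" using assms(1) finite_subset by auto
  have "k < n" using card_mono[of "{..<n} - {i0}" S0] S0 i0 card_S0 by fastforce
  moreover have "card ({..<n} - S - {i}) = n - card S - 1" using S assms(2) by (simp add: card_Diff_subset)
  ultimately have "block_elem ({..<n} - S - {i}) S \<star> cc = 0"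
    using assms(3) cols card_R0 S by (intro block_elem_cc_eq_0) auto
  then show ?thesis by (simp add: E_def)
qed

lemma alt2_part:
  "(\<Sum>\<sigma>\<in>G. of_int (fixpts n \<sigma> * Phi n (alt2_wt (int k)) \<sigma>) * cc (inv \<sigma>))
    = (\<Sum>i<n. \<Sum>S | S \<subseteq> {..<n} - {i} \<and> card S = k. E S i)"
proof -
  have "(\<Sum>\<sigma>\<in>G. of_int (fixpts n \<sigma> * Phi n (alt2_wt (int k)) \<sigma>) * cc (inv \<sigma>))
    = (\<Sum>i<n. \<Sum>S | S \<subseteq> {..<n} - {i}. of_int (alt_wt (int k) (card S)) * E S i)"
    unfolding fixpts_Phi_sum alt2_wt_step E_def gmult_id_apply ..
  also have "\<dots> = (\<Sum>i<n. \<Sum>S | S \<subseteq> {..<n} - {i} \<and> card S = k. E S i)"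
  proof (rule sum.cong[OF refl], rule sum.mono_neutral_cong_right)
    fix i assume i: "i \<in> {..<n}"
    show "\<forall>S\<in>{S. S \<subseteq> {..<n} - {i}} - {S. S \<subseteq> {..<n} - {i} \<and> card S = k}.
        of_int (alt_wt (int k) (card S)) * E S i = 0"
    proof
      fix S assume S: "S \<in> {S. S \<subseteq> {..<n} - {i}} - {S. S \<subseteq> {..<n} - {i} \<and> card S = k}"
      show "of_int (alt_wt (int k) (card S)) * E S i = 0"
      proof (cases "card S < k")
        case True
        then show ?thesis using E_eq_0[of S i] S i by simp
      next
        case False
        then show ?thesis using S by (auto simp: alt_wt_def)
      qed
    qed
  qed (auto simp: alt_wt_def)
  finally show ?thesis .
qed

lemma delta_part:
  "(\<Sum>\<sigma>\<in>G. of_int (Phi n (delta_wt (int k + 1)) \<sigma>) * cc (inv \<sigma>)) = (\<Sum>W | W \<subseteq> {..<n} \<and> card W = k + 1. EW W)"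
proof -
  have "(\<Sum>\<sigma>\<in>G. of_int (Phi n (delta_wt (int k + 1)) \<sigma>) * cc (inv \<sigma>))
     = (\<Sum>W | W \<subseteq> {..<n}. of_int (delta_wt (int k + 1) (card W)) * EW W)"
    unfolding fixsets_sum_swap EW_def gmult_id_apply ..
  also have "\<dots> = (\<Sum>W | W \<subseteq> {..<n} \<and> card W = k + 1. EW W)"
    by (rule sum.mono_neutral_cong_right) (auto simp: delta_wt_def)
  finally show ?thesis .
qed

text \<open>Each W arises k + 1 times, once for every choice of its point \<open>i\<close>.\<close>

lemma sum_EW_insert:
  "(\<Sum>i<n. \<Sum>S | S \<subseteq> {..<n} - {i} \<and> card S = k. EW (insert i S))
    = of_nat (k + 1) * (\<Sum>W | W \<subseteq> {..<n} \<and> card W = k + 1. EW W)"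
proof -
  have fin: "finite S" if "S \<subseteq> {..<n}" for S using that finite_subset by blast
  have fin2: "finite {S. S \<subseteq> {..<n} - {i} \<and> card S = k}" for i
    by (rule finite_subset[of _ "Pow {..<n}"]) auto
  have "(\<Sum>i<n. \<Sum>S | S \<subseteq> {..<n} - {i} \<and> card S = k. EW (insert i S))
     = (\<Sum>(i, S)\<in>(SIGMA i:{..<n}. {S. S \<subseteq> {..<n} - {i} \<and> card S = k}). EW (insert i S))"
    by (rule sum.Sigma) (use fin2 in auto)
  also have "\<dots> = (\<Sum>(W, i)\<in>(SIGMA W:{W. W \<subseteq> {..<n} \<and> card W = k + 1}. W). EW W)"
    by (rule sum.reindex_bij_witness[of _ "\<lambda>(W, i). (i, W - {i})" "\<lambda>(i, S). (insert i S, i)"])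
      (auto simp: insert_absorb card_insert_if fin subset_Diff_insert)
  also have "\<dots> = (\<Sum>W | W \<subseteq> {..<n} \<and> card W = k + 1. \<Sum>i\<in>W. EW W)"
    by (rule sum.Sigma[symmetric]) (use fin in auto)
  also have "\<dots> = (\<Sum>W | W \<subseteq> {..<n} \<and> card W = k + 1. of_nat (k + 1) * EW W)"
    by (rule sum.cong) auto
  finally show ?thesis by (simp only: sum_distrib_left)
qed

text \<open>Summing \<open>E + E'\<close> over the k points w of S gives k E + (E - EW) by the coset
  splitting. So \<open>sum_triples\<close> reads (k + 1) (?A - ?B), each W being counted k + 1
  times, and k + 1 cancels.\<close>

lemma near_hook_fun_cc: "((\<lambda>\<sigma>. of_int (near_hook_fun n (int k) \<sigma>)) \<star> cc) id = kappa"
proof -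
  let ?A = "\<Sum>i<n. \<Sum>S | S \<subseteq> {..<n} - {i} \<and> card S = k. E S i"
  let ?B = "\<Sum>W | W \<subseteq> {..<n} \<and> card W = k + 1. EW W"
  let ?D = "\<lambda>i. {S. S \<subseteq> {..<n} - {i} \<and> card S = k}"
  have fin2: "finite (?D i)" for i by (rule finite_subset[of _ "Pow {..<n}"]) auto
  have fin: "finite S" if "S \<subseteq> {..<n}" for S using that finite_subset by blast
  have "kappa * of_nat (k + 1) = (\<Sum>(S, i, w)\<in>{(S, i, w). S \<subseteq> {..<n} \<and> card S = k \<and> i < n \<and> i \<notin> S \<and> w \<in> S}. E S i + E' S i w)"
    by (rule sum_triples[symmetric])
  also have "\<dots> = (\<Sum>(i, S, w)\<in>(SIGMA i:{..<n}. SIGMA S:?D i. S). E S i + E' S i w)"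
    by (rule sum.reindex_bij_witness[of _ "\<lambda>(i, S, w). (S, i, w)" "\<lambda>(S, i, w). (i, S, w)"]) auto
  also have "\<dots> = (\<Sum>i<n. \<Sum>(S, w)\<in>(SIGMA S:?D i. S). E S i + E' S i w)"
    by (rule sum.Sigma[symmetric]) (use fin2 fin in \<open>auto intro!: finite_SigmaI\<close>)
  also have "\<dots> = (\<Sum>i<n. \<Sum>S\<in>?D i. \<Sum>w\<in>S. E S i + E' S i w)"
    by (intro sum.cong refl, rule sum.Sigma[symmetric]) (use fin2 fin in auto)
  also have "\<dots> = (\<Sum>i<n. \<Sum>S\<in>?D i. of_nat (k + 1) * E S i - EW (insert i S))"
  proof (intro sum.cong refl)
    fix i S assume iS: "i \<in> {..<n}" "S \<in> ?D i"
    then have "EW (insert i S) = E S i - (\<Sum>w\<in>S. E' S i w)" by (intro EW_insert) auto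
    then show "(\<Sum>w\<in>S. E S i + E' S i w) = of_nat (k + 1) * E S i - EW (insert i S)"
      using iS by (simp add: sum.distrib algebra_simps)
  qed
  also have "\<dots> = of_nat (k + 1) * ?A - of_nat (k + 1) * ?B"
    unfolding sum_subtractf sum_EW_insert by (simp only: sum_distrib_left)
  also have "\<dots> = (?A - ?B) * of_nat (k + 1)" by (simp add: algebra_simps)
  finally have "kappa * of_nat (k + 1) = (?A - ?B) * of_nat (k + 1)" .
  moreover have "of_nat (k + 1) \<noteq> (0 :: complex)" by (rule of_nat_neq_0[of k, unfolded Suc_eq_plus1])
  ultimately have "kappa = ?A - ?B" using mult_right_cancel by blast
  moreover have "((\<lambda>\<sigma>. of_int (near_hook_fun n (int k) \<sigma>)) \<star> cc) id = ?A - ?B"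
    unfolding gmult_id_apply near_hook_fun_def of_int_diff left_diff_distrib sum_subtractf alt2_part delta_part ..
  ultimately show ?thesis by simp
qed

end

section \<open>Kronecker coefficients\<close>

lemma sum_list_take_Suc: "i < length l \<Longrightarrow> sum_list (take (Suc i) l) = sum_list (take i l) + l ! i"
  for l :: "nat list"
  by (simp add: take_Suc_conv_app_nth)

lemma sum_list_take_mono:
  fixes l :: "nat list"
  assumes "i \<le> j"
  shows "sum_list (take i l) \<le> sum_list (take j l)"
proof -
  have "take j l = take i l @ take (j - i) (drop i l)" using assms take_add[of i "j - i" l] by simp
  then show ?thesis by simp
qed

lemma row_col_of_cell:
  assumes "i < length l" "j < l ! i"
  shows "row_of l (sum_list (take i l) + j) = i" "col_of l (sum_list (take i l) + j) = j"
    "sum_list (take i l) + j < sum_list l"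
proof -
  let ?x = "sum_list (take i l) + j"
  show row: "row_of l ?x = i" unfolding row_of_def
  proof (rule Least_equality)
    show "?x < sum_list (take (Suc i) l)" using assms by (simp add: sum_list_take_Suc)
    fix m assume m: "?x < sum_list (take (Suc m) l)"
    show "i \<le> m"
    proof (rule ccontr)
      assume "\<not> i \<le> m"
      then have "sum_list (take (Suc m) l) \<le> sum_list (take i l)" by (intro sum_list_take_mono) simp
      then show False using m by simp
    qed
  qed
  show "col_of l ?x = j" by (simp add: col_of_def row)
  have "?x < sum_list (take (Suc i) l)" using assms by (simp add: sum_list_take_Suc)
  also have "\<dots> \<le> sum_list (take (length l) l)" using assms by (intro sum_list_take_mono) simp
  finally show "?x < sum_list l" by simp
qed

lemma cell_of:
  assumes "x < sum_list l"
  shows "row_of l x < length l" "col_of l x < l ! row_of l x" "x = sum_list (take (row_of l x) l) + col_of l x"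
proof -
  let ?i = "row_of l x"
  \<comment> \<open>Taking more elements than there are returns the whole list; this supplies the
    existence that \<open>LeastI\<close> requires.\<close>
  have "x < sum_list (take (Suc (length l)) l)" using assms by simp
  then have lt: "x < sum_list (take (Suc ?i) l)" unfolding row_of_def by (rule LeastI)
  have ge: "sum_list (take ?i l) \<le> x"
  proof (cases ?i)
    case (Suc m)
    then have "\<not> x < sum_list (take (Suc m) l)" using not_less_Least[of m "\<lambda>i. x < sum_list (take (Suc i) l)"]
      by (simp add: row_of_def)
    then show ?thesis using Suc by simp
  qed simp
  show "x = sum_list (take ?i l) + col_of l x" using ge by (simp add: col_of_def)
  show len: "?i < length l" using ge assms by (cases "?i < length l") simp_all
  show "col_of l x < l ! ?i" using lt ge len by (simp add: col_of_def sum_list_take_Suc)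
qed

lemma young_data_list: "young_data (sum_list l) (row_of l) (col_of l)"
proof
  show "inj_on (\<lambda>x. (row_of l x, col_of l x)) {..<sum_list l}"
    by (rule inj_onI) (metis cell_of(3) lessThan_iff prod.inject)
  fix x j assume x: "x < sum_list l" "j \<le> col_of l x"
  then have "row_of l x < length l" "j < l ! row_of l x" using cell_of[OF x(1)] by auto
  from row_col_of_cell[OF this] show "\<exists>y<sum_list l. row_of l y = row_of l x \<and> col_of l y = j" by blast
qed

lemma irr_char_chi:
  assumes "\<sigma> \<in> sym_group (sum_list l)"
  shows "irr_char l \<sigma> = young_data.chi (sum_list l) (row_of l) (col_of l) \<sigma>"
proof -
  interpret young_data "sum_list l" "row_of l" "col_of l" by (rule young_data_list)
  have P: "row_group l = P" by (simp add: row_group_def P_def)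
  have Q: "col_group l = Q" by (simp add: col_group_def Q_def)
  have cc: "young_symmetrizer l = cc" by (simp add: young_symmetrizer_def P Q cc_def a_def b_def)
  have "specht l = ideal" by (simp add: specht_def ideal_def cc)
  then show ?thesis using trace_on_ideal[OF assms] by (simp add: irr_char_def)
qed

section \<open>Identification of the characters of hooks and near hooks\<close>

lemma irr_char_hook:
  assumes "a > 0" "\<sigma> \<in> sym_group (a + b)"
  shows "irr_char (a # replicate b 1) \<sigma> = of_int (hook_fun (a + b) (int b) \<sigma>)"
proof -
  define l where "l = a # replicate b (1::nat)"
  have n: "sum_list l = a + b" by (simp add: l_def sum_list_replicate)
  have low: "row_of l x = 0" "col_of l x = x" if "x < a" for x
    using row_col_of_cell[of 0 l x] that by (simp_all add: l_def)
  have high: "row_of l x = Suc (x - a)" "col_of l x = 0" if "a \<le> x" "x < a + b" for x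
  proof -
    define m where "m = x - a"
    have m: "x = a + m" "m < b" using that by (auto simp: m_def)
    have "Suc m < length l" "l ! Suc m = 1" "sum_list (take (Suc m) l) = a + m"
      using m by (simp_all add: l_def sum_list_replicate)
    then show "row_of l x = Suc (x - a)" "col_of l x = 0"
      using row_col_of_cell[of "Suc m" l 0] by (simp_all add: m)
  qed
  interpret young_data "a + b" "row_of l" "col_of l" using young_data_list[of l] by (simp only: n)
  have P_eq: "P = {p. p permutes {..<a}}"
  proof
    show "P \<subseteq> {p. p permutes {..<a}}"
    proof
      fix p assume p: "p \<in> P"
      have "p x = x" if "x \<in> {..<a + b} - {..<a}" for x
      proof -
        have x: "a \<le> x" "x < a + b" using that by auto
        have "p x < a + b" "row_of l (p x) = row_of l x" using G_less[OF P_G[OF p]] p x by (auto simp: P_def)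
        then show ?thesis using high[OF x] high[of "p x"] low[of "p x"] x by (cases "p x < a") auto
      qed
      moreover have pn: "p permutes {..<a + b}" using P_G[OF p] by (simp add: sym_group_def)
      ultimately have "p permutes {..<a}" by (intro permutes_superset[OF pn])
      then show "p \<in> {p. p permutes {..<a}}" by simp
    qed
    show "{p. p permutes {..<a}} \<subseteq> P"
    proof
      fix p assume "p \<in> {p. p permutes {..<a}}"
      then have p: "p permutes {..<a}" by simp
      have "row_of l (p x) = row_of l x" for x
        using permutes_in_image[OF p, of x] permutes_not_in[OF p, of x] low[of x] low[of "p x"] by (cases "x < a") auto
      moreover have "p permutes {..<a + b}" by (rule permutes_subset[OF p]) auto
      ultimately show "p \<in> P" by (simp add: P_def sym_group_def)
    qed
  qed
  interpret hook_data "a + b" "row_of l" "col_of l" "{a..<a + b}" "{..<a}"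
  proof
    show "col_of l x = col_of l y" if "x \<in> {a..<a + b}" "y \<in> {a..<a + b}" for x y
      using that high(2) by simp
    have "col_of l x < a" if "x < a + b" for x
      using low(2)[of x] high(2)[of x] assms(1) that by (cases "x < a") auto
    then have "col_of l ` {..<a + b} \<subseteq> {..<a}" by auto
    then have "card (col_of l ` {..<a + b}) \<le> card {..<a}" by (intro card_mono) auto
    then show "card (col_of l ` {..<a + b}) \<le> card {..<a}" .
  qed (use P_eq in auto)
  have pos: "a + b > 0" using assms(1) by simp
  have "chi \<sigma> = of_int (hook_fun (a + b) (int b) \<sigma>)"
  proof (rule chi_eqI[OF _ _ _ assms(2)])
    \<comment> \<open>Leg 0 gives the trivial character, so the norm is a triple product of
      hooks.\<close>
    show "(\<Sum>\<sigma>\<in>G. hook_fun (a + b) (int b) \<sigma> * hook_fun (a + b) (int b) \<sigma>) = fact (a + b)"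
      using sum_hook_fun3[OF pos, of "int b" "int b" 0] assms(1)
      by (simp add: hook_fun_0 hook_triple_def triangle_ind_def)
    show "gmult (a + b) (\<lambda>\<sigma>. of_int (hook_fun (a + b) (int b) \<sigma>)) cc id = kappa"
      using hook_fun_cc by simp
  qed (simp only: Phi_conj)
  moreover have "irr_char l \<sigma> = chi \<sigma>" using irr_char_chi[of \<sigma> l] assms(2) by (simp only: n)
  ultimately show ?thesis by (simp only: l_def)
qed

lemma irr_char_near_hook:
  assumes "k \<ge> 2" "\<sigma> \<in> sym_group (2 * k + 2)"
  shows "irr_char ((k + 1) # 2 # replicate (k - 1) 1) \<sigma> = of_int (near_hook_fun (2 * k + 2) (int k) \<sigma>)"
proof -
  define l where "l = (k + 1) # 2 # replicate (k - 1) (1::nat)"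
  define n where "n = 2 * k + 2"
  have n: "sum_list l = n" using assms(1) by (simp add: l_def n_def sum_list_replicate)
  have low: "row_of l x = 0" "col_of l x = x" if "x < k + 1" for x
    using row_col_of_cell[of 0 l x] that by (simp_all add: l_def)
  have mid: "row_of l (k + 1) = 1" "col_of l (k + 1) = 0" "row_of l (k + 2) = 1" "col_of l (k + 2) = 1"
    using row_col_of_cell[of 1 l 0] row_col_of_cell[of 1 l 1] by (simp_all add: l_def)
  have high: "row_of l x = x - k - 1" "col_of l x = 0" if "k + 3 \<le> x" "x < n" for x
  proof -
    define m where "m = x - k - 3"
    have x: "x = k + 3 + m" "m < k - 1" using that by (auto simp: m_def n_def)
    have "Suc (Suc m) < length l" "l ! Suc (Suc m) = 1" "sum_list (take (Suc (Suc m)) l) = k + 3 + m"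
      using x by (simp_all add: l_def sum_list_replicate)
    then show "row_of l x = x - k - 1" "col_of l x = 0"
      using row_col_of_cell[of "Suc (Suc m)" l 0] by (simp_all add: x)
  qed
  have kn: "k + 2 < n" using assms(1) by (simp add: n_def)
  have row_cases: "x < k + 1 \<or> x = k + 1 \<or> x = k + 2 \<or> k + 3 \<le> x" for x by linarith
  have row_inj: "y = x" if "k + 3 \<le> x" "x < n" "y < n" "row_of l y = row_of l x" for x y
    using row_cases[of y] high(1)[OF that(1,2)] low(1)[of y] mid high(1)[of y] that by auto
  have row1: "y = k + 1 \<or> y = k + 2" if "y < n" "row_of l y = 1" for y
    using row_cases[of y] low(1)[of y] high(1)[of y] that by auto
  interpret young_data n "row_of l" "col_of l" using young_data_list[of l] by (simp only: n)
  \<comment> \<open>Entries 0 to k fill the first row, k + 1 and k + 2 the second, and the others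
    are single cells. Thus \<open>w0\<close> is k + 1, \<open>i0\<close> is k + 2, and
    \<open>?S\<close> is the first column below the corner.\<close>
  let ?S = "insert (k + 1) {k + 3..<n}"
  let ?t = "transpose (k + 1) (k + 2)"
  have P_eq: "P = {p. p permutes {..<k + 1}} \<union> (\<lambda>p. ?t \<circ> p) ` {p. p permutes {..<k + 1}}"
  proof
    show "P \<subseteq> {p. p permutes {..<k + 1}} \<union> (\<lambda>p. ?t \<circ> p) ` {p. p permutes {..<k + 1}}"
    proof
      fix p assume p: "p \<in> P"
      have pn: "p permutes {..<n}" using P_G[OF p] by (simp add: sym_group_def)
      have row: "p x < n" "row_of l (p x) = row_of l x" if "x < n" for x
        using p G_less[OF P_G[OF p] that] that by (auto simp: P_def)
      have fix_high: "p x = x" if "k + 3 \<le> x" "x < n" for x using row_inj[OF that row[OF that(2)]] .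
      have img: "p (k + 1) = k + 1 \<or> p (k + 1) = k + 2" "p (k + 2) = k + 1 \<or> p (k + 2) = k + 2"
        using row1[OF row(1)] row(2) mid kn by simp_all
      have ne: "p (k + 1) \<noteq> p (k + 2)" using permutes_inj[OF pn] by (simp add: inj_eq)
      show "p \<in> {p. p permutes {..<k + 1}} \<union> (\<lambda>p. ?t \<circ> p) ` {p. p permutes {..<k + 1}}"
      proof (cases "p (k + 1) = k + 1")
        case True
        have "p x = x" if "x \<in> {..<n} - {..<k + 1}" for x
          using row_cases[of x] that True img ne fix_high[of x] by auto
        then have "p permutes {..<k + 1}" by (intro permutes_superset[OF pn]) auto
        then show ?thesis by blast
      next
        case False
        have tp: "?t \<circ> p permutes {..<n}" using pn kn by (intro permutes_compose permutes_swap_id) auto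
        have "(?t \<circ> p) x = x" if "x \<in> {..<n} - {..<k + 1}" for x
          using row_cases[of x] that False img ne fix_high[of x] by (auto simp: transpose_def)
        then have "?t \<circ> p permutes {..<k + 1}" by (intro permutes_superset[OF tp]) auto
        moreover have "p = ?t \<circ> (?t \<circ> p)" by (simp add: fun_eq_iff)
        ultimately show ?thesis by blast
      qed
    qed
    have sub: "p \<in> P" if p: "p permutes {..<k + 1}" for p
    proof -
      have "row_of l (p x) = row_of l x" for x
        using permutes_in_image[OF p, of x] permutes_not_in[OF p, of x] low[of x] low[of "p x"] by (cases "x < k + 1") auto
      moreover have "p permutes {..<n}" by (rule permutes_subset[OF p]) (use kn in auto)
      ultimately show ?thesis by (simp add: P_def sym_group_def)
    qed
    moreover have "?t \<in> P" using transpose_P[of "k + 1" "k + 2"] kn mid by simp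
    ultimately show "{p. p permutes {..<k + 1}} \<union> (\<lambda>p. ?t \<circ> p) ` {p. p permutes {..<k + 1}} \<subseteq> P"
      using P_comp by blast
  qed
  have S_col: "col_of l x = 0" if "x \<in> ?S" for x using that mid high(2)[of x] by auto
  interpret near_hook_data n "row_of l" "col_of l" ?S "{..<k + 1}" "k + 2" "k + 1" k
  proof
    show "?S \<subseteq> {..<n}" "k + 2 < n" using kn by auto
    show "k + 2 \<notin> ?S" "k + 1 \<in> ?S" by auto
    show "{..<k + 1} = {..<n} - ?S - {k + 2}" using kn by auto
    show "card ?S = k" using assms(1) by (simp add: n_def)
    show "col_of l x = col_of l y" if "x \<in> ?S" "y \<in> ?S" for x y using S_col that by simp
    show "row_of l (k + 1) = row_of l (k + 2)" using mid by simp
    have "col_of l x < k + 1" if "x < n" for x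
      using row_cases[of x] low(2)[of x] mid high(2)[of x] that assms(1) by auto
    then have "col_of l ` {..<n} \<subseteq> {..<k + 1}" by auto
    then show "card (col_of l ` {..<n}) \<le> card {..<k + 1}" by (rule card_mono[rotated]) simp
  qed (rule P_eq)
  have \<sigma>: "\<sigma> \<in> G" using assms(2) by (simp add: n_def)
  have "chi \<sigma> = of_int (near_hook_fun n (int k) \<sigma>)"
  proof (rule chi_eqI[OF _ _ near_hook_fun_cc \<sigma>])
    \<comment> \<open>The norm is the multiplicity for leg 0, where \<open>near_hook_mult\<close> is
      1.\<close>
    show "(\<Sum>\<sigma>\<in>G. near_hook_fun n (int k) \<sigma> * near_hook_fun n (int k) \<sigma>) = fact n"
      using sum_near_hook_fun[of k 0] near_hook_mult_eq[of "int k" 0] assms(1)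
      by (simp add: hook_fun_0 n_def Let_def del: fact_Suc)
  qed (simp only: near_hook_fun_conj)
  moreover have "irr_char l \<sigma> = chi \<sigma>" using irr_char_chi[of \<sigma> l] \<sigma> by (simp only: n)
  ultimately show ?thesis by (simp only: l_def n_def)
qed

text \<open>A later part of size at least 2 forces the first two parts to be at least 2, so the
  diagram contains a 2 x 2 square.\<close>

lemma hook_of_durfee:
  assumes "l \<in> partitions n" "n > 0" "durfee l = 1"
  obtains a b where "l = a # replicate b 1"
proof -
  have l: "sorted_wrt (\<ge>) l" "0 \<notin> set l" "sum_list l = n" using assms(1) by (auto simp: partitions_def)
  obtain a l' where al: "l = a # l'" using l(3) assms(2) by (cases l) auto
  have "x = 1" if x: "x \<in> set l'" for x
  proof (rule ccontr)
    assume "x \<noteq> 1"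
    then have x2: "x \<ge> 2" using l(2) al x by (cases x; cases "x - 1") auto
    obtain y l'' where l': "l' = y # l''" using x by (cases l') auto
    have "y \<ge> x" "a \<ge> y" using l(1) x by (auto simp: al l')
    then have sq: "{..<2} \<times> {..<2} \<subseteq> diagram l"
      using x2 by (auto simp: diagram_def al l' less_2_cases_iff)
    \<comment> \<open>The maximum in \<open>durfee\<close> is taken over a bounded property: column
      0 limits d to the number of rows.\<close>
    have bound: "d \<le> length l" if "{..<d} \<times> {..<d} \<subseteq> diagram l" for d
    proof (rule ccontr)
      assume "\<not> d \<le> length l"
      then have "(length l, 0) \<in> {..<d} \<times> {..<d}" by auto
      then show False using that by (auto simp: diagram_def)
    qed
    have "2 \<le> durfee l" unfolding durfee_def
      by (rule Greatest_le_nat[where b = "length l"]) (use sq bound in auto)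
    then show False using assms(3) by simp
  qed
  then have "l' = replicate (length l') 1" by (metis replicate_eqI)
  then show ?thesis using that al by metis
qed

lemma kronecker_near_hook:
  assumes "k \<ge> 2" "a # replicate b 1 \<in> partitions (2 * k + 2)"
  shows "kronecker ((k + 1) # 2 # replicate (k - 1) 1) ((k + 1) # 2 # replicate (k - 1) 1) (a # replicate b 1)
    = of_int (near_hook_mult (int k) (int b))" (is "kronecker ?g ?g ?l = _")
proof -
  have ab: "a > 0" "a + b = 2 * k + 2" using assms(2) by (auto simp: partitions_def sum_list_replicate)
  have n: "sum_list ?g = 2 * k + 2" using assms(1) by (simp add: sum_list_replicate)
  let ?N = "near_hook_fun (2 * k + 2) (int k)" and ?H = "hook_fun (2 * k + 2) (int b)"
  have "kronecker ?g ?g ?l = (\<Sum>\<sigma>\<in>sym_group (2 * k + 2). of_int (?N \<sigma> * ?N \<sigma> * ?H \<sigma>)) / fact (2 * k + 2)"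
    unfolding kronecker_def char_inner_def n
  proof (intro arg_cong2[where f = "(/)"] sum.cong refl)
    fix \<sigma> assume \<sigma>: "\<sigma> \<in> sym_group (2 * k + 2)"
    have "irr_char ?l \<sigma> = of_int (?H \<sigma>)" using irr_char_hook[OF ab(1), of \<sigma> b] \<sigma> unfolding ab(2) .
    \<comment> \<open>The characters are integer-valued, so complex conjugation has no
      effect.\<close>
    then show "irr_char ?g \<sigma> * cnj (irr_char ?g \<sigma> * irr_char ?l \<sigma>) = of_int (?N \<sigma> * ?N \<sigma> * ?H \<sigma>)"
      unfolding irr_char_near_hook[OF assms(1) \<sigma>]
      by (simp only: complex_cnj_mult complex_cnj_of_int of_int_mult mult.assoc)
  qed
  also have "\<dots> = of_int (fact (2 * k + 2) * near_hook_mult (int k) (int b)) / fact (2 * k + 2)"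
    using sum_near_hook_fun[of k "int b"] assms(1) by (simp only: of_int_sum[symmetric])
  finally show ?thesis
    by (simp only: of_int_mult of_int_fact nonzero_mult_div_cancel_left[OF fact_nonzero])
qed

theorem proposition4p7:
  fixes k :: nat and \<gamma> :: "nat list"
  assumes "k \<ge> 2"
    and "\<gamma> = (k + 1) # 2 # replicate (k - 1) 1"
  shows "(\<forall>l \<in> partitions (2 * k + 2). durfee l = 1 \<longrightarrow> kronecker \<gamma> \<gamma> l \<noteq> 0) \<and>
    (\<forall>l \<in> partitions (2 * k + 2). \<forall>a b. l = a # replicate b 1 \<and> a > b \<longrightarrow>
      kronecker \<gamma> \<gamma> l =
        (if b = 0 then 1 else if b = 1 then 2 else if b = 2 then 4 else 6))"
proof (intro conjI ballI impI allI)
  fix l assume l: "l \<in> partitions (2 * k + 2)" "durfee l = 1"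
  obtain a b where ab: "l = a # replicate b 1" by (rule hook_of_durfee[OF l(1) _ l(2)]) simp_all
  have "a > 0" "a + b = 2 * k + 2" using l(1) by (auto simp: ab partitions_def sum_list_replicate)
  then have "near_hook_mult (int k) (int b) \<noteq> 0"
    using near_hook_mult_eq[of "int k" "int b"] assms(1) by (auto simp: Let_def)
  then show "kronecker \<gamma> \<gamma> l \<noteq> 0"
    using kronecker_near_hook[OF assms(1), of a b] l(1) by (simp add: assms(2) ab)
next
  fix l a b assume l: "l \<in> partitions (2 * k + 2)" and ab: "l = a # replicate b 1 \<and> a > b"
  then have s: "a + b = 2 * k + 2" by (auto simp: partitions_def sum_list_replicate)
  \<comment> \<open>As a + b = 2k + 2, the condition a > b means b \<le> k, so the minimum of b and
    2k + 1 - b is b.\<close>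
  then have "near_hook_mult (int k) (int b) = (if b = 0 then 1 else if b = 1 then 2 else if b = 2 then 4 else 6)"
    using near_hook_mult_eq[of "int k" "int b"] assms(1) ab by (auto simp: Let_def min_def)
  then show "kronecker \<gamma> \<gamma> l = (if b = 0 then 1 else if b = 1 then 2 else if b = 2 then 4 else 6)"
    using kronecker_near_hook[OF assms(1), of a b] l ab by (simp add: assms(2))
qed

end
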